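(* Consider real-valued, normalized, spherically symmetric bipartite wave functions $\psi(x,y)=\Psi(\sqrt{x^2+y^2})$, $\int_{\mathbf{R}^2}\psi^2\,dx\,dy=1$. The infimum of the uncertainty product $\sigma_{xp}\sigma_{px}$ over all such wave functions equals $1/8$, and this infimum is not attained. Moreover, for $0<\xi<1$ the functions $$\psi_\xi(x,y)=\frac{1}{\sqrt{2K(\xi)(1-\xi)}}\exp\left(-\frac{1+\xi}{1-\xi}\,\frac{x^2+y^2}{2}\right) I_0\left(\frac{\sqrt{\xi}}{1-\xi}(x^2+y^2)\right)$$ are normalized wave functions of this class, and for them $$\sigma_{xp}\sigma_{px}=\frac14+\frac14\left(-\frac{1}{1+\xi}+\frac{1}{(1+\xi)^2}\frac{E(\xi)}{K(\xi)}\right);$$ in particular $\sigma_{xp}\sigma_{px}<1/4$ for all $0<\xi<1$, and $\sigma_{xp}\sigma_{px}\to 1/8$ as $\xi\to1$.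
   Context: Units are such that $\hat p=-i\,d/dx$. For a bipartite pure state with wave function $\psi(x,y)\in L^2(\mathbf{R}^2)$ (first variable for part $a$, second for part $b$), $\sigma_{xp}$ is the standard deviation of $\hat x_a\hat p_b=-ix\,\partial/\partial y$ and $\sigma_{px}$ that of $\hat p_a\hat x_b=-iy\,\partial/\partial x$, where the standard deviation of $\hat X$ is $\sqrt{\langle\hat X^2\rangle-\langle\hat X\rangle^2}$ with $\langle\hat X^2\rangle=\|\hat X\psi\|^2$. Only wave functions for which both standard deviations are finite (i.e. $x\,\partial_y\psi$ and $y\,\partial_x\psi$ are square-integrable) are considered. $K(\xi)=\int_0^{\pi/2}\frac{d\theta}{\sqrt{1-\xi^2\sin^2\theta}}$ and $E(\xi)=\int_0^{\pi/2}\sqrt{1-\xi^2\sin^2\theta}\,d\theta$ are the complete elliptic integrals of the first and second kind (with modulus $\xi$), and $I_0(z)=\sum_{n\geqslant0}\frac{z^{2n}}{2^{2n}(n!)^2}$ is the modified Bessel function of the first kind. *)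

theory Defs
  imports "HOL-Analysis.Analysis"
begin

text \<open>
  Vectors of the Hilbert space of square-integrable functions on the plane are represented by
  functions on \<^typ>\<open>real \<times> real\<close>; functions that agree almost everywhere are not
  identified, but all quantities below only depend on the class of the function.
\<close>

definition square_integrable :: "(real \<times> real \<Rightarrow> complex) \<Rightarrow> bool" where
  "square_integrable f \<longleftrightarrow>
     f \<in> borel_measurable lborel \<and> integrable lborel (\<lambda>z. (cmod (f z))\<^sup>2)"

definition norm2_sq :: "(real \<times> real \<Rightarrow> complex) \<Rightarrow> real" where
  "norm2_sq f = (LINT z|lborel. (cmod (f z))\<^sup>2)"

definition inner2 :: "(real \<times> real \<Rightarrow> complex) \<Rightarrow> (real \<times> real \<Rightarrow> complex) \<Rightarrow> complex" where
  "inner2 f g = (LINT z|lborel. cnj (f z) * g z)"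

definition deriv_fst :: "(real \<times> real \<Rightarrow> real) \<Rightarrow> real \<times> real \<Rightarrow> real" where
  "deriv_fst \<phi> z = deriv (\<lambda>s. \<phi> (s, snd z)) (fst z)"

definition deriv_snd :: "(real \<times> real \<Rightarrow> real) \<Rightarrow> real \<times> real \<Rightarrow> real" where
  "deriv_snd \<phi> z = deriv (\<lambda>t. \<phi> (fst z, t)) (snd z)"

text \<open>
  Smoothness is expressed by the family \<open>D\<close> of all iterated partial derivatives: \<open>D m n\<close> is the
  derivative of order \<open>m\<close> in the first and \<open>n\<close> in the second variable.
\<close>

definition smooth_plane :: "(real \<times> real \<Rightarrow> real) \<Rightarrow> bool" where
  "smooth_plane \<phi> \<longleftrightarrow>
     (\<exists>D :: nat \<Rightarrow> nat \<Rightarrow> real \<times> real \<Rightarrow> real.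
        D 0 0 = \<phi> \<and>
        (\<forall>m n. continuous_on UNIV (D m n) \<and>
           (\<forall>x y. ((\<lambda>s. D m n (s, y)) has_real_derivative D (Suc m) n (x, y)) (at x) \<and>
                  ((\<lambda>t. D m n (x, t)) has_real_derivative D m (Suc n) (x, y)) (at y))))"

definition test_function :: "(real \<times> real \<Rightarrow> real) \<Rightarrow> bool" where
  "test_function \<phi> \<longleftrightarrow> smooth_plane \<phi> \<and> compact (closure {z. \<phi> z \<noteq> 0})"

text \<open>
  \<open>is_xp \<psi> \<eta>\<close> means that \<open>\<eta>\<close> is square-integrable and \<open>\<eta> = - \<i> x \<partial>\<psi>/\<partial>y\<close>, and \<open>is_px \<psi> \<eta>\<close> that
  \<open>\<eta>\<close> is square-integrable and \<open>\<eta> = - \<i> y \<partial>\<psi>/\<partial>x\<close>, with derivatives in the sense of distributions.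
  Real test functions are enough, by linearity. The domains obtained in this way are those of the
  self-adjoint operators.
\<close>

definition is_xp :: "(real \<times> real \<Rightarrow> complex) \<Rightarrow> (real \<times> real \<Rightarrow> complex) \<Rightarrow> bool" where
  "is_xp \<psi> \<eta> \<longleftrightarrow> square_integrable \<eta> \<and>
     (\<forall>\<phi>. test_function \<phi> \<longrightarrow>
        (LINT z|lborel. complex_of_real (\<phi> z) * \<eta> z) =
        \<i> * (LINT z|lborel. complex_of_real (fst z * deriv_snd \<phi> z) * \<psi> z))"

definition is_px :: "(real \<times> real \<Rightarrow> complex) \<Rightarrow> (real \<times> real \<Rightarrow> complex) \<Rightarrow> bool" where
  "is_px \<psi> \<eta> \<longleftrightarrow> square_integrable \<eta> \<and>
     (\<forall>\<phi>. test_function \<phi> \<longrightarrow>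
        (LINT z|lborel. complex_of_real (\<phi> z) * \<eta> z) =
        \<i> * (LINT z|lborel. complex_of_real (snd z * deriv_fst \<phi> z) * \<psi> z))"

text \<open>
  A choice of \<open>X \<psi>\<close> for \<open>\<psi>\<close> in the domain of the operator; it is unique almost everywhere.
\<close>

definition op_xp :: "(real \<times> real \<Rightarrow> complex) \<Rightarrow> real \<times> real \<Rightarrow> complex" where
  "op_xp \<psi> = (SOME \<eta>. is_xp \<psi> \<eta>)"

definition op_px :: "(real \<times> real \<Rightarrow> complex) \<Rightarrow> real \<times> real \<Rightarrow> complex" where
  "op_px \<psi> = (SOME \<eta>. is_px \<psi> \<eta>)"

text \<open>
  The expectation value of a self-adjoint operator is real; \<^const>\<open>Re\<close> only adapts the type.
\<close>

definition std_dev ::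
  "((real \<times> real \<Rightarrow> complex) \<Rightarrow> real \<times> real \<Rightarrow> complex) \<Rightarrow> (real \<times> real \<Rightarrow> complex) \<Rightarrow> real" where
  "std_dev X \<psi> = sqrt (norm2_sq (X \<psi>) - (Re (inner2 \<psi> (X \<psi>)))\<^sup>2)"

definition sigma_xp :: "(real \<times> real \<Rightarrow> complex) \<Rightarrow> real" where
  "sigma_xp = std_dev op_xp"

definition sigma_px :: "(real \<times> real \<Rightarrow> complex) \<Rightarrow> real" where
  "sigma_px = std_dev op_px"

definition wave_function :: "(real \<times> real \<Rightarrow> complex) \<Rightarrow> bool" where
  "wave_function \<psi> \<longleftrightarrow> square_integrable \<psi> \<and> norm2_sq \<psi> = 1 \<and>
     (\<exists>\<eta>. is_xp \<psi> \<eta>) \<and> (\<exists>\<eta>. is_px \<psi> \<eta>)"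

definition spherical_states :: "(real \<times> real \<Rightarrow> complex) set" where
  "spherical_states =
     {\<psi>. wave_function \<psi> \<and>
          (\<exists>\<Psi> :: real \<Rightarrow> real. \<forall>x y. \<psi> (x, y) = complex_of_real (\<Psi> (sqrt (x\<^sup>2 + y\<^sup>2))))}"

definition elliptic_K :: "real \<Rightarrow> real" where
  "elliptic_K \<xi> = integral {0..pi/2} (\<lambda>\<theta>. 1 / sqrt (1 - \<xi>\<^sup>2 * (sin \<theta>)\<^sup>2))"

definition elliptic_E :: "real \<Rightarrow> real" where
  "elliptic_E \<xi> = integral {0..pi/2} (\<lambda>\<theta>. sqrt (1 - \<xi>\<^sup>2 * (sin \<theta>)\<^sup>2))"

definition bessel_I0 :: "real \<Rightarrow> real" where
  "bessel_I0 z = (\<Sum>n. z ^ (2 * n) / (2 ^ (2 * n) * (fact n)\<^sup>2))"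

definition psi_fam :: "real \<Rightarrow> real \<times> real \<Rightarrow> complex" where
  "psi_fam \<xi> = (\<lambda>(x, y). complex_of_real
     (1 / sqrt (2 * elliptic_K \<xi> * (1 - \<xi>)) *
      exp (- ((1 + \<xi>) / (1 - \<xi>)) * ((x\<^sup>2 + y\<^sup>2) / 2)) *
      bessel_I0 (sqrt \<xi> / (1 - \<xi>) * (x\<^sup>2 + y\<^sup>2))))"

end

theory Submission
  imports Defs
begin

text \<open>
  For a radial function \<open>\<psi>(x, y) = u(x\<^sup>2 + y\<^sup>2)\<close> both operators give \<open>- 2 \<i> x y u'(x\<^sup>2 + y\<^sup>2)\<close> and have
  mean \<open>0\<close>, so the uncertainty product is \<open>\<pi>/2 \<integral> s\<^sup>2 u'(s)\<^sup>2 ds\<close> over the half-line, while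
  \<open>\<pi> \<integral> u\<^sup>2 ds = 1\<close>. The bound \<open>1/8\<close> is Hardy's inequality, which is never an equality. To obtain it
  for distributional derivatives, the weak equation is tested with \<open>x y w(x\<^sup>2 + y\<^sup>2)\<close>; this gives the
  representation \<open>u(t) = - 4/\<pi> \<integral> g x y / r\<^sup>4\<close>, the integral of the weak derivative \<open>g = x \<partial>\<psi>/\<partial>y\<close> over
  \<open>r\<^sup>2 > t\<close>, to which a weighted Cauchy-Schwarz inequality applies.

  For \<open>\<psi>\<^sub>\<xi>\<close>, integration by parts with Bessel's equation and termwise integration of \<open>I\<^sub>0\<^sup>2\<close> express both
  integrals by the complete elliptic integrals of modulus \<open>2 \<surd>\<xi> / (1 + \<xi>)\<close>, and Landen's
  transformation, here a consequence of Parseval's identity, leads to modulus \<open>\<xi>\<close>. The quotient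
  \<open>E(\<xi>) / K(\<xi>)\<close> vanishes as \<open>\<xi> \<rightarrow> 1\<close>, so \<open>1/8\<close> is approached.
\<close>

section \<open>Radial integrals over the plane\<close>

text \<open>The critical profile of Hardy's inequality is u(s) = s^(-1/2), for which g is a multiple
  of x y / r^3. It dictates the weight: \<open>kern\<close> times g is read as the product of g and
  x y / r^3 with respect to the weight 1 / r, so that equality holds exactly for critical g, and
  integration over t keeps the constant sharp. The square of that profile is 1 / s, so it just fails
  to be square-integrable.

  The profile of \<open>psi_fam\<close> is a multiple of exp (- A s / 2) I_0(B s) with A - 2 B = (1
  - sqrt \<xi>) / (1 + sqrt \<xi>). Since I_0(z) grows like exp z / sqrt z, for \<xi> near 1 it
  follows s^(-1/2) over a long range; this is why the family reaches the bound.

  The obstacle in the lower bound is that u is only square-integrable: it has no value at infinity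
  from which to integrate, and admissible test functions have compact support, while the
  antiderivative of a bump does not. A second copy, stretched by a factor that tends to infinity, is
  subtracted; square-integrability makes its contribution vanish.\<close>

lemma borel_measurable_fst_snd [measurable]:
  "(fst :: 'a::second_countable_topology \<times> 'b::second_countable_topology \<Rightarrow> 'a) \<in> borel_measurable borel"
  "(snd :: 'a \<times> 'b \<Rightarrow> 'b) \<in> borel_measurable borel"
  by (simp_all add: borel_prod[symmetric])

definition rsq :: "real \<times> real \<Rightarrow> real" where
  "rsq z = (fst z)\<^sup>2 + (snd z)\<^sup>2"

lemma rsq_nonneg [simp]: "0 \<le> rsq z"
  by (simp add: rsq_def)

lemma rsq_measurable [measurable]: "rsq \<in> borel_measurable borel"
  unfolding rsq_def[abs_def] by measurable

lemma emeasure_rsq_le: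
  assumes "0 \<le> t"
  shows "emeasure lborel {z. rsq z \<le> t} = ennreal (pi * t)"
proof -
  have "{z. rsq z \<le> t} = cball (0::real\<times>real) (sqrt t)"
    using assms by (auto simp: rsq_def norm_prod_def)
  then show ?thesis
    using assms by (simp add: emeasure_cball unit_ball_vol_2)
qed

text \<open>The disc \<open>rsq z \<le> a\<close> has area pi a, so both measures agree on the
  half-lines \<open>{..a}\<close>, a generator stable under intersections. This takes the place of
  polar coordinates; working with r^2 instead of r makes the density constant.\<close>

lemma distr_rsq: "distr lborel borel rsq = density lborel (\<lambda>s. ennreal (pi * indicator {0..} s))"
    (is "?M = ?N")
proof (rule measure_eqI_generator_eq[where E = "range atMost" and \<Omega> = UNIV and A = "\<lambda>n. {..real n}"])
  show "Int_stable (range (atMost :: real \<Rightarrow> _))"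
    by (auto simp: Int_stable_def)
  show "range atMost \<subseteq> Pow UNIV" by simp
  show "sets ?M = sigma_sets UNIV (range atMost)" "sets ?N = sigma_sets UNIV (range atMost)"
    by (simp_all add: borel_eq_atMost)
  have em: "emeasure ?M {..a} = (if 0 \<le> a then ennreal (pi * a) else 0)" for a :: real
  proof -
    have "emeasure ?M {..a} = emeasure lborel {z. rsq z \<le> a}"
      by (simp add: emeasure_distr vimage_def)
    moreover have "emeasure lborel {z. rsq z \<le> a} = 0" if "a < 0"
    proof -
      have "\<not> rsq z \<le> a" for z
        using rsq_nonneg[of z] that by linarith
      then have "{z. rsq z \<le> a} = {}" by simp
      then show ?thesis by (metis emeasure_empty)
    qed
    ultimately show ?thesis
      using emeasure_rsq_le[of a] by (auto simp: not_le)
  qed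
  show "emeasure ?M X = emeasure ?N X" if "X \<in> range atMost" for X
  proof -
    from that obtain a where X: "X = {..a}" by auto
    have "emeasure ?N X = (\<integral>\<^sup>+s. ennreal (pi * indicator {0..} s) * indicator {..a} s \<partial>lborel)"
      by (simp add: X emeasure_density)
    also have "\<dots> = (\<integral>\<^sup>+s. ennreal pi * indicator {0..a} s \<partial>lborel)"
      by (intro nn_integral_cong) (auto split: split_indicator)
    also have "\<dots> = ennreal pi * emeasure lborel {0..a}"
      by (simp add: nn_integral_cmult)
    also have "\<dots> = (if 0 \<le> a then ennreal (pi * a) else 0)"
      by (auto simp: ennreal_mult)
    finally show ?thesis by (simp only: em X)
  qed
  show "range (\<lambda>n. {..real n}) \<subseteq> range atMost" by auto
  show "(\<Union>i. {..real i}) = UNIV" by (auto simp: real_arch_simple)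
  show "emeasure ?M {..real i} \<noteq> \<infinity>" for i by (simp add: em)
qed

lemma nn_integral_radial:
  assumes [measurable]: "F \<in> borel_measurable borel"
  shows "(\<integral>\<^sup>+z. F (rsq z) \<partial>lborel) = (\<integral>\<^sup>+s. ennreal (pi * indicator {0..} s) * F s \<partial>lborel)"
proof -
  have "(\<integral>\<^sup>+z. F (rsq z) \<partial>lborel) = (\<integral>\<^sup>+s. F s \<partial>distr lborel borel rsq)"
    by (simp add: nn_integral_distr)
  also have "\<dots> = (\<integral>\<^sup>+s. ennreal (pi * indicator {0..} s) * F s \<partial>lborel)"
    unfolding distr_rsq by (subst nn_integral_density) auto
  finally show ?thesis .
qed

lemma nn_integral_lborel_swap:
  fixes f :: "real \<times> real \<Rightarrow> ennreal"
  assumes [measurable]: "f \<in> borel_measurable borel"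
  shows "(\<integral>\<^sup>+z. f (snd z, fst z) \<partial>lborel) = (\<integral>\<^sup>+z. f z \<partial>lborel)"
proof -
  have [measurable]: "f \<in> borel_measurable (lborel \<Otimes>\<^sub>M lborel)"
    by (simp add: lborel_prod)
  have "(\<integral>\<^sup>+z. f (snd z, fst z) \<partial>lborel) = (\<integral>\<^sup>+x. \<integral>\<^sup>+y. f (y, x) \<partial>lborel \<partial>lborel)"
    by (subst lborel_prod[symmetric], subst lborel.nn_integral_fst[symmetric]) auto
  also have "\<dots> = (\<integral>\<^sup>+z. f z \<partial>lborel)"
    by (subst lborel_prod[symmetric], subst lborel_pair.nn_integral_snd[symmetric]) auto
  finally show ?thesis .
qed

text \<open>Two one-dimensional affine substitutions replace the change of variables in the plane.
  The first, in x for fixed y, contributes the factor sqrt 2; the second, in y for fixed x, absorbs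
  it.\<close>

lemma nn_integral_lborel_rotate:
  fixes f :: "real \<times> real \<Rightarrow> ennreal"
  assumes [measurable]: "f \<in> borel_measurable borel"
  shows "(\<integral>\<^sup>+z. f ((fst z + snd z) / sqrt 2, (fst z - snd z) / sqrt 2) \<partial>lborel)
       = (\<integral>\<^sup>+z. f z \<partial>lborel)"
proof -
  let ?c = "sqrt 2"
  have [measurable]: "f \<in> borel_measurable (lborel \<Otimes>\<^sub>M lborel)"
    "f \<in> borel_measurable (borel \<Otimes>\<^sub>M borel)"
    by (simp_all add: lborel_prod borel_prod)
  have c2: "2 / ?c = ?c" by (simp add: real_div_sqrt)
  have "(\<integral>\<^sup>+z. f ((fst z + snd z) / ?c, (fst z - snd z) / ?c) \<partial>lborel)
     = (\<integral>\<^sup>+y. \<integral>\<^sup>+x. f ((x + y) / ?c, (x - y) / ?c) \<partial>lborel \<partial>lborel)"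
    by (subst lborel_prod[symmetric], subst lborel_pair.nn_integral_snd[symmetric]) auto
  also have "\<dots> = (\<integral>\<^sup>+y. ennreal ?c * (\<integral>\<^sup>+x. f (x, x - ?c * y) \<partial>lborel) \<partial>lborel)"
  proof (intro nn_integral_cong)
    fix y :: real
    have "(\<integral>\<^sup>+x. f ((x + y) / ?c, (x - y) / ?c) \<partial>lborel)
       = ennreal \<bar>?c\<bar> * (\<integral>\<^sup>+x. f (((- y + ?c * x) + y) / ?c, ((- y + ?c * x) - y) / ?c) \<partial>lborel)"
      by (rule nn_integral_real_affine) auto
    also have "(\<lambda>x. f (((- y + ?c * x) + y) / ?c, ((- y + ?c * x) - y) / ?c)) = (\<lambda>x. f (x, x - ?c * y))"
    proof
      fix x :: real
      have "(- y + ?c * x - y) / ?c = x - (2 / ?c) * y" by (simp add: field_simps)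
      then show "f ((- y + ?c * x + y) / ?c, (- y + ?c * x - y) / ?c) = f (x, x - ?c * y)"
        unfolding c2 by simp
    qed
    finally show "(\<integral>\<^sup>+x. f ((x + y) / ?c, (x - y) / ?c) \<partial>lborel)
       = ennreal ?c * (\<integral>\<^sup>+x. f (x, x - ?c * y) \<partial>lborel)" by simp
  qed
  also have "\<dots> = ennreal ?c * (\<integral>\<^sup>+y. \<integral>\<^sup>+x. f (x, x - ?c * y) \<partial>lborel \<partial>lborel)"
    by (rule nn_integral_cmult) measurable
  also have "(\<integral>\<^sup>+y. \<integral>\<^sup>+x. f (x, x - ?c * y) \<partial>lborel \<partial>lborel)
     = (\<integral>\<^sup>+x. \<integral>\<^sup>+y. f (x, x - ?c * y) \<partial>lborel \<partial>lborel)"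
    by (rule lborel_pair.Fubini'[symmetric]) measurable
  also have "ennreal ?c * \<dots> = (\<integral>\<^sup>+x. ennreal ?c * (\<integral>\<^sup>+y. f (x, x - ?c * y) \<partial>lborel) \<partial>lborel)"
    by (rule nn_integral_cmult[symmetric]) measurable
  also have "\<dots> = (\<integral>\<^sup>+x. \<integral>\<^sup>+y. f (x, y) \<partial>lborel \<partial>lborel)"
  proof (intro nn_integral_cong)
    fix x :: real
    show "ennreal ?c * (\<integral>\<^sup>+y. f (x, x - ?c * y) \<partial>lborel) = (\<integral>\<^sup>+y. f (x, y) \<partial>lborel)"
      using nn_integral_real_affine[of "\<lambda>y. f (x, y)" "- ?c" x] by simp
  qed
  also have "\<dots> = (\<integral>\<^sup>+z. f z \<partial>lborel)"
    by (subst lborel_prod[symmetric], subst lborel.nn_integral_fst[symmetric]) auto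
  finally show ?thesis .
qed

lemma rsq_rotate: "rsq ((x + y) / sqrt 2, (x - y) / sqrt 2) = rsq (x, y)"
  by (simp add: rsq_def power_divide power2_sum power2_diff field_simps)

text \<open>Exchanging the variables shows that x^2 and y^2 have the same integral, and their sum is
  radial; each receives half of the weight pi s.\<close>

lemma nn_integral_radial_x2:
  assumes [measurable]: "F \<in> borel_measurable borel"
  shows "(\<integral>\<^sup>+z. ennreal ((fst z)\<^sup>2) * F (rsq z) \<partial>lborel)
       = (\<integral>\<^sup>+s. ennreal (pi / 2 * s * indicator {0..} s) * F s \<partial>lborel)"
proof -
  let ?I = "\<integral>\<^sup>+z. ennreal ((fst z)\<^sup>2) * F (rsq z) \<partial>lborel"
  have "?I + ?I = ?I + (\<integral>\<^sup>+z. ennreal ((snd z)\<^sup>2) * F (rsq z) \<partial>lborel)"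
    by (subst (2) nn_integral_lborel_swap[symmetric]) (auto simp: rsq_def add.commute)
  also have "\<dots> = (\<integral>\<^sup>+z. ennreal (rsq z) * F (rsq z) \<partial>lborel)"
    by (subst nn_integral_add[symmetric]) (auto simp: rsq_def ennreal_plus distrib_right)
  also have "\<dots> = (\<integral>\<^sup>+s. ennreal (pi * indicator {0..} s) * (ennreal s * F s) \<partial>lborel)"
    by (rule nn_integral_radial) measurable
  also have "\<dots> = (\<integral>\<^sup>+s. ennreal 2 * (ennreal (pi / 2 * s * indicator {0..} s) * F s) \<partial>lborel)"
    by (intro nn_integral_cong)
      (auto simp: mult.assoc[symmetric] ennreal_mult'[symmetric] split: split_indicator simp del: ennreal_numeral)
  also have "\<dots> = 2 * (\<integral>\<^sup>+s. ennreal (pi / 2 * s * indicator {0..} s) * F s \<partial>lborel)"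
    by (subst nn_integral_cmult) auto
  finally have "2 * ?I = 2 * (\<integral>\<^sup>+s. ennreal (pi / 2 * s * indicator {0..} s) * F s \<partial>lborel)"
    by (simp add: mult_2)
  then show ?thesis
    by (simp add: ennreal_mult_cancel_left)
qed

text \<open>
  The average of \<open>sin\<^sup>2 \<theta> cos\<^sup>2 \<theta>\<close> over a circle, without polar coordinates: a rotation by
  \<open>\<pi>/4\<close> exchanges \<open>4 x\<^sup>2 y\<^sup>2\<close> and \<open>(x\<^sup>2 - y\<^sup>2)\<^sup>2\<close>, and their sum is \<open>(x\<^sup>2 + y\<^sup>2)\<^sup>2\<close>.
\<close>

lemma nn_integral_radial_x2y2:
  assumes [measurable]: "F \<in> borel_measurable borel"
  shows "(\<integral>\<^sup>+z. ennreal ((fst z * snd z)\<^sup>2) * F (rsq z) \<partial>lborel)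
       = (\<integral>\<^sup>+s. ennreal (pi / 8 * s\<^sup>2 * indicator {0..} s) * F s \<partial>lborel)"
proof -
  let ?I = "\<integral>\<^sup>+z. ennreal ((fst z * snd z)\<^sup>2) * F (rsq z) \<partial>lborel"
  let ?J = "\<integral>\<^sup>+z. ennreal (((fst z)\<^sup>2 - (snd z)\<^sup>2)\<^sup>2) * F (rsq z) \<partial>lborel"
  have I4: "ennreal 4 * ?I = (\<integral>\<^sup>+z. ennreal (4 * (fst z * snd z)\<^sup>2) * F (rsq z) \<partial>lborel)"
    by (subst nn_integral_cmult[symmetric])
      (auto simp: mult.assoc[symmetric] ennreal_mult'[symmetric] simp del: ennreal_numeral)
  have "ennreal 4 * ?I = ?J"
  proof -
    have "ennreal 4 * ?I = (\<integral>\<^sup>+z. ennreal (4 * ((fst z + snd z) / sqrt 2 * ((fst z - snd z) / sqrt 2))\<^sup>2)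
              * F (rsq (fst z, snd z)) \<partial>lborel)"
      unfolding I4 by (subst nn_integral_lborel_rotate[symmetric]) (auto simp: rsq_rotate)
    also have "\<dots> = ?J"
    proof (intro nn_integral_cong arg_cong2[where f = "(*)"] arg_cong[where f = ennreal])
      fix z :: "real \<times> real"
      have "(fst z + snd z) / sqrt 2 * ((fst z - snd z) / sqrt 2) = ((fst z)\<^sup>2 - (snd z)\<^sup>2) / 2"
        by (simp add: power2_eq_square algebra_simps)
      then show "4 * ((fst z + snd z) / sqrt 2 * ((fst z - snd z) / sqrt 2))\<^sup>2 = ((fst z)\<^sup>2 - (snd z)\<^sup>2)\<^sup>2"
        by (simp add: power_divide)
    qed simp
    finally show ?thesis .
  qed
  then have "ennreal 4 * ?I + ennreal 4 * ?I = ?J + (\<integral>\<^sup>+z. ennreal (4 * (fst z * snd z)\<^sup>2) * F (rsq z) \<partial>lborel)"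
    using I4 by simp
  also have "\<dots> = (\<integral>\<^sup>+z. ennreal ((rsq z)\<^sup>2) * F (rsq z) \<partial>lborel)"
  proof (subst nn_integral_add[symmetric]; (intro nn_integral_cong)?)
    fix z :: "real \<times> real"
    have "((fst z)\<^sup>2 - (snd z)\<^sup>2)\<^sup>2 + 4 * (fst z * snd z)\<^sup>2 = (rsq z)\<^sup>2"
      by (simp add: rsq_def power2_eq_square algebra_simps)
    then show "ennreal (((fst z)\<^sup>2 - (snd z)\<^sup>2)\<^sup>2) * F (rsq z) + ennreal (4 * (fst z * snd z)\<^sup>2) * F (rsq z)
        = ennreal ((rsq z)\<^sup>2) * F (rsq z)"
      by (simp only: distrib_right[symmetric] ennreal_plus[symmetric] zero_le_power2
            zero_le_mult_iff zero_le_numeral simp_thms)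
  qed measurable
  also have "\<dots> = (\<integral>\<^sup>+s. ennreal (pi * indicator {0..} s) * (ennreal (s\<^sup>2) * F s) \<partial>lborel)"
    by (rule nn_integral_radial) measurable
  also have "\<dots> = (\<integral>\<^sup>+s. ennreal 8 * (ennreal (pi / 8 * s\<^sup>2 * indicator {0..} s) * F s) \<partial>lborel)"
    by (intro nn_integral_cong)
      (auto simp: mult.assoc[symmetric] ennreal_mult'[symmetric] split: split_indicator simp del: ennreal_numeral)
  also have "\<dots> = ennreal 8 * (\<integral>\<^sup>+s. ennreal (pi / 8 * s\<^sup>2 * indicator {0..} s) * F s \<partial>lborel)"
    by (subst nn_integral_cmult) auto
  finally have "ennreal 8 * ?I = ennreal 8 * (\<integral>\<^sup>+s. ennreal (pi / 8 * s\<^sup>2 * indicator {0..} s) * F s \<partial>lborel)"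
    by (simp add: distrib_right[symmetric] del: ennreal_numeral ennreal_plus) (simp add: ennreal_plus[symmetric] del: ennreal_plus)
  then show ?thesis
    by (simp add: ennreal_mult_cancel_left)
qed

text \<open>On indicator functions, hypothesis \<open>nn\<close> identifies the image under
  \<open>rsq\<close> of the measure with density m. Both claims about signed integrands are then
  transformation rules for measures. The instances used below have m = 1, x^2 and x^2 y^2.\<close>

lemma
  fixes F :: "real \<Rightarrow> real"
  assumes nn: "\<And>G. G \<in> borel_measurable borel \<Longrightarrow>
      (\<integral>\<^sup>+z. ennreal (m z) * G (rsq z) \<partial>lborel) = (\<integral>\<^sup>+s. ennreal (k s) * G s \<partial>lborel)"
    and m [measurable]: "m \<in> borel_measurable borel" and "\<And>z. 0 \<le> m z"
    and k [measurable]: "k \<in> borel_measurable borel" and "\<And>s. 0 \<le> k s"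
    and F [measurable]: "F \<in> borel_measurable borel"
  shows radial_integrable_weighted:
      "integrable lborel (\<lambda>z. m z * F (rsq z)) \<longleftrightarrow> integrable lborel (\<lambda>s. k s * F s)" (is ?A)
    and radial_integral_weighted:
      "(LINT z|lborel. m z * F (rsq z)) = (LINT s|lborel. k s * F s)" (is ?B)
proof -
  have eq: "distr (density lborel (\<lambda>z. ennreal (m z))) borel rsq = density lborel (\<lambda>s. ennreal (k s))"
  proof (rule measure_eqI)
    fix A assume "A \<in> sets (distr (density lborel (\<lambda>z. ennreal (m z))) borel rsq)"
    then have [measurable]: "A \<in> sets borel" by simp
    have [measurable]: "rsq -` A \<in> sets borel"
      using measurable_sets_borel[OF rsq_measurable] by simp
    have "emeasure (distr (density lborel (\<lambda>z. ennreal (m z))) borel rsq) A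
        = (\<integral>\<^sup>+z. ennreal (m z) * indicator (rsq -` A) z \<partial>lborel)"
      by (subst emeasure_distr) (auto simp: emeasure_density)
    also have "\<dots> = (\<integral>\<^sup>+z. ennreal (m z) * indicator A (rsq z) \<partial>lborel)"
      by (intro nn_integral_cong) (auto split: split_indicator)
    also have "\<dots> = (\<integral>\<^sup>+s. ennreal (k s) * indicator A s \<partial>lborel)"
      by (rule nn) measurable
    also have "\<dots> = emeasure (density lborel (\<lambda>s. ennreal (k s))) A"
      by (simp add: emeasure_density)
    finally show "emeasure (distr (density lborel (\<lambda>z. ennreal (m z))) borel rsq) A
        = emeasure (density lborel (\<lambda>s. ennreal (k s))) A" .
  qed simp
  have "integrable lborel (\<lambda>z. m z * F (rsq z)) \<longleftrightarrow> integrable (density lborel (\<lambda>z. ennreal (m z))) (\<lambda>z. F (rsq z))"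
    using assms by (subst integrable_density) auto
  also have "\<dots> \<longleftrightarrow> integrable (distr (density lborel (\<lambda>z. ennreal (m z))) borel rsq) F"
    by (subst integrable_distr_eq) auto
  also have "\<dots> \<longleftrightarrow> integrable lborel (\<lambda>s. k s * F s)"
    unfolding eq using assms by (subst integrable_density) auto
  finally show ?A .
  have "(LINT z|lborel. m z * F (rsq z)) = (LINT z|density lborel (\<lambda>z. ennreal (m z)). F (rsq z))"
    using assms by (subst integral_density) auto
  also have "\<dots> = (LINT s|distr (density lborel (\<lambda>z. ennreal (m z))) borel rsq. F s)"
    by (subst integral_distr) auto
  also have "\<dots> = (LINT s|lborel. k s * F s)"
    unfolding eq using assms by (subst integral_density) auto
  finally show ?B .
qed

lemma
  fixes F :: "real \<Rightarrow> real"
  assumes F: "F \<in> borel_measurable borel"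
  shows radial_integrable:
      "integrable lborel (\<lambda>z. F (rsq z)) \<longleftrightarrow> integrable lborel (\<lambda>s. pi * indicator {0..} s * F s)"
    and radial_integral:
      "(LINT z|lborel. F (rsq z)) = (LINT s|lborel. pi * indicator {0..} s * F s)"
    and radial_x2_integrable:
      "integrable lborel (\<lambda>z. (fst z)\<^sup>2 * F (rsq z)) \<longleftrightarrow> integrable lborel (\<lambda>s. pi / 2 * s * indicator {0..} s * F s)"
    and radial_x2_integral:
      "(LINT z|lborel. (fst z)\<^sup>2 * F (rsq z)) = (LINT s|lborel. pi / 2 * s * indicator {0..} s * F s)"
    and radial_x2y2_integrable:
      "integrable lborel (\<lambda>z. (fst z * snd z)\<^sup>2 * F (rsq z)) \<longleftrightarrow> integrable lborel (\<lambda>s. pi / 8 * s\<^sup>2 * indicator {0..} s * F s)"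
    and radial_x2y2_integral:
      "(LINT z|lborel. (fst z * snd z)\<^sup>2 * F (rsq z)) = (LINT s|lborel. pi / 8 * s\<^sup>2 * indicator {0..} s * F s)"
proof -
  have j: "0 \<le> pi / 2 * s * indicator {0..} s" for s :: real
    by (auto split: split_indicator)
  note r1 = radial_integrable_weighted[of "\<lambda>_. 1" "\<lambda>s. pi * indicator {0..} s" F]
    radial_integral_weighted[of "\<lambda>_. 1" "\<lambda>s. pi * indicator {0..} s" F]
  show "integrable lborel (\<lambda>z. F (rsq z)) \<longleftrightarrow> integrable lborel (\<lambda>s. pi * indicator {0..} s * F s)"
    "(LINT z|lborel. F (rsq z)) = (LINT s|lborel. pi * indicator {0..} s * F s)"
    using r1 F by (simp_all add: nn_integral_radial)
  note r2 = radial_integrable_weighted[of "\<lambda>z. (fst z)\<^sup>2" "\<lambda>s. pi / 2 * s * indicator {0..} s" F]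
    radial_integral_weighted[of "\<lambda>z. (fst z)\<^sup>2" "\<lambda>s. pi / 2 * s * indicator {0..} s" F]
  show "integrable lborel (\<lambda>z. (fst z)\<^sup>2 * F (rsq z)) \<longleftrightarrow> integrable lborel (\<lambda>s. pi / 2 * s * indicator {0..} s * F s)"
      "(LINT z|lborel. (fst z)\<^sup>2 * F (rsq z)) = (LINT s|lborel. pi / 2 * s * indicator {0..} s * F s)"
    by (rule r2; use F j nn_integral_radial_x2 in auto)+
  note r3 = radial_integrable_weighted[of "\<lambda>z. (fst z * snd z)\<^sup>2" "\<lambda>s. pi / 8 * s\<^sup>2 * indicator {0..} s" F]
    radial_integral_weighted[of "\<lambda>z. (fst z * snd z)\<^sup>2" "\<lambda>s. pi / 8 * s\<^sup>2 * indicator {0..} s" F]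
  show "integrable lborel (\<lambda>z. (fst z * snd z)\<^sup>2 * F (rsq z)) \<longleftrightarrow> integrable lborel (\<lambda>s. pi / 8 * s\<^sup>2 * indicator {0..} s * F s)"
      "(LINT z|lborel. (fst z * snd z)\<^sup>2 * F (rsq z)) = (LINT s|lborel. pi / 8 * s\<^sup>2 * indicator {0..} s * F s)"
    by (rule r3; use F nn_integral_radial_x2y2 in auto)+
qed

section \<open>Smooth functions of compact support\<close>

text \<open>The measures whose densities are the positive and the negative part of f agree on boxes,
  which are stable under intersections; hence they are equal, and so are the densities almost
  everywhere. Cutting f off to a bounded box first makes both measures finite.\<close>

lemma AE_eq_0_if_box_integrals_eq_0:
  fixes f :: "'a::euclidean_space \<Rightarrow> real"
  assumes [measurable]: "f \<in> borel_measurable borel"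
    and int: "\<And>a b. integrable lborel (\<lambda>x. indicator (box a b) x * f x)"
    and zero: "\<And>a b. (LINT x|lborel. indicator (box a b) x * f x) = 0"
  shows "AE x in lborel. f x = 0"
proof -
  let ?A = "\<lambda>n::nat. box (- (real n *\<^sub>R One)) (real n *\<^sub>R One) :: 'a set"
  have "AE x in lborel. indicator (?A n) x * f x = 0" for n
  proof -
    let ?g = "\<lambda>x. indicator (?A n) x * f x"
    let ?P = "density lborel (\<lambda>x. ennreal (max 0 (?g x)))"
    let ?N = "density lborel (\<lambda>x. ennreal (max 0 (- ?g x)))"
    have gi: "integrable lborel (\<lambda>x. indicator (box a b) x * ?g x)"
      and g0: "(LINT x|lborel. indicator (box a b) x * ?g x) = 0" for a b
      using int zero
      by (simp_all add: mult.assoc[symmetric] indicator_inter_arith[symmetric] box_Int_box)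
    have box_eq: "emeasure ?P (box a b) = ennreal (LINT x|lborel. max 0 (indicator (box a b) x * ?g x))"
        "emeasure ?N (box a b) = ennreal (LINT x|lborel. max 0 (- (indicator (box a b) x * ?g x)))" for a b
      using gi[of a b]
      by (auto simp: emeasure_density nn_integral_eq_integral[symmetric] intro!: nn_integral_cong
            split: split_indicator)
    have "?P = ?N"
    proof (rule measure_eqI_generator_eq)
      let ?E = "range (\<lambda>(a, b). box a b::'a set)"
      show "Int_stable ?E"
        by (auto simp: Int_stable_def box_Int_box)
      show "?E \<subseteq> Pow UNIV" "sets ?P = sigma_sets UNIV ?E" "sets ?N = sigma_sets UNIV ?E"
        by (simp_all add: borel_eq_box)
      show "range ?A \<subseteq> ?E" "(\<Union>i. ?A i) = UNIV"
        unfolding UN_box_eq_UNIV by auto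
      show "emeasure ?P (?A i) \<noteq> \<infinity>" for i
        unfolding box_eq by simp
      show "emeasure ?P X = emeasure ?N X" if "X \<in> ?E" for X
      proof -
        from that obtain a b where X: "X = box a b" by auto
        let ?h = "\<lambda>x. indicator (box a b) x * ?g x"
        have "(LINT x|lborel. max 0 (?h x)) - (LINT x|lborel. max 0 (- ?h x))
            = (LINT x|lborel. max 0 (?h x) - max 0 (- ?h x))"
          using gi[of a b] by (subst Bochner_Integration.integral_diff) auto
        also have "\<dots> = (LINT x|lborel. ?h x)"
          by (intro Bochner_Integration.integral_cong) auto
        finally show ?thesis
          unfolding X box_eq using g0[of a b] by simp
      qed
    qed
    then have "AE x in lborel. ennreal (max 0 (?g x)) = ennreal (max 0 (- ?g x))"
      by (intro sigma_finite_measure.density_unique[OF sigma_finite_lborel]) auto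
    then show ?thesis
      by eventually_elim (auto simp: max_def split: if_splits)
  qed
  then have "AE x in lborel. \<forall>n. indicator (?A n) x * f x = 0"
    by (simp only: AE_all_countable) simp
  then show ?thesis
  proof eventually_elim
    fix x assume *: "\<forall>n. indicator (?A n) x * f x = 0"
    have "x \<in> (\<Union>n. ?A n)" unfolding UN_box_eq_UNIV by simp
    then obtain n where "x \<in> ?A n" by blast
    then show "f x = 0" using *[rule_format, of n] by simp
  qed
qed

section \<open>Smooth functions of one variable and bump functions\<close>

lemma DERIV_power':
  fixes t :: real
  assumes "t \<noteq> 0"
  shows "((\<lambda>t. t ^ j) has_real_derivative real j * t ^ j / t) (at t)"
  using DERIV_pow[of j t] assms by (cases j) auto

text \<open>At j = 0 the classical flat function exp (-1 / t). The powers in the denominator make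
  the family closed under differentiation up to linear combinations, so every derivative can be
  written down.\<close>

definition flat :: "nat \<Rightarrow> real \<Rightarrow> real" where
  "flat j t = (if 0 < t then exp (- (1 / t)) / t ^ j else 0)"

lemma flat_tendsto_0: "(flat j \<longlongrightarrow> 0) (at 0)"
proof -
  have "((\<lambda>t. inverse t ^ j / exp (inverse t)) \<longlongrightarrow> 0) (at_right (0::real))"
    by (rule filterlim_compose[OF tendsto_power_div_exp_0 filterlim_inverse_at_top_right])
  then have "(flat j \<longlongrightarrow> 0) (at_right 0)"
    by (rule Lim_transform_eventually)
      (auto simp: flat_def eventually_at_right_field exp_minus divide_simps power_inverse intro: exI[of _ 1])
  moreover have "(flat j \<longlongrightarrow> 0) (at_left 0)"
    by (rule Lim_transform_eventually[OF tendsto_const])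
      (auto simp: flat_def eventually_at_left_field intro: exI[of _ "-1"])
  ultimately show ?thesis
    by (simp add: filterlim_at_split)
qed

lemma DERIV_flat: "(flat j has_real_derivative flat (j + 2) t - real j * flat (j + 1) t) (at t)"
proof -
  consider "t < 0" | "t = 0" | "0 < t" by linarith
  then show ?thesis
  proof cases
    case 1
    have "((\<lambda>_. 0) has_real_derivative 0) (at t)" by simp
    then have "(flat j has_real_derivative 0) (at t)"
      by (rule has_field_derivative_transform_within_open[where S = "{..<0}"]) (use 1 in \<open>auto simp: flat_def\<close>)
    then show ?thesis using 1 by (simp add: flat_def)
  next
    case 2
    \<comment> \<open>At 0 the difference quotient is itself the next member of the family, whose
      limit is already known.\<close>
    have "(\<lambda>h. (flat j (0 + h) - flat j 0) / h) = flat (j + 1)"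
      by (auto simp: flat_def fun_eq_iff)
    then have "(flat j has_real_derivative 0) (at 0)"
      using flat_tendsto_0[of "j + 1"] by (simp add: DERIV_def)
    then show ?thesis using 2 by (simp add: flat_def)
  next
    case 3
    have "((\<lambda>t. exp (- (1 / t)) / t ^ j) has_real_derivative flat (j + 2) t - real j * flat (j + 1) t) (at t)"
    proof -
      have "((\<lambda>t. exp (- (1 / t))) has_real_derivative exp (- (1 / t)) / t\<^sup>2) (at t)"
        using 3 by (auto intro!: derivative_eq_intros simp: power2_eq_square)
      from DERIV_cong[OF DERIV_divide[OF this DERIV_power'[of t j]]] 3 show ?thesis
        by (auto simp: flat_def field_simps power2_eq_square)
    qed
    then show ?thesis
      by (rule has_field_derivative_transform_within_open[where S = "{0<..}"]) (use 3 in \<open>auto simp: flat_def\<close>)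
  qed
qed

text \<open>A recursion on the existence of a derivative, instead of iterates of
  \<open>deriv\<close>: closure under sums, products and affine substitution then takes one
  induction each, with the derivative exhibited as witness.\<close>

primrec times_diff :: "nat \<Rightarrow> (real \<Rightarrow> real) \<Rightarrow> bool" where
  "times_diff 0 f = True"
| "times_diff (Suc n) f = (\<exists>f'. (\<forall>x. (f has_real_derivative f' x) (at x)) \<and> times_diff n f')"

definition smooth_line :: "(real \<Rightarrow> real) \<Rightarrow> bool" where
  "smooth_line f \<longleftrightarrow> (\<forall>n. times_diff n f)"

lemma times_diff_Suc_imp: "times_diff (Suc n) f \<Longrightarrow> times_diff n f"
  by (induction n arbitrary: f) (simp, metis times_diff.simps(2))

lemma times_diff_add: "times_diff n f \<Longrightarrow> times_diff n g \<Longrightarrow> times_diff n (\<lambda>x. f x + g x)"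
proof (induction n arbitrary: f g)
  case (Suc n)
  then obtain f' g' where "\<forall>x. (f has_real_derivative f' x) (at x)" "times_diff n f'"
    "\<forall>x. (g has_real_derivative g' x) (at x)" "times_diff n g'" by auto
  with Suc.IH show ?case
    by (auto intro!: exI[of _ "\<lambda>x. f' x + g' x"] derivative_eq_intros)
qed simp

lemma times_diff_mult: "times_diff n f \<Longrightarrow> times_diff n g \<Longrightarrow> times_diff n (\<lambda>x. f x * g x)"
proof (induction n arbitrary: f g)
  case (Suc n)
  then obtain f' g' where "\<forall>x. (f has_real_derivative f' x) (at x)" "times_diff n f'"
    "\<forall>x. (g has_real_derivative g' x) (at x)" "times_diff n g'" by auto
  moreover have "times_diff n f" "times_diff n g"
    using Suc.prems by (auto intro: times_diff_Suc_imp simp del: times_diff.simps)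
  ultimately show ?case
    using Suc.IH
    by (auto intro!: exI[of _ "\<lambda>x. f' x * g x + g' x * f x"] derivative_eq_intros times_diff_add)
qed simp

lemma times_diff_const: "times_diff n (\<lambda>x. c)"
  by (induction n arbitrary: c) (auto intro!: exI[of _ "\<lambda>_. 0"])

lemma times_diff_affine: "times_diff n f \<Longrightarrow> times_diff n (\<lambda>x. f (a * x + b))"
proof (induction n arbitrary: f)
  case (Suc n)
  then obtain f' where "\<forall>x. (f has_real_derivative f' x) (at x)" "times_diff n f'" by auto
  moreover from this have "((\<lambda>x. f (a * x + b)) has_real_derivative a * f' (a * x + b)) (at x)" for x
    using DERIV_chain2[of f "f' (a * x + b)" "\<lambda>x. a * x + b" x a]
      DERIV_add[OF DERIV_cmult_Id[of a x UNIV] DERIV_const[of b]]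
    by (simp add: mult.commute)
  ultimately show ?case
    using Suc.IH by (auto intro!: exI[of _ "\<lambda>x. a * f' (a * x + b)"] times_diff_mult times_diff_const)
qed simp

lemma times_diff_flat: "times_diff n (flat j)"
proof (induction n arbitrary: j)
  case (Suc n)
  have "times_diff n (\<lambda>t. flat (j + 2) t + (- real j) * flat (j + 1) t)"
    by (intro times_diff_add times_diff_mult times_diff_const Suc)
  then show ?case
    using DERIV_flat[of j]
    by (auto intro!: exI[of _ "\<lambda>t. flat (j + 2) t - real j * flat (j + 1) t"])
qed simp

text \<open>Division by a power of s is harmless because V vanishes below \<alpha> > 0, so that the
  quotient is 0 there, including at s = 0. The exponent is arbitrary because every differentiation
  raises it.\<close>

lemma times_diff_divide_power:
  assumes "0 < \<alpha>"
  shows "times_diff n V \<Longrightarrow> (\<And>s. s < \<alpha> \<Longrightarrow> V s = 0) \<Longrightarrow> times_diff n (\<lambda>s. V s / s ^ j)"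
proof (induction n arbitrary: V j)
  case (Suc n)
  then obtain V' where V': "\<And>x. (V has_real_derivative V' x) (at x)" "times_diff n V'" by auto
  have V'0: "V' s = 0" if "s < \<alpha>" for s
  proof -
    have "((\<lambda>_. 0) has_real_derivative 0) (at s)" by simp
    then have "(V has_real_derivative 0) (at s)"
      by (rule has_field_derivative_transform_within_open[where S = "{..<\<alpha>}"]) (use that Suc.prems in auto)
    then show ?thesis using V'(1) DERIV_unique by blast
  qed
  have "((\<lambda>s. V s / s ^ j) has_real_derivative V' s / s ^ j + (- real j) * (V s / s ^ Suc j)) (at s)" for s
  proof (cases "s < \<alpha>")
    case True
    have "((\<lambda>_. 0) has_real_derivative 0) (at s)" by simp
    then have "((\<lambda>s. V s / s ^ j) has_real_derivative 0) (at s)"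
      by (rule has_field_derivative_transform_within_open[where S = "{..<\<alpha>}"]) (use True Suc.prems in auto)
    then show ?thesis using True V'0 Suc.prems by simp
  next
    case False
    then have "s \<noteq> 0" using assms by auto
    then show ?thesis
      by (intro DERIV_cong[OF DERIV_divide[OF V'(1) DERIV_power'[of s j]]]) (auto simp: field_simps)
  qed
  moreover have "times_diff n (\<lambda>s. V' s / s ^ j + (- real j) * (V s / s ^ Suc j))"
    using Suc.prems V'0 V'(2)
    by (intro times_diff_add times_diff_mult times_diff_const Suc.IH)
      (auto intro: times_diff_Suc_imp simp del: times_diff.simps)
  ultimately show ?case
    unfolding times_diff.simps
    by (intro exI[of _ "\<lambda>s. V' s / s ^ j + (- real j) * (V s / s ^ Suc j)"]) simp
qed simp

text \<open>Each order of differentiability comes with its own chain of derivatives; by uniqueness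
  of the derivative they are all initial parts of the one sequence of iterates of
  \<open>deriv\<close>.\<close>

lemma smooth_line_derivatives:
  assumes "smooth_line f"
  obtains d where "d 0 = f" "\<And>k x. (d k has_real_derivative d (Suc k) x) (at x)"
proof
  have step: "smooth_line (deriv g)" "(g has_real_derivative deriv g x) (at x)" if "smooth_line g" for g x
  proof -
    have "\<exists>g'. (\<forall>x. (g has_real_derivative g' x) (at x)) \<and> times_diff n g'" for n
      using that[unfolded smooth_line_def, rule_format, of "Suc n"] by simp
    moreover have "g' = deriv g" if "\<forall>x. (g has_real_derivative g' x) (at x)" for g'
      using that DERIV_imp_deriv by (metis ext)
    ultimately show "smooth_line (deriv g)" "(g has_real_derivative deriv g x) (at x)"
      by (simp_all add: smooth_line_def) metis+
  qed
  let ?d = "\<lambda>k. (deriv ^^ k) f"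
  have "smooth_line (?d k)" for k
    by (induction k) (simp_all add: assms step)
  then show "(?d k has_real_derivative ?d (Suc k) x) (at x)" for k x
    using step(2) by simp
  show "?d 0 = f" by simp
qed

lemma smooth_line_integral:
  assumes "smooth_line f" "\<And>x. (F has_real_derivative f x) (at x)"
  shows "smooth_line F"
  unfolding smooth_line_def
proof
  fix n show "times_diff n F"
    using assms by (cases n) (auto simp: smooth_line_def)
qed

text \<open>A smooth approximation from below to the indicator of the open interval: inside, the
  scaling by n + 1 drives both exponential factors to 1, and outside one of the factors is exactly
  0.\<close>

definition bump :: "real \<Rightarrow> real \<Rightarrow> nat \<Rightarrow> real \<Rightarrow> real" where
  "bump a b n s = flat 0 (real (Suc n) * (s - a)) * flat 0 (real (Suc n) * (b - s))"

lemma smooth_line_bump: "smooth_line (bump a b n)"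
proof -
  have "times_diff k (\<lambda>s. flat 0 (real (Suc n) * s + - (real (Suc n) * a)) * flat 0 (- real (Suc n) * s + real (Suc n) * b))" for k
    by (intro times_diff_mult times_diff_affine times_diff_flat)
  then show ?thesis
    by (simp add: smooth_line_def bump_def[abs_def] algebra_simps)
qed

lemma bump_nonneg [simp]: "0 \<le> bump a b n s"
  by (simp add: bump_def flat_def)

lemma bump_le_1: "bump a b n s \<le> 1"
  by (auto simp: bump_def flat_def intro!: mult_le_one)

lemma bump_eq_0: "s \<le> a \<or> b \<le> s \<Longrightarrow> bump a b n s = 0"
  by (auto simp: bump_def flat_def zero_less_mult_iff)

lemma bump_le_indicator: "bump a b n s \<le> indicator {a<..<b} s"
  using bump_le_1[of a b n s] bump_eq_0[of s a b n] by (auto split: split_indicator simp: not_less)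

lemma bump_tendsto: "(\<lambda>n. bump a b n s) \<longlonglongrightarrow> indicator {a<..<b} s"
proof (cases "a < s \<and> s < b")
  case True
  have lim: "(\<lambda>n. exp (- (1 / (real (Suc n) * c)))) \<longlonglongrightarrow> 1" if "0 < c" for c :: real
  proof -
    have "(\<lambda>n. exp (- (inverse (real (Suc n)) * (1 / c)))) \<longlonglongrightarrow> exp (- (0 * (1 / c)))"
      by (intro tendsto_intros LIMSEQ_inverse_real_of_nat)
    then show ?thesis by (simp add: divide_simps)
  qed
  have "(\<lambda>n. exp (- (1 / (real (Suc n) * (s - a)))) * exp (- (1 / (real (Suc n) * (b - s))))) \<longlonglongrightarrow> 1 * 1"
    using True by (intro tendsto_mult lim) auto
  then show ?thesis
    using True by (simp add: bump_def flat_def zero_less_mult_iff)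
next
  case False
  then show ?thesis by (auto simp: bump_eq_0 not_less)
qed

lemma continuous_on_smooth_line: "smooth_line f \<Longrightarrow> continuous_on S f"
  by (metis DERIV_isCont continuous_at_imp_continuous_on smooth_line_derivatives)

lemma bump_measurable [measurable]: "bump a b n \<in> borel_measurable borel"
  by (intro borel_measurable_continuous_onI continuous_on_smooth_line smooth_line_bump)

section \<open>Test functions on the plane\<close>

lemma test_function_product:
  assumes f: "smooth_line f" "\<And>x. x \<le> a \<or> b \<le> x \<Longrightarrow> f x = 0"
    and g: "smooth_line g" "\<And>y. y \<le> c \<or> d \<le> y \<Longrightarrow> g y = 0"
  shows "test_function (\<lambda>z. f (fst z) * g (snd z))"
proof -
  obtain df where df: "df 0 = f" "\<And>k x. (df k has_real_derivative df (Suc k) x) (at x)"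
    using smooth_line_derivatives[OF f(1)] by blast
  obtain dg where dg: "dg 0 = g" "\<And>k x. (dg k has_real_derivative dg (Suc k) x) (at x)"
    using smooth_line_derivatives[OF g(1)] by blast
  have cont: "continuous_on UNIV (df k)" "continuous_on UNIV (dg k)" for k
    by (meson df(2) dg(2) DERIV_isCont continuous_at_imp_continuous_on)+
  have "smooth_plane (\<lambda>z. f (fst z) * g (snd z))"
    unfolding smooth_plane_def
  proof (intro exI[of _ "\<lambda>m n z. df m (fst z) * dg n (snd z)"] conjI allI)
    show "(\<lambda>z. df 0 (fst z) * dg 0 (snd z)) = (\<lambda>z. f (fst z) * g (snd z))"
      by (simp add: df dg)
    fix m n
    show "continuous_on UNIV (\<lambda>z. df m (fst z) * dg n (snd z))"
      by (intro continuous_intros continuous_on_compose2[OF cont(1)] continuous_on_compose2[OF cont(2)]) auto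
    fix x y
    show "((\<lambda>s. df m (fst (s, y)) * dg n (snd (s, y))) has_real_derivative df (Suc m) (fst (x, y)) * dg n (snd (x, y))) (at x)"
      by (auto intro!: derivative_eq_intros df)
    show "((\<lambda>t. df m (fst (x, t)) * dg n (snd (x, t))) has_real_derivative df m (fst (x, y)) * dg (Suc n) (snd (x, y))) (at y)"
      by (auto intro!: derivative_eq_intros dg)
  qed
  moreover have "{z. f (fst z) * g (snd z) \<noteq> 0} \<subseteq> {a..b} \<times> {c..d}"
    using f(2) g(2) by (force simp: not_le[symmetric])
  then have "bounded {z. f (fst z) * g (snd z) \<noteq> 0}"
    by (rule bounded_subset[rotated]) (intro bounded_Times bounded_closed_interval)
  ultimately show ?thesis
    by (simp add: test_function_def)
qed

text \<open>
  Iterated partial derivatives of functions such as \<open>x y w(x\<^sup>2 + y\<^sup>2)\<close> are obtained by formal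
  differentiation; the atom \<open>Radial k\<close> stands for the \<open>k\<close>-th derivative of \<open>w\<close>. That the formal
  partial derivatives commute spares a proof of the symmetry of second derivatives.
\<close>

datatype expr = Fst | Snd | Const real | Radial nat | Add expr expr | Mult expr expr

primrec expr_val :: "(nat \<Rightarrow> real \<Rightarrow> real) \<Rightarrow> expr \<Rightarrow> real \<times> real \<Rightarrow> real" where
  "expr_val w Fst z = fst z"
| "expr_val w Snd z = snd z"
| "expr_val w (Const c) z = c"
| "expr_val w (Radial k) z = w k (rsq z)"
| "expr_val w (Add a b) z = expr_val w a z + expr_val w b z"
| "expr_val w (Mult a b) z = expr_val w a z * expr_val w b z"

primrec expr_dx :: "expr \<Rightarrow> expr" where
  "expr_dx Fst = Const 1"
| "expr_dx Snd = Const 0"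
| "expr_dx (Const c) = Const 0"
| "expr_dx (Radial k) = Mult (Mult (Const 2) Fst) (Radial (Suc k))"
| "expr_dx (Add a b) = Add (expr_dx a) (expr_dx b)"
| "expr_dx (Mult a b) = Add (Mult (expr_dx a) b) (Mult a (expr_dx b))"

primrec expr_dy :: "expr \<Rightarrow> expr" where
  "expr_dy Fst = Const 0"
| "expr_dy Snd = Const 1"
| "expr_dy (Const c) = Const 0"
| "expr_dy (Radial k) = Mult (Mult (Const 2) Snd) (Radial (Suc k))"
| "expr_dy (Add a b) = Add (expr_dy a) (expr_dy b)"
| "expr_dy (Mult a b) = Add (Mult (expr_dy a) b) (Mult a (expr_dy b))"

context
  fixes w :: "nat \<Rightarrow> real \<Rightarrow> real"
  assumes w: "\<And>k x. (w k has_real_derivative w (Suc k) x) (at x)"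
begin

lemma DERIV_expr_fst: "((\<lambda>s. expr_val w e (s, y)) has_real_derivative expr_val w (expr_dx e) (x, y)) (at x)"
proof (induction e)
  case (Radial k)
  show ?case
  proof -
    have "((\<lambda>s. s\<^sup>2 + y\<^sup>2) has_real_derivative 2 * x) (at x)"
      by (auto intro!: derivative_eq_intros)
    from DERIV_chain2[OF w this] show ?thesis
      by (simp add: rsq_def algebra_simps)
  qed
qed (auto intro!: derivative_eq_intros)

lemma DERIV_expr_snd: "((\<lambda>t. expr_val w e (x, t)) has_real_derivative expr_val w (expr_dy e) (x, y)) (at y)"
proof (induction e)
  case (Radial k)
  show ?case
  proof -
    have "((\<lambda>t. x\<^sup>2 + t\<^sup>2) has_real_derivative 2 * y) (at y)"
      by (auto intro!: derivative_eq_intros)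
    from DERIV_chain2[OF w this] show ?thesis
      by (simp add: rsq_def algebra_simps)
  qed
qed (auto intro!: derivative_eq_intros)

lemma continuous_on_expr: "continuous_on UNIV (expr_val w e)"
proof (induction e)
  case (Radial k)
  have "continuous_on UNIV (w k)"
    by (meson w DERIV_isCont continuous_at_imp_continuous_on)
  moreover have "continuous_on UNIV rsq"
    unfolding rsq_def by (intro continuous_intros)
  ultimately have "continuous_on UNIV (\<lambda>z. w k (rsq z))"
    by (rule continuous_on_compose2) simp
  then show ?case by simp
qed (simp_all add: continuous_on_fst continuous_on_snd continuous_on_id continuous_on_add continuous_on_mult)

lemma expr_dx_dy: "expr_val w (expr_dx (expr_dy e)) z = expr_val w (expr_dy (expr_dx e)) z"
  by (induction e) (auto simp: algebra_simps)

text \<open>Mixed formal derivatives agree in value but are different terms, so the induction that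
  follows cannot rewrite under \<open>expr_dy\<close>. Uniqueness of the derivative makes
  \<open>expr_dy\<close> respect equality of values.\<close>

lemma expr_dy_cong:
  assumes "\<And>z. expr_val w e z = expr_val w e' z"
  shows "expr_val w (expr_dy e) z = expr_val w (expr_dy e') z"
  using DERIV_expr_snd[of e "fst z" "snd z"] DERIV_expr_snd[of e' "fst z" "snd z"] assms DERIV_unique
  by fastforce

text \<open>The family of partial derivatives chosen below takes all x-derivatives before the
  y-derivatives, so a further x-derivative has to be moved past the latter.\<close>

lemma expr_dx_dy_iterate: "expr_val w (expr_dx ((expr_dy ^^ n) e)) z = expr_val w ((expr_dy ^^ n) (expr_dx e)) z"
proof (induction n arbitrary: z)
  case (Suc n)
  show ?case
    using expr_dy_cong[OF Suc.IH] by (simp add: expr_dx_dy)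
qed simp

lemma smooth_plane_expr: "smooth_plane (expr_val w e)"
  unfolding smooth_plane_def
proof (intro exI[of _ "\<lambda>m n. expr_val w ((expr_dy ^^ n) ((expr_dx ^^ m) e))"] conjI allI)
  fix m n x y
  show "continuous_on UNIV (expr_val w ((expr_dy ^^ n) ((expr_dx ^^ m) e)))"
    by (rule continuous_on_expr)
  show "((\<lambda>s. expr_val w ((expr_dy ^^ n) ((expr_dx ^^ m) e)) (s, y)) has_real_derivative
      expr_val w ((expr_dy ^^ n) ((expr_dx ^^ Suc m) e)) (x, y)) (at x)"
    using DERIV_expr_fst[of "(expr_dy ^^ n) ((expr_dx ^^ m) e)" y x] by (simp add: expr_dx_dy_iterate)
  show "((\<lambda>t. expr_val w ((expr_dy ^^ n) ((expr_dx ^^ m) e)) (x, t)) has_real_derivative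
      expr_val w ((expr_dy ^^ Suc n) ((expr_dx ^^ m) e)) (x, y)) (at y)"
    using DERIV_expr_snd by simp
qed simp

end

lemma test_function_xy_radial:
  assumes w: "smooth_line w" "\<And>s. R \<le> s \<Longrightarrow> w s = 0"
  shows "test_function (\<lambda>z. fst z * snd z * w (rsq z))"
proof -
  obtain d where d: "d 0 = w" "\<And>k x. (d k has_real_derivative d (Suc k) x) (at x)"
    using smooth_line_derivatives[OF w(1)] by blast
  have "expr_val d (Mult (Mult Fst Snd) (Radial 0)) = (\<lambda>z. fst z * snd z * w (rsq z))"
    by (simp add: fun_eq_iff d(1))
  then have "smooth_plane (\<lambda>z. fst z * snd z * w (rsq z))"
    using smooth_plane_expr[of d, OF d(2), of "Mult (Mult Fst Snd) (Radial 0)"] by simp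
  moreover have "{z. fst z * snd z * w (rsq z) \<noteq> 0} \<subseteq> cball 0 (sqrt \<bar>R\<bar>)"
  proof clarify
    fix x y assume "fst (x, y) * snd (x, y) * w (rsq (x, y)) \<noteq> 0"
    then have "rsq (x, y) \<le> \<bar>R\<bar>" using w(2)[of "rsq (x, y)"] by force
    then show "(x, y) \<in> cball 0 (sqrt \<bar>R\<bar>)"
      by (auto simp: rsq_def norm_prod_def)
  qed
  then have "bounded {z. fst z * snd z * w (rsq z) \<noteq> 0}"
    by (rule bounded_subset[rotated]) simp
  ultimately show ?thesis
    by (simp add: test_function_def)
qed

section \<open>The fundamental lemma of the calculus of variations\<close>

lemma integrable_mult_square:
  fixes f g :: "'a \<Rightarrow> real"
  assumes [measurable]: "f \<in> borel_measurable M" "g \<in> borel_measurable M"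
    and "integrable M (\<lambda>x. (f x)\<^sup>2)" "integrable M (\<lambda>x. (g x)\<^sup>2)"
  shows "integrable M (\<lambda>x. f x * g x)"
proof (rule Bochner_Integration.integrable_bound)
  show "integrable M (\<lambda>x. (f x)\<^sup>2 + (g x)\<^sup>2)"
    using assms by simp
  have "norm (a * b) \<le> norm (a\<^sup>2 + b\<^sup>2)" for a b :: real
  proof -
    have "2 * (\<bar>a\<bar> * \<bar>b\<bar>) \<le> a\<^sup>2 + b\<^sup>2"
      using sum_squares_bound[of "\<bar>a\<bar>" "\<bar>b\<bar>"] by (simp add: mult.assoc)
    moreover have "0 \<le> \<bar>a\<bar> * \<bar>b\<bar>" by simp
    ultimately show ?thesis unfolding real_norm_def abs_mult by linarith
  qed
  then show "AE x in M. norm (f x * g x) \<le> norm ((f x)\<^sup>2 + (g x)\<^sup>2)"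
    by blast
qed measurable

lemma integrable_mult_bounded_support:
  fixes f h :: "real \<Rightarrow> real"
  assumes [measurable]: "f \<in> borel_measurable borel" and "integrable lborel (\<lambda>x. (f x)\<^sup>2)"
    and h: "continuous_on UNIV h" "\<And>x. x \<le> a \<or> b \<le> x \<Longrightarrow> h x = 0"
  shows "integrable lborel (\<lambda>x. h x * f x)"
proof (rule integrable_mult_square)
  show "h \<in> borel_measurable lborel"
    using h(1) by (simp add: borel_measurable_continuous_onI)
  have "integrable lborel (\<lambda>x. indicator {a..b} x *\<^sub>R (h x)\<^sup>2)"
    by (intro borel_integrable_compact continuous_intros continuous_on_subset[OF h(1)]) auto
  also have "(\<lambda>x. indicator {a..b} x *\<^sub>R (h x)\<^sup>2) = (\<lambda>x. (h x)\<^sup>2)"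
    using h(2) by (auto simp: fun_eq_iff split: split_indicator)
  finally show "integrable lborel (\<lambda>x. (h x)\<^sup>2)" .
qed (use assms in auto)

lemma integrable_indicator_mult_square:
  fixes f :: "'a \<Rightarrow> real"
  assumes [measurable]: "f \<in> borel_measurable M" "A \<in> sets M"
    and "emeasure M A < \<infinity>" "integrable M (\<lambda>x. (f x)\<^sup>2)"
  shows "integrable M (\<lambda>x. indicator A x * f x)"
proof (rule integrable_mult_square)
  have "(\<lambda>x. (indicator A x :: real)\<^sup>2) = indicator A"
    by (auto simp: fun_eq_iff split: split_indicator)
  then show "integrable M (\<lambda>x. (indicator A x :: real)\<^sup>2)"
    using assms by simp
qed (use assms in auto)

text \<open>Products of two bumps are test functions that converge to the indicator of a box and are
  dominated by it, so all integrals over boxes vanish.\<close>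

lemma AE_eq_0_if_test_integrals_eq_0:
  fixes f :: "real \<times> real \<Rightarrow> real"
  assumes [measurable]: "f \<in> borel_measurable borel"
    and sq: "integrable lborel (\<lambda>z. (f z)\<^sup>2)"
    and test: "\<And>\<phi>. test_function \<phi> \<Longrightarrow> (LINT z|lborel. \<phi> z * f z) = 0"
  shows "AE z in lborel. f z = 0"
proof (rule AE_eq_0_if_box_integrals_eq_0)
  fix p q :: "real \<times> real"
  show int: "integrable lborel (\<lambda>z. indicator (box p q) z * f z)"
    using sq by (intro integrable_indicator_mult_square emeasure_bounded_finite bounded_box)
      (simp_all add: emeasure_bounded_finite)
  obtain a c where p: "p = (a, c)" by (cases p)
  obtain b d where q: "q = (b, d)" by (cases q)
  have box: "indicator (box p q) z = (indicator {a<..<b} (fst z) * indicator {c<..<d} (snd z) :: real)" for z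
    by (cases z) (auto simp: p q mem_box Basis_prod_def split: split_indicator)
  let ?\<phi> = "\<lambda>n z. bump a b n (fst z) * bump c d n (snd z)"
  have "(\<lambda>n. LINT z|lborel. ?\<phi> n z * f z) \<longlonglongrightarrow> (LINT z|lborel. indicator (box p q) z * f z)"
  proof (rule integral_dominated_convergence)
    show "integrable lborel (\<lambda>z. \<bar>indicator (box p q) z * f z\<bar>)"
      using int by simp
    show "AE z in lborel. (\<lambda>n. ?\<phi> n z * f z) \<longlonglongrightarrow> indicator (box p q) z * f z"
      unfolding box by (intro AE_I2 tendsto_intros bump_tendsto)
    show "AE z in lborel. norm (?\<phi> n z * f z) \<le> \<bar>indicator (box p q) z * f z\<bar>" for n
      unfolding box
      by (intro AE_I2) (auto simp: abs_mult intro!: mult_right_mono mult_mono bump_le_indicator)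
  qed measurable
  moreover have "(LINT z|lborel. ?\<phi> n z * f z) = 0" for n
    by (intro test test_function_product[where a = a and b = b and c = c and d = d] smooth_line_bump bump_eq_0)
  ultimately show "(LINT z|lborel. indicator (box p q) z * f z) = 0"
    by (simp add: LIMSEQ_const_iff)
qed fact

lemma antiderivative_UNIV:
  fixes f :: "real \<Rightarrow> real"
  assumes "continuous_on UNIV f"
  obtains F where "\<And>x. (F has_real_derivative f x) (at x)"
proof -
  have "\<exists>F. \<forall>x::real. -\<infinity> < ereal x \<longrightarrow> ereal x < \<infinity> \<longrightarrow> (F has_vector_derivative f x) (at x)"
    using assms by (intro einterval_antiderivative) (auto simp: continuous_on_eq_continuous_at)
  then show ?thesis
    using that by (auto simp: has_real_derivative_iff_has_vector_derivative)
qed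

text \<open>W stays constant beyond b, so it does not have compact support. The last property, W as
  an integral over t < s, is what Fubini's theorem later turns into a tail integral.\<close>

lemma bump_antiderivative:
  assumes "a < b"
  obtains W where "smooth_line W" "\<And>x. (W has_real_derivative bump a b n x) (at x)"
    "\<And>s. s \<le> a \<Longrightarrow> W s = 0" "\<And>s. b \<le> s \<Longrightarrow> W s = W b"
    "\<And>s. W s = (LINT t|lborel. bump a b n t * indicator {..<s} t)"
proof -
  obtain F where F: "\<And>x. (F has_real_derivative bump a b n x) (at x)"
    using antiderivative_UNIV continuous_on_smooth_line smooth_line_bump by metis
  have const: "F s = F t" if "s \<le> t" "t \<le> a \<or> b \<le> s" for s t
  proof (cases "s < t")
    case True
    have "(F has_real_derivative 0) (at x)" if "s < x" "x < t" for x
      using F[of x] bump_eq_0[of x a b n] that \<open>t \<le> a \<or> b \<le> s\<close> by auto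
    moreover have "continuous_on {s..t} F"
      using F by (meson DERIV_isCont continuous_at_imp_continuous_on)
    ultimately show ?thesis
      using DERIV_isconst_end[OF True] by metis
  qed (use that in simp)
  let ?W = "\<lambda>s. F s - F a"
  have "(?W has_real_derivative bump a b n x) (at x)" for x
    using F by (auto intro!: derivative_eq_intros)
  moreover from this have "smooth_line ?W"
    by (rule smooth_line_integral[OF smooth_line_bump])
  moreover have "?W s = 0" if "s \<le> a" for s
    using const[of s a] that by simp
  moreover have "?W s = ?W b" if "b \<le> s" for s
    using const[of b s] that by simp
  moreover have "?W s = (LINT t|lborel. bump a b n t * indicator {..<s} t)" for s
  proof (cases "a \<le> s")
    case True
    have "(LINT t|lborel. bump a b n t * indicator {..<s} t) = (LINT t|lborel. indicator {a..s} t *\<^sub>R bump a b n t)"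
    proof (rule integral_cong_AE)
      show "AE t in lborel. bump a b n t * indicator {..<s} t = indicator {a..s} t *\<^sub>R bump a b n t"
        using AE_lborel_singleton[of s] by eventually_elim (auto simp: bump_eq_0 split: split_indicator)
    qed measurable
    also have "\<dots> = F s - F a"
      using True F
      by (intro integral_FTC_atLeastAtMost continuous_on_smooth_line smooth_line_bump)
        (auto simp: has_real_derivative_iff_has_vector_derivative[symmetric] intro: DERIV_subset)
    finally show ?thesis by simp
  next
    case False
    then have "(\<lambda>t. bump a b n t * indicator {..<s} t) = (\<lambda>_. 0)"
      by (auto simp: fun_eq_iff bump_eq_0 split: split_indicator)
    then show ?thesis using False const[of s a] by simp
  qed
  ultimately show ?thesis using that by blast
qed

section \<open>Weak derivatives of radial functions\<close>

text \<open>What remains of the test function x y V(r^2) / r^4 when V is split off.\<close>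

definition kern :: "real \<times> real \<Rightarrow> real" where
  "kern z = fst z * snd z / (rsq z)\<^sup>2"

lemma kern_measurable [measurable]: "kern \<in> borel_measurable borel"
  unfolding kern_def[abs_def] by measurable

lemma nn_integral_inverse_sqrt:
  assumes "0 < q"
  shows "(\<integral>\<^sup>+t. ennreal (indicator {0<..<q} t / sqrt t) \<partial>lborel) = ennreal (2 * sqrt q)"
proof -
  have D: "DERIV (\<lambda>t. 2 * sqrt t) x :> 1 / sqrt x" if "0 < x" for x :: real
    using that by (auto intro!: derivative_eq_intros simp: divide_simps)
  have "((\<lambda>t. 2 * sqrt t) \<longlongrightarrow> 2 * sqrt 0) (at_right 0)"
    by (intro tendsto_intros)
  then have lim: "((\<lambda>t. 2 * sqrt t) \<longlongrightarrow> 0) (at_right 0)" by simp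
  have ftc: "set_integrable lborel (einterval 0 q) (\<lambda>t. 1 / sqrt t)"
      "(LBINT x=0..q. 1 / sqrt x) = 2 * sqrt q - 2 * sqrt 0"
    by (rule interval_integral_FTC_nonneg[where F = "\<lambda>t. 2 * sqrt t"];
        use assms D lim in \<open>auto simp: zero_ereal_def ereal_tendsto_simps intro!: tendsto_intros
          continuous_intros\<close>)+
  have e: "einterval 0 q = {0<..<q}"
    by (auto simp: einterval_def zero_ereal_def)
  have "integrable lborel (\<lambda>t. indicator {0<..<q} t / sqrt t)"
       "(LINT t|lborel. indicator {0<..<q} t / sqrt t) = 2 * sqrt q"
    using ftc assms by (simp_all add: e set_integrable_def interval_lebesgue_integral_def
      set_lebesgue_integral_def zero_ereal_def)
  then show ?thesis
    by (subst nn_integral_eq_integral) (auto split: split_indicator)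
qed

text \<open>The denominator is r^7: the integrand is \<open>kern\<close> squared times r, that is,
  the square of x y / r^3 with the weight 1 / r. It is one of the two factors in the weighted
  Cauchy-Schwarz inequality.\<close>

lemma nn_integral_radial_tail:
  assumes "0 < t"
  shows "(\<integral>\<^sup>+z. ennreal (indicator {t<..} (rsq z) * (fst z * snd z)\<^sup>2 / (rsq z ^ 3 * sqrt (rsq z))) \<partial>lborel)
    = ennreal (pi / 4 / sqrt t)"
proof -
  have "(\<integral>\<^sup>+z. ennreal (indicator {t<..} (rsq z) * (fst z * snd z)\<^sup>2 / (rsq z ^ 3 * sqrt (rsq z))) \<partial>lborel)
     = (\<integral>\<^sup>+z. ennreal ((fst z * snd z)\<^sup>2) * ennreal (indicator {t<..} (rsq z) / (rsq z ^ 3 * sqrt (rsq z))) \<partial>lborel)"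
    by (intro nn_integral_cong) (simp add: ennreal_mult'[symmetric] mult.commute)
  also have "\<dots> = (\<integral>\<^sup>+s. ennreal (pi / 8 * s\<^sup>2 * indicator {0..} s) * ennreal (indicator {t<..} s / (s ^ 3 * sqrt s)) \<partial>lborel)"
    by (rule nn_integral_radial_x2y2) measurable
  also have "\<dots> = (\<integral>\<^sup>+s. ennreal (pi / 8 / (s * sqrt s)) * indicator {t..} s \<partial>lborel)"
  proof (rule nn_integral_cong_AE)
    show "AE s in lborel. ennreal (pi / 8 * s\<^sup>2 * indicator {0..} s) * ennreal (indicator {t<..} s / (s ^ 3 * sqrt s))
        = ennreal (pi / 8 / (s * sqrt s)) * indicator {t..} s"
      using AE_lborel_singleton[of t]
    proof eventually_elim
      fix s assume "s \<noteq> t"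
      then show "ennreal (pi / 8 * s\<^sup>2 * indicator {0..} s) * ennreal (indicator {t<..} s / (s ^ 3 * sqrt s))
        = ennreal (pi / 8 / (s * sqrt s)) * indicator {t..} s"
        using assms by (cases "t < s")
          (auto simp: ennreal_mult'[symmetric] field_simps power2_eq_square power3_eq_cube)
    qed
  qed
  also have "\<dots> = ennreal (0 - (- (pi / 4) / sqrt t))"
  proof (rule nn_integral_FTC_atLeast)
    show "((\<lambda>s. - (pi / 4) / sqrt s) has_real_derivative pi / 8 / (s * sqrt s)) (at s)" if "t \<le> s" for s
      using that assms by (auto intro!: derivative_eq_intros simp: divide_simps)
    show "((\<lambda>s. - (pi / 4) / sqrt s) \<longlongrightarrow> 0) at_top"
      by (intro real_tendsto_divide_at_top[OF tendsto_const] sqrt_at_top)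
  qed (use assms in auto)
  finally show ?thesis by simp
qed

lemma integrable_indicator_Ioo: "integrable lborel (indicator {c<..<d} :: real \<Rightarrow> real)"
  by (cases "c \<le> d") (auto intro!: integrable_real_indicator)

lemma indicator_rsq_measurable [measurable]:
  "(\<lambda>p. indicator {fst p<..} (rsq (snd p)) :: real) \<in> borel_measurable (borel \<Otimes>\<^sub>M borel)"
proof -
  have "(\<lambda>p. indicator {fst p<..} (rsq (snd p)) :: real) = (\<lambda>p. if fst p < rsq (snd p) then 1 else 0)"
    by (auto simp: fun_eq_iff)
  then show ?thesis by simp
qed

text \<open>The function g is x d/dy of the function z |-> \<open>u (rsq z)\<close> in the sense of
  distributions, everything being real. Up to the factor pi, \<open>u_square\<close> is the
  square-integrability of that function.\<close>

locale radial_weak_derivative =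
  fixes u :: "real \<Rightarrow> real" and g :: "real \<times> real \<Rightarrow> real"
  assumes u_measurable [measurable]: "u \<in> borel_measurable borel"
    and g_measurable [measurable]: "g \<in> borel_measurable borel"
    and u_square: "integrable lborel (\<lambda>s. indicator {0..} s * (u s)\<^sup>2)"
    and g_square: "integrable lborel (\<lambda>z. (g z)\<^sup>2)"
    and weak: "\<And>\<phi>. test_function \<phi> \<Longrightarrow>
      (LINT z|lborel. \<phi> z * g z) = - (LINT z|lborel. fst z * deriv_snd \<phi> z * u (rsq z))"
begin

text \<open>A profile is arbitrary at negative arguments, which \<open>rsq\<close> never takes; the
  cut-off turns integrals over the half-line into integrals over the line.\<close>

definition v :: "real \<Rightarrow> real" where
  "v s = indicator {0..} s * u s"

lemma v_measurable [measurable]: "v \<in> borel_measurable borel"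
  unfolding v_def[abs_def] by measurable

lemma v_square: "integrable lborel (\<lambda>s. (v s)\<^sup>2)"
proof -
  have "(\<lambda>s. (v s)\<^sup>2) = (\<lambda>s. indicator {0..} s * (u s)\<^sup>2)"
    by (auto simp: v_def fun_eq_iff split: split_indicator)
  then show ?thesis using u_square by simp
qed

text \<open>The radial averages of x^2 and x^2 y^2 have the weights pi/2 s and pi/8 s^2, so x d/dy
  (x y w) = x^2 w + 2 x^2 y^2 w' averages to pi/4 (s^2 w)'. Hence the choice w = V / s^2 leaves
  exactly V' on the right. V has to vanish near 0 for w to be smooth.\<close>

lemma weak_radial:
  assumes V: "smooth_line V" "\<And>x. (V has_real_derivative V' x) (at x)"
    and V': "continuous_on UNIV V'"
    and supp: "0 < \<alpha>" "\<And>s. s \<le> \<alpha> \<or> R \<le> s \<Longrightarrow> V s = 0" "\<And>s. s \<le> \<alpha> \<or> R \<le> s \<Longrightarrow> V' s = 0"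
  shows "(LINT z|lborel. kern z * g z * V (rsq z)) = - (pi / 4) * (LINT s|lborel. V' s * v s)"
proof -
  define w where "w = (\<lambda>s. V s / s\<^sup>2)"
  define w' where "w' = (\<lambda>s. V' s / s\<^sup>2 - 2 * V s / s ^ 3)"
  have w: "smooth_line w"
    using V(1) supp times_diff_divide_power[of \<alpha> _ V 2] by (auto simp: smooth_line_def w_def)
  have dw: "(w has_real_derivative w' s) (at s)" for s
  proof (cases "s < \<alpha>")
    case True
    have "((\<lambda>_. 0) has_real_derivative 0) (at s)" by simp
    then have "(w has_real_derivative 0) (at s)"
      by (rule has_field_derivative_transform_within_open[where S = "{..<\<alpha>}"])
        (use True supp in \<open>auto simp: w_def\<close>)
    then show ?thesis using True supp by (simp add: w'_def)
  next
    case False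
    then have "s \<noteq> 0" using supp by auto
    then show ?thesis
      unfolding w_def w'_def
      by (intro DERIV_cong[OF DERIV_divide[OF V(2) DERIV_power'[of s 2]]])
        (auto simp: field_simps power2_eq_square power3_eq_cube)
  qed
  have w_supp: "w s = 0" "w' s = 0" if "s \<le> \<alpha> \<or> R \<le> s" for s
    using supp that by (auto simp: w_def w'_def)
  have w'_cont: "continuous_on UNIV w'"
  proof -
    obtain d where d: "d 0 = w" "\<And>k x. (d k has_real_derivative d (Suc k) x) (at x)"
      using smooth_line_derivatives[OF w] by blast
    then have "w' = d 1" using dw DERIV_unique by (metis One_nat_def ext)
    then show ?thesis
      using d(2)[of 1] by (meson DERIV_isCont continuous_at_imp_continuous_on)
  qed
  have [measurable]: "w \<in> borel_measurable borel" "w' \<in> borel_measurable borel"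
      "V \<in> borel_measurable borel" "V' \<in> borel_measurable borel"
    using w w'_cont V V' by (auto intro!: borel_measurable_continuous_onI continuous_on_smooth_line)
  let ?\<phi> = "\<lambda>z. fst z * snd z * w (rsq z)"
  have test: "test_function ?\<phi>"
    using w w_supp by (intro test_function_xy_radial) auto
  have dphi: "deriv_snd ?\<phi> z = fst z * w (rsq z) + 2 * fst z * (snd z)\<^sup>2 * w' (rsq z)" for z
  proof -
    obtain x y where z: "z = (x, y)" by (cases z)
    have q: "((\<lambda>t. x\<^sup>2 + t\<^sup>2) has_real_derivative 2 * y) (at y)"
      by (auto intro!: derivative_eq_intros)
    have "((\<lambda>t. w (x\<^sup>2 + t\<^sup>2)) has_real_derivative w' (x\<^sup>2 + y\<^sup>2) * (2 * y)) (at y)"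
      by (rule DERIV_chain2[OF dw q])
    then have "((\<lambda>t. x * t * w (x\<^sup>2 + t\<^sup>2)) has_real_derivative x * w (x\<^sup>2 + y\<^sup>2) + 2 * x * y\<^sup>2 * w' (x\<^sup>2 + y\<^sup>2)) (at y)"
      by (auto intro!: derivative_eq_intros simp: power2_eq_square)
    then show ?thesis
      unfolding deriv_snd_def z by (simp add: rsq_def DERIV_imp_deriv)
  qed
  have i1: "integrable lborel (\<lambda>s. pi / 2 * s * indicator {0..} s * (w s * u s))"
  proof -
    have "integrable lborel (\<lambda>s. (pi / 2 * s * w s) * v s)"
      using w_supp w v_square
      by (intro integrable_mult_bounded_support[where a = \<alpha> and b = R] continuous_intros continuous_on_smooth_line) auto
    then show ?thesis by (simp add: v_def mult_ac)
  qed
  have i2: "integrable lborel (\<lambda>s. pi / 8 * s\<^sup>2 * indicator {0..} s * (2 * w' s * u s))"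
  proof -
    have "integrable lborel (\<lambda>s. (pi / 4 * s\<^sup>2 * w' s) * v s)"
      using w_supp w'_cont v_square
      by (intro integrable_mult_bounded_support[where a = \<alpha> and b = R] continuous_intros) auto
    then show ?thesis by (simp add: v_def mult_ac)
  qed
  have "(LINT z|lborel. kern z * g z * V (rsq z)) = (LINT z|lborel. ?\<phi> z * g z)"
    by (intro Bochner_Integration.integral_cong) (auto simp: kern_def w_def)
  also have "\<dots> = - (LINT z|lborel. fst z * deriv_snd ?\<phi> z * u (rsq z))"
    by (rule weak[OF test])
  also have "(LINT z|lborel. fst z * deriv_snd ?\<phi> z * u (rsq z))
      = (LINT z|lborel. (fst z)\<^sup>2 * (w (rsq z) * u (rsq z)) + (fst z * snd z)\<^sup>2 * (2 * w' (rsq z) * u (rsq z)))"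
    unfolding dphi
    by (intro Bochner_Integration.integral_cong) (auto simp: algebra_simps power2_eq_square)
  also have "\<dots> = (LINT z|lborel. (fst z)\<^sup>2 * (w (rsq z) * u (rsq z)))
      + (LINT z|lborel. (fst z * snd z)\<^sup>2 * (2 * w' (rsq z) * u (rsq z)))"
    using radial_x2_integrable[of "\<lambda>s. w s * u s"] radial_x2y2_integrable[of "\<lambda>s. 2 * w' s * u s"] i1 i2
    by (intro Bochner_Integration.integral_add) auto
  also have "\<dots> = (LINT s|lborel. pi / 2 * s * indicator {0..} s * (w s * u s))
      + (LINT s|lborel. pi / 8 * s\<^sup>2 * indicator {0..} s * (2 * w' s * u s))"
    using radial_x2_integral[of "\<lambda>s. w s * u s"] radial_x2y2_integral[of "\<lambda>s. 2 * w' s * u s"] by simp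
  also have "\<dots> = (LINT s|lborel. pi / 2 * s * indicator {0..} s * (w s * u s)
      + pi / 8 * s\<^sup>2 * indicator {0..} s * (2 * w' s * u s))"
    using i1 i2 by (rule Bochner_Integration.integral_add[symmetric])
  also have "\<dots> = (LINT s|lborel. pi / 4 * (V' s * v s))"
  proof (intro Bochner_Integration.integral_cong refl)
    fix s :: real
    show "pi / 2 * s * indicator {0..} s * (w s * u s) + pi / 8 * s\<^sup>2 * indicator {0..} s * (2 * w' s * u s)
        = pi / 4 * (V' s * v s)"
    proof (cases "s \<le> \<alpha>")
      case True
      then show ?thesis using w_supp supp by simp
    next
      case False
      then have "0 < s" using supp by simp
      then show ?thesis
        by (simp add: w_def w'_def v_def field_simps power2_eq_square power3_eq_cube)
    qed
  qed
  finally show ?thesis by simp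
qed

text \<open>Outside a disc, \<open>kern\<close> squared is at most 1 / sqrt t times the integrand of
  \<open>nn_integral_radial_tail\<close>, hence integrable; the product with the square-integrable g
  is then integrable.\<close>

lemma kern_tail_integrable:
  assumes "0 < t"
  shows "integrable lborel (\<lambda>z. indicator {t<..} (rsq z) * (kern z * g z))"
proof -
  have "integrable lborel (\<lambda>z. (indicator {t<..} (rsq z) * kern z) * g z)"
  proof (rule integrable_mult_square)
    show "integrable lborel (\<lambda>z. (indicator {t<..} (rsq z) * kern z)\<^sup>2)"
    proof (rule integrableI_bounded)
      have "(\<integral>\<^sup>+z. ennreal (norm ((indicator {t<..} (rsq z) * kern z)\<^sup>2)) \<partial>lborel)
        \<le> (\<integral>\<^sup>+z. ennreal (1 / sqrt t) * ennreal (indicator {t<..} (rsq z) * (fst z * snd z)\<^sup>2 / (rsq z ^ 3 * sqrt (rsq z))) \<partial>lborel)"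
      proof (intro nn_integral_mono)
        fix z
        have "(indicator {t<..} (rsq z) * kern z)\<^sup>2
            \<le> 1 / sqrt t * (indicator {t<..} (rsq z) * (fst z * snd z)\<^sup>2 / (rsq z ^ 3 * sqrt (rsq z)))"
        proof (cases "t < rsq z")
          case True
          let ?q = "rsq z"
          have q: "0 < ?q" "sqrt t < sqrt ?q" "0 < sqrt t" using True assms by auto
          have "(kern z)\<^sup>2 = (fst z * snd z)\<^sup>2 / (?q ^ 3 * sqrt ?q) * (1 / sqrt ?q)"
            using q by (simp add: kern_def power_divide field_simps power2_eq_square power3_eq_cube)
          also have "\<dots> \<le> (fst z * snd z)\<^sup>2 / (?q ^ 3 * sqrt ?q) * (1 / sqrt t)"
            using q by (intro mult_left_mono frac_le) auto
          finally show ?thesis using True by (simp add: mult_ac)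
        qed simp
        then show "ennreal (norm ((indicator {t<..} (rsq z) * kern z)\<^sup>2))
          \<le> ennreal (1 / sqrt t) * ennreal (indicator {t<..} (rsq z) * (fst z * snd z)\<^sup>2 / (rsq z ^ 3 * sqrt (rsq z)))"
          using assms by (simp add: ennreal_mult'[symmetric] del: times_divide_eq_left)
      qed
      also have "\<dots> = ennreal (1 / sqrt t) * ennreal (pi / 4 / sqrt t)"
        using nn_integral_radial_tail[OF assms] by (subst nn_integral_cmult) auto
      also have "\<dots> < \<infinity>"
        by (simp add: ennreal_mult_less_top)
      finally show "(\<integral>\<^sup>+z. ennreal (norm ((indicator {t<..} (rsq z) * kern z)\<^sup>2)) \<partial>lborel) < \<infinity>" .
    qed measurable
  qed (use g_square in auto)
  then show ?thesis by (simp add: mult.assoc)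
qed

section \<open>The tail integral and its pairing with bumps\<close>

definition tail :: "real \<Rightarrow> real" where
  "tail t = (LINT z|lborel. indicator {t<..} (rsq z) * (kern z * g z))"

lemma tail_measurable [measurable]: "tail \<in> borel_measurable borel"
proof -
  have "(\<lambda>t. LINT z|lborel. indicator {t<..} (rsq z) * (kern z * g z)) \<in> borel_measurable borel"
    by (rule lborel.borel_measurable_lebesgue_integral) (simp add: split_beta')
  then show ?thesis unfolding tail_def[abs_def] .
qed

lemma tail_bounded:
  assumes "0 < a" "a \<le> t"
  shows "\<bar>tail t\<bar> \<le> (LINT z|lborel. \<bar>indicator {a<..} (rsq z) * (kern z * g z)\<bar>)"
proof -
  have "\<bar>tail t\<bar> \<le> (LINT z|lborel. norm (indicator {t<..} (rsq z) * (kern z * g z)))"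
    unfolding tail_def real_norm_def[symmetric] by (rule integral_norm_bound)
  also have "\<dots> \<le> (LINT z|lborel. \<bar>indicator {a<..} (rsq z) * (kern z * g z)\<bar>)"
    using assms integrable_norm[OF kern_tail_integrable[of t]] integrable_norm[OF kern_tail_integrable[of a]]
    by (intro integral_mono) (auto simp: abs_mult split: split_indicator)
  finally show ?thesis .
qed

text \<open>If the antiderivative W of the bump had compact support, this would be
  \<open>weak_radial\<close> followed by Fubini's theorem. But W is a nonzero constant beyond b.
  Therefore W(s) - W(s / M) is used, which vanishes near 0 and near infinity. The derivative of the
  stretched copy has L2 norm of order M^(-1/2), so its pairing with the square-integrable v
  disappears as M grows, while the difference itself tends to W.\<close>

lemma bump_identity:
  assumes "0 < a" "a < b"
  shows "integrable lborel (\<lambda>t. bump a b n t * tail t)"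
    and "(LINT t|lborel. bump a b n t * tail t) = - (pi / 4) * (LINT t|lborel. bump a b n t * v t)"
proof -
  let ?B = "bump a b n"
  obtain W where W: "smooth_line W" "\<And>x. (W has_real_derivative ?B x) (at x)"
    "\<And>s. s \<le> a \<Longrightarrow> W s = 0" "\<And>s. b \<le> s \<Longrightarrow> W s = W b"
    "\<And>s. W s = (LINT t|lborel. ?B t * indicator {..<s} t)"
  proof (rule bump_antiderivative[OF \<open>a < b\<close>, of n], goal_cases)
    case (1 W)
    show ?case by (rule 1(1)[of W]) (fact 1)+
  qed
  have [measurable]: "W \<in> borel_measurable borel"
    by (intro borel_measurable_continuous_onI continuous_on_smooth_line W)
  define C where "C = (LINT t|lborel. ?B t)"
  have B_int: "integrable lborel ?B"
    by (rule Bochner_Integration.integrable_bound[of _ "indicator {a<..<b} :: real \<Rightarrow> real"])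
      (auto simp: bump_le_indicator integrable_indicator_Ioo)
  have W_nonneg: "0 \<le> W s" for s
    unfolding W(5) by (intro integral_nonneg_AE AE_I2) (auto split: split_indicator)
  have W_le: "W s \<le> C" for s
    unfolding W(5) C_def
    by (intro integral_mono B_int Bochner_Integration.integrable_bound[OF B_int])
      (auto split: split_indicator)
  have "0 \<le> C" using W_nonneg W_le order_trans by blast
  define D where "D = (LINT s|lborel. (v s)\<^sup>2)"
  \<comment> \<open>The derivative of the stretched copy W(s / (m + 1)).\<close>
  define Bm where "Bm = (\<lambda>m s. ?B (s / real (Suc m)) / real (Suc m))"
  have [measurable]: "Bm m \<in> borel_measurable borel" for m
    unfolding Bm_def by measurable
  \<comment> \<open>Young's inequality with the weight sqrt M, M = m + 1, balances the two terms:
    both are of order 1 / sqrt M after integration, since the stretched interval has length (b - a)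
    M and the square of \<open>Bm\<close> is at most 1 / M^2 on it.\<close>
  have Bm_le: "\<bar>Bm m s * v s\<bar> \<le> (sqrt (real (Suc m)) * (indicator {a * real (Suc m)<..<b * real (Suc m)} s / (real (Suc m))\<^sup>2)
      + (v s)\<^sup>2 / sqrt (real (Suc m))) / 2" for m s
  proof -
    let ?M = "real (Suc m)" and ?r = "sqrt (real (Suc m))"
    have r: "0 < ?r" "?r * ?r = ?M" by simp_all
    have "?B (s / ?M) \<le> indicator {a<..<b} (s / ?M)" by (rule bump_le_indicator)
    also have "\<dots> = indicator {a * ?M<..<b * ?M} s"
      by (auto simp: field_simps split: split_indicator)
    finally have "(?B (s / ?M))\<^sup>2 \<le> (indicator {a * ?M<..<b * ?M} s)\<^sup>2"
      by (intro power_mono) auto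
    also have "\<dots> = (indicator {a * ?M<..<b * ?M} s :: real)"
      by (auto split: split_indicator)
    finally have "(Bm m s)\<^sup>2 \<le> indicator {a * ?M<..<b * ?M} s / ?M\<^sup>2"
      unfolding Bm_def power_divide by (intro divide_right_mono) auto
    then have "?r * (Bm m s)\<^sup>2 \<le> ?r * (indicator {a * ?M<..<b * ?M} s / ?M\<^sup>2)"
      using r by (intro mult_left_mono) auto
    moreover have "2 * \<bar>Bm m s * v s\<bar> \<le> ?r * (Bm m s)\<^sup>2 + (v s)\<^sup>2 / ?r"
    proof -
      have "0 \<le> (?r * \<bar>Bm m s\<bar> - \<bar>v s\<bar>)\<^sup>2 / ?r"
        using r by (intro divide_nonneg_pos) auto
      also have "\<dots> = ?r * (Bm m s)\<^sup>2 + (v s)\<^sup>2 / ?r - 2 * \<bar>Bm m s * v s\<bar>"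
        using r by (simp add: power2_diff power_mult_distrib abs_mult field_simps power2_eq_square)
      finally show ?thesis by simp
    qed
    ultimately show ?thesis by simp
  qed
  have dom_int: "integrable lborel (\<lambda>s. (sqrt (real (Suc m)) * (indicator {a * real (Suc m)<..<b * real (Suc m)} s / (real (Suc m))\<^sup>2)
      + (v s)\<^sup>2 / sqrt (real (Suc m))) / 2)" for m
    using v_square
    by (intro integrable_divide Bochner_Integration.integrable_add integrable_mult_right integrable_indicator_Ioo)
  have Bmv_int: "integrable lborel (\<lambda>s. Bm m s * v s)" for m
    by (rule Bochner_Integration.integrable_bound[OF dom_int[of m]]) (use Bm_le[of m] in \<open>auto intro: order_trans[OF _ abs_ge_self]\<close>)
  have Bm_lim: "(\<lambda>m. LINT s|lborel. Bm m s * v s) \<longlonglongrightarrow> 0"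
  proof (rule Lim_null_comparison)
    show "\<forall>\<^sub>F m in sequentially. norm (LINT s|lborel. Bm m s * v s) \<le> ((b - a) + D) / 2 * sqrt (inverse (real (Suc m)))"
    proof (intro always_eventually allI)
      fix m
      let ?M = "real (Suc m)"
      have "norm (LINT s|lborel. Bm m s * v s) \<le> (LINT s|lborel. norm (Bm m s * v s))"
        by (rule integral_norm_bound)
      also have "\<dots> \<le> (LINT s|lborel. (sqrt ?M * (indicator {a * ?M<..<b * ?M} s / ?M\<^sup>2) + (v s)\<^sup>2 / sqrt ?M) / 2)"
        using Bm_le by (intro integral_mono integrable_norm Bmv_int dom_int) auto
      also have "\<dots> = (sqrt ?M * ((b - a) * ?M / ?M\<^sup>2) + D / sqrt ?M) / 2"
      proof -
        have i: "integrable lborel (\<lambda>s. sqrt ?M * (indicator {a * ?M<..<b * ?M} s / ?M\<^sup>2))"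
          by (intro integrable_mult_right integrable_divide integrable_indicator_Ioo)
        have "(LINT s|lborel. indicator {a * ?M<..<b * ?M} s) = (b - a) * ?M"
          using \<open>a < b\<close> by (simp add: left_diff_distrib)
        then show ?thesis
          using i v_square unfolding D_def by simp
      qed
      also have "\<dots> = ((b - a) + D) / 2 * sqrt (inverse ?M)"
      proof -
        have e1: "sqrt ?M * ((b - a) * ?M / ?M\<^sup>2) = (b - a) / sqrt ?M"
        proof -
          have r: "0 < sqrt ?M" by simp
          have e: "?M = sqrt ?M * sqrt ?M" by simp
          have "x * ((b - a) * (x * x) / (x * x)\<^sup>2) = (b - a) / x" if "0 < x" for x :: real
            using that by (simp add: field_simps power2_eq_square)
          from this[OF r] show ?thesis by (simp only: e[symmetric])
        qed
        have "(x / r + y / r) / 2 = (x + y) / 2 * inverse r" for x y r :: real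
          by (cases "r = 0") (auto simp: field_simps)
        then show ?thesis
          unfolding e1 real_sqrt_inverse by blast
      qed
      finally show "norm (LINT s|lborel. Bm m s * v s) \<le> ((b - a) + D) / 2 * sqrt (inverse ?M)" .
    qed
    have "(\<lambda>m. ((b - a) + D) / 2 * sqrt (inverse (real (Suc m)))) \<longlonglongrightarrow> ((b - a) + D) / 2 * sqrt 0"
      by (intro tendsto_intros LIMSEQ_inverse_real_of_nat)
    then show "(\<lambda>m. ((b - a) + D) / 2 * sqrt (inverse (real (Suc m)))) \<longlonglongrightarrow> 0" by simp
  qed
  have Bv_int: "integrable lborel (\<lambda>s. ?B s * v s)"
    using bump_eq_0 smooth_line_bump v_square
    by (intro integrable_mult_bounded_support[where a = a and b = b] continuous_on_smooth_line) auto
  define V where "V = (\<lambda>m s. W s - W (s / real (Suc m)))"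
  have V_id: "(LINT z|lborel. kern z * g z * V m (rsq z)) = - (pi / 4) * ((LINT s|lborel. ?B s * v s) - (LINT s|lborel. Bm m s * v s))" for m
  proof -
    let ?M = "real (Suc m)"
    have M: "a \<le> a * ?M" "b \<le> b * ?M" using assms by auto
    have dV: "(V m has_real_derivative (?B x - Bm m x)) (at x)" for x
      unfolding V_def Bm_def
      by (intro DERIV_diff W(2) DERIV_cong[OF DERIV_chain2[OF W(2) DERIV_cdivide[OF DERIV_ident]]]) simp
    have sm: "smooth_line (\<lambda>x. ?B x - Bm m x)"
    proof -
      have "times_diff k (\<lambda>x. ?B x + (- 1 / ?M) * ?B ((1 / ?M) * x + 0))" for k
        using smooth_line_bump
        by (intro times_diff_add times_diff_mult times_diff_const times_diff_affine) (auto simp: smooth_line_def)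
      then show ?thesis by (simp add: smooth_line_def Bm_def)
    qed
    have supp: "?B s - Bm m s = 0" "V m s = 0" if "s \<le> a \<or> b * ?M \<le> s" for s
    proof -
      have "s \<le> a \<and> s / ?M \<le> a \<or> b \<le> s \<and> b \<le> s / ?M"
        using that M by (auto simp: divide_le_eq le_divide_eq)
      then show "?B s - Bm m s = 0" "V m s = 0"
        using W(3)[of s] W(3)[of "s / ?M"] W(4)[of s] W(4)[of "s / ?M"]
        by (auto simp: Bm_def V_def bump_eq_0 simp del: of_nat_Suc)
    qed
    have "(LINT z|lborel. kern z * g z * V m (rsq z)) = - (pi / 4) * (LINT s|lborel. (?B s - Bm m s) * v s)"
      using supp assms sm
      by (intro weak_radial[where \<alpha> = a and R = "b * ?M"] dV smooth_line_integral[OF sm dV] continuous_on_smooth_line) auto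
    then show ?thesis
      using Bv_int Bmv_int by (simp add: left_diff_distrib)
  qed
  \<comment> \<open>W takes values between 0 and C, so the difference of two values is bounded by C,
    and it vanishes for \<open>rsq z \<le> a\<close>. Pointwise the subtracted copy tends to W(0) =
    0.\<close>
  have lim1: "(\<lambda>m. LINT z|lborel. kern z * g z * V m (rsq z)) \<longlonglongrightarrow> (LINT z|lborel. kern z * g z * W (rsq z))"
  proof (rule integral_dominated_convergence)
    show "integrable lborel (\<lambda>z. C * \<bar>indicator {a<..} (rsq z) * (kern z * g z)\<bar>)"
      using kern_tail_integrable[OF \<open>0 < a\<close>] by (intro integrable_mult_right integrable_abs)
    show "AE z in lborel. (\<lambda>m. kern z * g z * V m (rsq z)) \<longlonglongrightarrow> kern z * g z * W (rsq z)"
    proof (intro AE_I2)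
      fix z
      have "(\<lambda>m. rsq z * inverse (real (Suc m))) \<longlonglongrightarrow> rsq z * 0"
        by (intro tendsto_intros LIMSEQ_inverse_real_of_nat)
      then have "(\<lambda>m. W (rsq z * inverse (real (Suc m)))) \<longlonglongrightarrow> W (rsq z * 0)"
        by (intro isCont_tendsto_compose[of _ W] DERIV_isCont[OF W(2)])
      then have "(\<lambda>m. V m (rsq z)) \<longlonglongrightarrow> W (rsq z) - 0"
        unfolding V_def using W(3)[of 0] assms by (intro tendsto_diff tendsto_const) (simp add: divide_inverse)
      then show "(\<lambda>m. kern z * g z * V m (rsq z)) \<longlonglongrightarrow> kern z * g z * W (rsq z)"
        by (intro tendsto_mult tendsto_const) simp
    qed
    show "AE z in lborel. norm (kern z * g z * V m (rsq z)) \<le> C * \<bar>indicator {a<..} (rsq z) * (kern z * g z)\<bar>" for m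
    proof (intro AE_I2)
      fix z
      have "a \<le> a * real (Suc m)" using assms by simp
      then have "V m (rsq z) = 0" if "rsq z \<le> a"
        using that W(3)[of "rsq z"] W(3)[of "rsq z / real (Suc m)"] by (simp add: V_def divide_le_eq)
      moreover have "\<bar>V m (rsq z)\<bar> \<le> C"
        using W_nonneg W_le unfolding V_def by (smt (verit))
      ultimately show "norm (kern z * g z * V m (rsq z)) \<le> C * \<bar>indicator {a<..} (rsq z) * (kern z * g z)\<bar>"
        by (cases "rsq z \<le> a") (auto simp: abs_mult mult.commute intro!: mult_right_mono)
    qed
    show "(\<lambda>z. kern z * g z * V m (rsq z)) \<in> borel_measurable lborel" for m
      unfolding V_def by measurable
  qed measurable
  have "(\<lambda>m. - (pi / 4) * ((LINT s|lborel. ?B s * v s) - (LINT s|lborel. Bm m s * v s)))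
      \<longlonglongrightarrow> - (pi / 4) * ((LINT s|lborel. ?B s * v s) - 0)"
    by (intro tendsto_intros Bm_lim)
  with lim1 have main: "(LINT z|lborel. kern z * g z * W (rsq z)) = - (pi / 4) * (LINT s|lborel. ?B s * v s)"
    unfolding V_id by (intro LIMSEQ_unique) auto
  have kW_int: "integrable lborel (\<lambda>z. \<bar>kern z * g z\<bar> * W (rsq z))"
  proof (rule Bochner_Integration.integrable_bound[OF integrable_mult_right[OF integrable_abs[OF kern_tail_integrable[OF \<open>0 < a\<close>]], of C]])
    show "AE z in lborel. norm (\<bar>kern z * g z\<bar> * W (rsq z)) \<le> norm (C * \<bar>indicator {a<..} (rsq z) * (kern z * g z)\<bar>)"
    proof (intro AE_I2)
      fix z show "norm (\<bar>kern z * g z\<bar> * W (rsq z)) \<le> norm (C * \<bar>indicator {a<..} (rsq z) * (kern z * g z)\<bar>)"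
        using W(3)[of "rsq z"] W_nonneg[of "rsq z"] W_le[of "rsq z"] \<open>0 \<le> C\<close>
        by (cases "rsq z \<le> a") (auto simp: abs_mult mult.commute intro!: mult_right_mono)
    qed
  qed measurable
  \<comment> \<open>For Fubini's theorem: integrating over t gives \<open>W (rsq z)\<close>,
    integrating over z gives the tail integral at t.\<close>
  define f where "f = (\<lambda>z t. kern z * g z * (?B t * indicator {t<..} (rsq z)))"
  have ind: "indicator {..<rsq z} t = (indicator {t<..} (rsq z) :: real)" for z t
    by (auto split: split_indicator)
  have [measurable]: "case_prod f \<in> borel_measurable (lborel \<Otimes>\<^sub>M lborel)"
  proof -
    have "case_prod f = (\<lambda>p. kern (fst p) * g (fst p) * (?B (snd p) * (if snd p < rsq (fst p) then 1 else 0)))"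
      by (auto simp: f_def fun_eq_iff)
    then show ?thesis by simp
  qed
  have f_int: "integrable (lborel \<Otimes>\<^sub>M lborel) (case_prod f)"
  proof (rule lborel_pair.Fubini_integrable)
    have "(LINT t|lborel. norm (f z t)) = \<bar>kern z * g z\<bar> * W (rsq z)" for z
    proof -
      have "(LINT t|lborel. norm (f z t)) = (LINT t|lborel. \<bar>kern z * g z\<bar> * (?B t * indicator {..<rsq z} t))"
        by (intro Bochner_Integration.integral_cong) (auto simp: f_def abs_mult ind)
      then show ?thesis by (simp add: W(5))
    qed
    then show "integrable lborel (\<lambda>z. LINT t|lborel. norm (case_prod f (z, t)))"
      using kW_int by simp
    have "integrable lborel (\<lambda>t. ?B t * indicator {t<..} (rsq z))" for z
      unfolding ind[symmetric] by (rule Bochner_Integration.integrable_bound[OF B_int]) (auto split: split_indicator)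
    then show "AE z in lborel. integrable lborel (\<lambda>t. case_prod f (z, t))"
      by (simp add: f_def)
  qed measurable
  have inner: "(LINT z|lborel. f z t) = ?B t * tail t" for t
  proof -
    have "(LINT z|lborel. f z t) = (LINT z|lborel. ?B t * (indicator {t<..} (rsq z) * (kern z * g z)))"
      by (intro Bochner_Integration.integral_cong) (auto simp: f_def)
    then show ?thesis by (simp add: tail_def)
  qed
  show "integrable lborel (\<lambda>t. ?B t * tail t)"
    using lborel_pair.integrable_snd[OF f_int] by (simp add: inner)
  have "(LINT t|lborel. ?B t * tail t) = (LINT t|lborel. LINT z|lborel. f z t)"
    by (simp add: inner)
  also have "\<dots> = (LINT z|lborel. LINT t|lborel. f z t)"
    by (rule lborel_pair.Fubini_integral[OF f_int])
  also have "\<dots> = (LINT z|lborel. kern z * g z * W (rsq z))"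
    by (intro Bochner_Integration.integral_cong refl) (simp add: f_def W(5) ind)
  finally show "(LINT t|lborel. ?B t * tail t) = - (pi / 4) * (LINT t|lborel. ?B t * v t)"
    using main by simp
qed

end

section \<open>A strict Hardy inequality\<close>

lemma not_integrable_inverse:
  assumes "0 < t"
  shows "\<not> integrable lborel (\<lambda>s::real. indicator {t<..} s / s)"
proof
  assume int: "integrable lborel (\<lambda>s::real. indicator {t<..} s / s)"
  define I where "I = (LINT s|lborel. indicator {t<..} s / s)"
  have "0 \<le> I"
    unfolding I_def using assms by (intro integral_nonneg_AE AE_I2) (auto split: split_indicator)
  \<comment> \<open>Chosen so that ln T - ln t = I + 1 exceeds the supposed value I of the whole
    integral.\<close>
  define T where "T = t * exp (I + 1)"
  have "t \<le> T"
    using assms \<open>0 \<le> I\<close> by (simp add: T_def)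
  have cont: "continuous_on {t..T} (\<lambda>s. 1 / s)"
    using assms by (intro continuous_intros) auto
  have "integrable lborel (\<lambda>s. indicator {t..T} s *\<^sub>R (1 / s))"
    using borel_integrable_atLeastAtMost'[OF cont] by (simp add: set_integrable_def)
  moreover have "(LINT s|lborel. indicator {t..T} s *\<^sub>R (1 / s)) = ln T - ln t"
    using \<open>t \<le> T\<close> assms
    by (intro integral_FTC_atLeastAtMost cont)
      (auto simp: has_real_derivative_iff_has_vector_derivative[symmetric] intro!: derivative_eq_intros)
  moreover have "(LINT s|lborel. indicator {t..T} s *\<^sub>R (1 / s)) \<le> I"
    unfolding I_def
  proof (rule integral_mono_AE)
    show "AE s in lborel. indicator {t..T} s *\<^sub>R (1 / s) \<le> indicator {t<..} s / s"
      using AE_lborel_singleton[of t] by eventually_elim (use assms in \<open>auto split: split_indicator\<close>)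
  qed (use calculation(1) int in auto)
  ultimately have "ln T - ln t \<le> I" by simp
  then show False
    using assms by (simp add: T_def ln_mult)
qed

context radial_weak_derivative
begin

lemma indicator_v_integrable: "integrable lborel (\<lambda>t. indicator {a<..<b} t * v t)"
proof (intro integrable_indicator_mult_square emeasure_bounded_finite)
  show "bounded {a<..<b}"
    by (rule bounded_subset[OF bounded_closed_interval[of a b]]) auto
qed (use v_square in auto)

lemma indicator_tail_integrable:
  assumes "0 < a"
  shows "integrable lborel (\<lambda>t. indicator {a<..<b} t * tail t)"
proof (rule Bochner_Integration.integrable_bound)
  let ?C = "LINT z|lborel. \<bar>indicator {a<..} (rsq z) * (kern z * g z)\<bar>"
  show "integrable lborel (\<lambda>t. ?C * indicator {a<..<b} t)"
    by (intro integrable_mult_right integrable_indicator_Ioo)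
  show "AE t in lborel. norm (indicator {a<..<b} t * tail t) \<le> norm (?C * indicator {a<..<b} t)"
    using tail_bounded[OF assms] by (intro AE_I2) (auto split: split_indicator intro: order_trans[OF _ abs_ge_self])
qed measurable

text \<open>Bumps are available only on intervals (a, b) with 0 < a, away from the singularity of
  \<open>kern\<close>. So the identity is obtained beyond each 1 / (k + 1), by letting the bumps
  tend to indicators of intervals, and the countably many null sets are united.\<close>

lemma tail_eq: "AE t in lborel. 0 < t \<longrightarrow> tail t = - (pi / 4) * v t"
proof -
  have "AE t in lborel. indicator {inverse (real (Suc k))<..} t * (tail t + pi / 4 * v t) = 0" for k
  proof (rule AE_eq_0_if_box_integrals_eq_0)
    let ?\<epsilon> = "inverse (real (Suc k))"
    fix a b :: real
    \<comment> \<open>Intersecting the box with the half-line beyond \<epsilon> only moves its left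
      end, so the positive number c serves as left end of the bumps.\<close>
    define c where "c = max a ?\<epsilon>"
    have "0 < c" unfolding c_def by (simp add: less_max_iff_disj)
    have box: "indicator (box a b) t * (indicator {?\<epsilon><..} t * (tail t + pi / 4 * v t))
        = indicator {c<..<b} t * tail t + pi / 4 * (indicator {c<..<b} t * v t)" for t
      by (auto simp: c_def algebra_simps split: split_indicator)
    have int: "integrable lborel (\<lambda>t. indicator {c<..<b} t * tail t + pi / 4 * (indicator {c<..<b} t * v t))"
      using indicator_tail_integrable[OF \<open>0 < c\<close>] indicator_v_integrable by simp
    then show "integrable lborel (\<lambda>t. indicator (box a b) t * (indicator {?\<epsilon><..} t * (tail t + pi / 4 * v t)))"
      unfolding box .
    show "(LINT t|lborel. indicator (box a b) t * (indicator {?\<epsilon><..} t * (tail t + pi / 4 * v t))) = 0"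
    proof (cases "c < b")
      case False
      then have "(\<lambda>t. indicator {c<..<b} t * tail t + pi / 4 * (indicator {c<..<b} t * v t)) = (\<lambda>_. 0)"
        by (auto simp: fun_eq_iff split: split_indicator)
      then show ?thesis unfolding box by simp
    next
      case True
      let ?f = "\<lambda>n t. bump c b n t * tail t + pi / 4 * (bump c b n t * v t)"
      have "(\<lambda>n. LINT t|lborel. ?f n t)
          \<longlonglongrightarrow> (LINT t|lborel. indicator {c<..<b} t * tail t + pi / 4 * (indicator {c<..<b} t * v t))"
      proof (rule integral_dominated_convergence)
        show "integrable lborel (\<lambda>t. \<bar>indicator {c<..<b} t * tail t + pi / 4 * (indicator {c<..<b} t * v t)\<bar>)"
          using int by (rule integrable_abs)
        show "AE t in lborel. (\<lambda>n. ?f n t) \<longlonglongrightarrow> indicator {c<..<b} t * tail t + pi / 4 * (indicator {c<..<b} t * v t)"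
          by (intro AE_I2 tendsto_intros bump_tendsto)
        show "AE t in lborel. norm (?f n t) \<le> \<bar>indicator {c<..<b} t * tail t + pi / 4 * (indicator {c<..<b} t * v t)\<bar>" for n
        proof (intro AE_I2)
          fix t
          have "?f n t = bump c b n t * (tail t + pi / 4 * v t)"
            by (simp add: distrib_left mult.left_commute)
          then have "norm (?f n t) = bump c b n t * \<bar>tail t + pi / 4 * v t\<bar>"
            by (simp only: real_norm_def abs_mult abs_of_nonneg[OF bump_nonneg])
          also have "\<dots> \<le> indicator {c<..<b} t * \<bar>tail t + pi / 4 * v t\<bar>"
            by (intro mult_right_mono bump_le_indicator) simp
          also have "\<dots> = \<bar>indicator {c<..<b} t * tail t + pi / 4 * (indicator {c<..<b} t * v t)\<bar>"
            by (auto split: split_indicator)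
          finally show "norm (?f n t) \<le> \<bar>indicator {c<..<b} t * tail t + pi / 4 * (indicator {c<..<b} t * v t)\<bar>" .
        qed
      qed measurable
      moreover have "(LINT t|lborel. ?f n t) = 0" for n
      proof -
        have "integrable lborel (\<lambda>t. bump c b n t * v t)"
          using v_square bump_eq_0
          by (intro integrable_mult_bounded_support[where a = c and b = b] continuous_on_smooth_line smooth_line_bump) auto
        then show ?thesis
          using bump_identity[OF \<open>0 < c\<close> True, of n] by simp
      qed
      ultimately show ?thesis
        unfolding box by (simp add: LIMSEQ_const_iff)
    qed
  qed measurable
  then have "AE t in lborel. \<forall>k. indicator {inverse (real (Suc k))<..} t * (tail t + pi / 4 * v t) = 0"
    by (simp only: AE_all_countable) simp
  then show ?thesis
  proof eventually_elim
    fix t assume *: "\<forall>k. indicator {inverse (real (Suc k))<..} t * (tail t + pi / 4 * v t) = 0"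
    show "0 < t \<longrightarrow> tail t = - (pi / 4) * v t"
    proof
      assume "0 < t"
      then obtain k where "inverse (real (Suc k)) < t" using reals_Archimedean by blast
      then show "tail t = - (pi / 4) * v t" using *[rule_format, of k] by simp
    qed
  qed
qed

text \<open>The other factor in the weighted Cauchy-Schwarz inequality. With the weight 1 / r, the
  integral of \<open>energy t / sqrt t\<close> over t > 0 returns the plain integral of g^2 up to a
  constant.\<close>

definition energy :: "real \<Rightarrow> real" where
  "energy t = (LINT z|lborel. indicator {t<..} (rsq z) * ((g z)\<^sup>2 / sqrt (rsq z)))"

lemma energy_integrable:
  assumes "0 < t"
  shows "integrable lborel (\<lambda>z. indicator {t<..} (rsq z) * ((g z)\<^sup>2 / sqrt (rsq z)))"
proof (rule Bochner_Integration.integrable_bound)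
  show "integrable lborel (\<lambda>z. (g z)\<^sup>2 / sqrt t)"
    using g_square by simp
  show "AE z in lborel. norm (indicator {t<..} (rsq z) * ((g z)\<^sup>2 / sqrt (rsq z))) \<le> norm ((g z)\<^sup>2 / sqrt t)"
    using assms by (intro AE_I2) (auto intro!: divide_left_mono split: split_indicator)
qed measurable

lemma energy_nonneg: "0 \<le> energy t"
  unfolding energy_def by (intro integral_nonneg_AE AE_I2) simp

lemma energy_measurable [measurable]: "energy \<in> borel_measurable borel"
proof -
  have "(\<lambda>t. LINT z|lborel. indicator {t<..} (rsq z) * ((g z)\<^sup>2 / sqrt (rsq z))) \<in> borel_measurable borel"
    by (rule lborel.borel_measurable_lebesgue_integral) (simp add: split_beta')
  then show ?thesis unfolding energy_def[abs_def] .
qed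

text \<open>Expansion of a square: with the weight 1 / r the cross term of g and x y / r^3 is
  \<open>kern\<close> times g, and the last term is \<open>nn_integral_radial_tail\<close>. At the
  optimal c this nonnegative integral is the gap in the Cauchy-Schwarz inequality; it is kept in
  integral form because the case of a vanishing gap is needed pointwise.\<close>

lemma
  assumes "0 < t"
  shows defect_integrable: "integrable lborel (\<lambda>z. indicator {t<..} (rsq z) *
        ((g z - c * (fst z * snd z / (rsq z * sqrt (rsq z))))\<^sup>2 / sqrt (rsq z)))" (is "integrable lborel ?d")
    and defect_integral: "(LINT z|lborel. indicator {t<..} (rsq z) *
        ((g z - c * (fst z * snd z / (rsq z * sqrt (rsq z))))\<^sup>2 / sqrt (rsq z)))
      = energy t - 2 * c * tail t + c\<^sup>2 * (pi / 4 / sqrt t)"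
proof -
  let ?e1 = "\<lambda>z. indicator {t<..} (rsq z) * ((g z)\<^sup>2 / sqrt (rsq z))"
  let ?e2 = "\<lambda>z. indicator {t<..} (rsq z) * (kern z * g z)"
  let ?e3 = "\<lambda>z. indicator {t<..} (rsq z) * (fst z * snd z)\<^sup>2 / (rsq z ^ 3 * sqrt (rsq z))"
  have i3: "integrable lborel ?e3"
    using nn_integral_radial_tail[OF assms] by (intro integrableI_nonneg) auto
  have v3: "(LINT z|lborel. ?e3 z) = pi / 4 / sqrt t"
    using nn_integral_radial_tail[OF assms] assms
    by (subst (asm) nn_integral_eq_integral[OF i3]) (auto simp: ennreal_inj integral_nonneg_AE)
  have eq: "?d = (\<lambda>z. ?e1 z - 2 * c * ?e2 z + c\<^sup>2 * ?e3 z)"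
  proof
    fix z
    show "?d z = ?e1 z - 2 * c * ?e2 z + c\<^sup>2 * ?e3 z"
    proof (cases "t < rsq z")
      case True
      define r where "r = sqrt (rsq z)"
      have r: "0 < r" and q: "rsq z = r * r" using True assms by (auto simp: r_def)
      show ?thesis
        using True r unfolding r_def[symmetric] kern_def q
        by (simp add: field_simps power2_eq_square power3_eq_cube)
    qed simp
  qed
  note ints = energy_integrable[OF assms] kern_tail_integrable[OF assms] i3
  show "integrable lborel ?d"
    unfolding eq using ints by (intro Bochner_Integration.integrable_add Bochner_Integration.integrable_diff integrable_mult_right)
  have "(LINT z|lborel. ?d z) = (LINT z|lborel. ?e1 z - 2 * c * ?e2 z) + (LINT z|lborel. c\<^sup>2 * ?e3 z)"
    unfolding eq using ints
    by (intro Bochner_Integration.integral_add Bochner_Integration.integrable_diff integrable_mult_right)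
  also have "(LINT z|lborel. ?e1 z - 2 * c * ?e2 z) = (LINT z|lborel. ?e1 z) - (LINT z|lborel. 2 * c * ?e2 z)"
    using ints by (intro Bochner_Integration.integral_diff integrable_mult_right)
  finally show "(LINT z|lborel. ?d z) = energy t - 2 * c * tail t + c\<^sup>2 * (pi / 4 / sqrt t)"
    unfolding integral_mult_right_zero v3 energy_def tail_def by simp
qed

lemma tail_square_le:
  assumes "0 < t"
  shows "(tail t)\<^sup>2 \<le> energy t * (pi / 4 / sqrt t)"
proof -
  define B where "B = pi / 4 / sqrt t"
  have "0 < B" using assms by (simp add: B_def)
  \<comment> \<open>\<open>tail t / B\<close> is the value of c that minimises the quadratic
    polynomial.\<close>
  have "0 \<le> energy t - 2 * (tail t / B) * tail t + (tail t / B)\<^sup>2 * B"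
    unfolding B_def defect_integral[OF assms, symmetric]
    by (intro integral_nonneg_AE AE_I2) simp
  also have "\<dots> = energy t - (tail t)\<^sup>2 / B"
    using \<open>0 < B\<close> by (simp add: field_simps power2_eq_square)
  finally have "(tail t)\<^sup>2 / B \<le> energy t" by simp
  then show ?thesis
    using \<open>0 < B\<close> unfolding B_def[symmetric] by (simp add: divide_le_eq)
qed

text \<open>
  Equality in the Cauchy-Schwarz inequality forces \<open>g\<close> to be a multiple of \<open>x y / r\<^sup>3\<close> outside a
  disc, which is not square-integrable.
\<close>

lemma tail_eq_0:
  assumes "0 < t" "(tail t)\<^sup>2 = energy t * (pi / 4 / sqrt t)"
  shows "tail t = 0"
proof (rule ccontr)
  assume "tail t \<noteq> 0"
  define B where "B = pi / 4 / sqrt t"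
  define c where "c = tail t / B"
  have "0 < B" using assms by (simp add: B_def)
  then have "c \<noteq> 0" using \<open>tail t \<noteq> 0\<close> by (simp add: c_def)
  let ?h = "\<lambda>z. fst z * snd z / (rsq z * sqrt (rsq z))"
  have "energy t - 2 * c * tail t + c\<^sup>2 * B = 0"
    using assms(2) \<open>0 < B\<close> unfolding B_def[symmetric] c_def by (simp add: field_simps power2_eq_square)
  then have "(LINT z|lborel. indicator {t<..} (rsq z) * ((g z - c * ?h z)\<^sup>2 / sqrt (rsq z))) = 0"
    unfolding defect_integral[OF assms(1)] B_def .
  then have "AE z in lborel. indicator {t<..} (rsq z) * ((g z - c * ?h z)\<^sup>2 / sqrt (rsq z)) = 0"
    by (subst (asm) integral_nonneg_eq_0_iff_AE[OF defect_integrable[OF assms(1)]]) auto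
  then have ae: "AE z in lborel. indicator {t<..} (rsq z) * (g z)\<^sup>2
      = c\<^sup>2 * ((fst z * snd z)\<^sup>2 * (indicator {t<..} (rsq z) / rsq z ^ 3))"
  proof eventually_elim
    fix z assume *: "indicator {t<..} (rsq z) * ((g z - c * ?h z)\<^sup>2 / sqrt (rsq z)) = 0"
    show "indicator {t<..} (rsq z) * (g z)\<^sup>2
      = c\<^sup>2 * ((fst z * snd z)\<^sup>2 * (indicator {t<..} (rsq z) / rsq z ^ 3))"
    proof (cases "t < rsq z")
      case True
      define r where "r = sqrt (rsq z)"
      have r: "0 < r" and q: "rsq z = r * r" using True assms by (auto simp: r_def)
      have "(g z - c * ?h z)\<^sup>2 / r = 0" using * True by (simp add: r_def)
      then have "g z = c * ?h z" using r by simp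
      moreover have "?h z = fst z * snd z / (r * r * r)"
        by (simp only: r_def[symmetric]) (simp only: q)
      ultimately have "g z = c * (fst z * snd z / (r * r * r))" by simp
      then show ?thesis
        using True r unfolding q by (simp add: field_simps power2_eq_square power3_eq_cube)
    qed simp
  qed
  have "integrable lborel (\<lambda>z. indicator {t<..} (rsq z) * (g z)\<^sup>2)"
    using g_square
    by (rule Bochner_Integration.integrable_bound) (auto split: split_indicator)
  then have "integrable lborel (\<lambda>z. c\<^sup>2 * ((fst z * snd z)\<^sup>2 * (indicator {t<..} (rsq z) / rsq z ^ 3)))"
    by (subst integrable_cong_AE[OF _ _ ae, symmetric]) auto
  then have "integrable lborel (\<lambda>z. (fst z * snd z)\<^sup>2 * (indicator {t<..} (rsq z) / rsq z ^ 3))"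
    using \<open>c \<noteq> 0\<close> by (simp only: integrable_mult_left_iff integrable_mult_right_iff power_eq_0_iff simp_thms)
  \<comment> \<open>In the radial variable the square of x y / r^3 becomes a multiple of 1 / s,
    whose integral diverges logarithmically.\<close>
  then have "integrable lborel (\<lambda>s. pi / 8 * s\<^sup>2 * indicator {0..} s * (indicator {t<..} s / s ^ 3))"
    by (subst (asm) radial_x2y2_integrable) auto
  also have "(\<lambda>s. pi / 8 * s\<^sup>2 * indicator {0..} s * (indicator {t<..} s / s ^ 3)) = (\<lambda>s. pi / 8 * (indicator {t<..} s / s))"
    using assms(1) by (auto simp: fun_eq_iff power2_eq_square power3_eq_cube split: split_indicator)
  finally have "pi / 8 = 0 \<or> integrable lborel (\<lambda>s. indicator {t<..} s / s)"
    unfolding integrable_mult_left_iff .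
  then show False
    using not_integrable_inverse[OF assms(1)] by simp
qed

text \<open>By Tonelli's theorem the t-integration comes first: 1 / sqrt t over 0 < t <
  \<open>rsq z\<close> has the integral 2 sqrt (\<open>rsq z\<close>), which cancels the weight in
  \<open>energy\<close>. At the origin the left side is 0, which is why the pointwise estimate is an
  inequality.\<close>

lemma
  shows energy_sum_integrable: "integrable lborel (\<lambda>t. indicator {0<..} t * (energy t / sqrt t))"
    and energy_sum_le: "(LINT t|lborel. indicator {0<..} t * (energy t / sqrt t)) \<le> 2 * (LINT z|lborel. (g z)\<^sup>2)"
proof -
  let ?F = "\<lambda>t. indicator {0<..} t * (energy t / sqrt t)"
  let ?f = "\<lambda>t z. ennreal (indicator {0<..} t / sqrt t) * ennreal ((if t < rsq z then 1 else 0) * ((g z)\<^sup>2 / sqrt (rsq z)))"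
  have [measurable]: "(\<lambda>p. ?f (fst p) (snd p)) \<in> borel_measurable (lborel \<Otimes>\<^sub>M lborel)"
    by measurable
  have F: "ennreal (?F t) = (\<integral>\<^sup>+z. ?f t z \<partial>lborel)" for t
  proof (cases "0 < t")
    case True
    have "ennreal (energy t) = (\<integral>\<^sup>+z. ennreal (indicator {t<..} (rsq z) * ((g z)\<^sup>2 / sqrt (rsq z))) \<partial>lborel)"
      unfolding energy_def by (rule nn_integral_eq_integral[OF energy_integrable[OF True], symmetric]) simp
    also have "\<dots> = (\<integral>\<^sup>+z. ennreal ((if t < rsq z then 1 else 0) * ((g z)\<^sup>2 / sqrt (rsq z))) \<partial>lborel)"
      by (intro nn_integral_cong) auto
    finally have e: "ennreal (energy t) = \<dots>" .
    have "ennreal (?F t) = ennreal (indicator {0<..} t / sqrt t) * ennreal (energy t)"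
      using True by (simp add: ennreal_mult'[symmetric])
    also have "\<dots> = (\<integral>\<^sup>+z. ?f t z \<partial>lborel)"
      unfolding e by (rule nn_integral_cmult[symmetric]) measurable
    finally show ?thesis .
  qed simp
  have "(\<integral>\<^sup>+t. ennreal (?F t) \<partial>lborel) = (\<integral>\<^sup>+t. \<integral>\<^sup>+z. ?f t z \<partial>lborel \<partial>lborel)"
    by (simp only: F)
  also have "\<dots> = (\<integral>\<^sup>+z. \<integral>\<^sup>+t. ?f t z \<partial>lborel \<partial>lborel)"
    by (rule lborel_pair.Fubini') (simp add: split_beta')
  also have "\<dots> \<le> (\<integral>\<^sup>+z. ennreal (2 * (g z)\<^sup>2) \<partial>lborel)"
  proof (intro nn_integral_mono)
    fix z
    show "(\<integral>\<^sup>+t. ?f t z \<partial>lborel) \<le> ennreal (2 * (g z)\<^sup>2)"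
    proof (cases "rsq z = 0")
      case True
      then show ?thesis by simp
    next
      case False
      then have q: "0 < rsq z" using rsq_nonneg[of z] by linarith
      have "(\<integral>\<^sup>+t. ?f t z \<partial>lborel)
          = (\<integral>\<^sup>+t. ennreal ((g z)\<^sup>2 / sqrt (rsq z)) * ennreal (indicator {0<..<rsq z} t / sqrt t) \<partial>lborel)"
        by (intro nn_integral_cong) (auto simp: mult.commute split: split_indicator)
      also have "\<dots> = ennreal ((g z)\<^sup>2 / sqrt (rsq z)) * ennreal (2 * sqrt (rsq z))"
        using nn_integral_inverse_sqrt[OF q] by (subst nn_integral_cmult) auto
      also have "\<dots> = ennreal (2 * (g z)\<^sup>2)"
        using q by (simp add: ennreal_mult'[symmetric] mult.commute)
      finally show ?thesis by simp
    qed
  qed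
  also have "\<dots> = ennreal (2 * (LINT z|lborel. (g z)\<^sup>2))"
    using g_square by (subst nn_integral_eq_integral) auto
  finally have le: "(\<integral>\<^sup>+t. ennreal (?F t) \<partial>lborel) \<le> ennreal (2 * (LINT z|lborel. (g z)\<^sup>2))" .
  have nonneg: "0 \<le> ?F t" for t
    using energy_nonneg[of t] by (auto split: split_indicator)
  show int: "integrable lborel ?F"
    using le nonneg by (intro integrableI_nonneg) (auto intro: order_le_less_trans)
  have "ennreal (LINT t|lborel. ?F t) \<le> ennreal (2 * (LINT z|lborel. (g z)\<^sup>2))"
    using le nonneg by (subst nn_integral_eq_integral[OF int, symmetric]) auto
  then show "(LINT t|lborel. ?F t) \<le> 2 * (LINT z|lborel. (g z)\<^sup>2)"
    by (subst (asm) ennreal_le_iff) (auto intro!: integral_nonneg_AE)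
qed

text \<open>Integrating \<open>tail_square_le\<close> over t gives the constant (4/pi)^2 * pi/4 * 2
  = 8/pi. If the strict inequality failed, the nonnegative pointwise difference \<open>?D\<close>
  would have integral at most 0, hence vanish almost everywhere; then the Cauchy-Schwarz inequality
  is an equality for almost every t > 0, and \<open>tail_eq_0\<close> forces v to vanish.\<close>

theorem hardy_strict:
  assumes pos: "0 < (LINT s|lborel. (v s)\<^sup>2)"
  shows "pi / 8 * (LINT s|lborel. (v s)\<^sup>2) < (LINT z|lborel. (g z)\<^sup>2)"
proof (rule ccontr)
  assume "\<not> ?thesis"
  then have le: "(LINT z|lborel. (g z)\<^sup>2) \<le> pi / 8 * (LINT s|lborel. (v s)\<^sup>2)" by simp
  let ?F = "\<lambda>t. indicator {0<..} t * (energy t / sqrt t)"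
  let ?D = "\<lambda>t. 4 / pi * ?F t - (v t)\<^sup>2"
  \<comment> \<open>The point 0 is discarded as a null set: \<open>tail_eq\<close> says nothing
    about it, and v need not vanish there.\<close>
  have v_tail: "AE t in lborel. (0 < t \<longrightarrow> (v t)\<^sup>2 = (4 / pi)\<^sup>2 * (tail t)\<^sup>2) \<and> (t \<le> 0 \<longrightarrow> v t = 0)"
    using tail_eq AE_lborel_singleton[of "0::real"]
  proof eventually_elim
    fix t :: real assume "0 < t \<longrightarrow> tail t = - (pi / 4) * v t" "t \<noteq> 0"
    moreover from this have "v t = - (4 / pi) * tail t" if "0 < t"
      using that by (simp add: field_simps)
    ultimately show "(0 < t \<longrightarrow> (v t)\<^sup>2 = (4 / pi)\<^sup>2 * (tail t)\<^sup>2) \<and> (t \<le> 0 \<longrightarrow> v t = 0)"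
      by (auto simp: v_def power_mult_distrib power_divide)
  qed
  have factor: "(4 / pi)\<^sup>2 * (e * (pi / 4 / r)) = 4 / pi * (e / r)" for e r :: real
    by (simp add: power2_eq_square)
  have D_int: "integrable lborel ?D"
    using energy_sum_integrable v_square by (intro Bochner_Integration.integrable_diff integrable_mult_right)
  have D_nonneg: "AE t in lborel. 0 \<le> ?D t"
    using v_tail
  proof eventually_elim
    fix t assume *: "(0 < t \<longrightarrow> (v t)\<^sup>2 = (4 / pi)\<^sup>2 * (tail t)\<^sup>2) \<and> (t \<le> 0 \<longrightarrow> v t = 0)"
    show "0 \<le> ?D t"
    proof (cases "0 < t")
      case True
      then have "(v t)\<^sup>2 \<le> (4 / pi)\<^sup>2 * (energy t * (pi / 4 / sqrt t))"
        using * tail_square_le[OF True] by (simp only:) (intro mult_left_mono; simp)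
      then show ?thesis using True unfolding factor by simp
    qed (use * in simp)
  qed
  have "(LINT t|lborel. ?D t) = 4 / pi * (LINT t|lborel. ?F t) - (LINT t|lborel. (v t)\<^sup>2)"
    using energy_sum_integrable v_square
    by (subst Bochner_Integration.integral_diff) (simp_all only: integral_mult_right_zero integrable_mult_right)
  also have "4 / pi * (LINT t|lborel. ?F t) \<le> 4 / pi * (2 * (pi / 8 * (LINT s|lborel. (v s)\<^sup>2)))"
    using energy_sum_le le by (intro mult_left_mono) auto
  also have "\<dots> = (LINT t|lborel. (v t)\<^sup>2)" by simp
  finally have "(LINT t|lborel. ?D t) \<le> 0" by simp
  then have "(LINT t|lborel. ?D t) = 0"
    using integral_nonneg_AE[OF D_nonneg] by linarith
  then have D0: "AE t in lborel. ?D t = 0"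
    using integral_nonneg_eq_0_iff_AE[OF D_int D_nonneg] by simp
  have "AE t in lborel. (v t)\<^sup>2 = 0"
    using v_tail D0
  proof eventually_elim
    fix t assume *: "(0 < t \<longrightarrow> (v t)\<^sup>2 = (4 / pi)\<^sup>2 * (tail t)\<^sup>2) \<and> (t \<le> 0 \<longrightarrow> v t = 0)"
      and D: "?D t = 0"
    show "(v t)\<^sup>2 = 0"
    proof (cases "0 < t")
      case True
      then have "(4 / pi)\<^sup>2 * (tail t)\<^sup>2 = (4 / pi)\<^sup>2 * (energy t * (pi / 4 / sqrt t))"
        using * D unfolding factor by simp
      then have "(4 / pi)\<^sup>2 = 0 \<or> (tail t)\<^sup>2 = energy t * (pi / 4 / sqrt t)"
        unfolding mult_cancel_left .
      then have "(tail t)\<^sup>2 = energy t * (pi / 4 / sqrt t)" by simp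
      then have "tail t = 0" by (rule tail_eq_0[OF True])
      then show ?thesis using * True by simp
    qed (use * in simp)
  qed
  then have "(LINT s|lborel. (v s)\<^sup>2) = 0"
    by (rule integral_eq_zero_AE)
  with pos show False by simp
qed

end

section \<open>The operators on spherical states\<close>

lemma
  assumes "test_function \<phi>"
  shows test_function_continuous: "continuous_on UNIV \<phi>"
    and test_function_DERIV_snd: "((\<lambda>t. \<phi> (x, t)) has_real_derivative deriv_snd \<phi> (x, y)) (at y)"
    and test_function_continuous_deriv_fst: "continuous_on UNIV (deriv_fst \<phi>)"
    and test_function_continuous_deriv_snd: "continuous_on UNIV (deriv_snd \<phi>)"
proof -
  obtain D where D: "D 0 0 = \<phi>" "\<And>m n. continuous_on UNIV (D m n)"
    "\<And>m n x y. ((\<lambda>s. D m n (s, y)) has_real_derivative D (Suc m) n (x, y)) (at x)"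
    "\<And>m n x y. ((\<lambda>t. D m n (x, t)) has_real_derivative D m (Suc n) (x, y)) (at y)"
    using assms unfolding test_function_def smooth_plane_def by metis
  have fst: "deriv_fst \<phi> = D 1 0"
    using D(3)[of 0 0] by (auto simp: fun_eq_iff deriv_fst_def D(1) intro!: DERIV_imp_deriv)
  have snd: "deriv_snd \<phi> = D 0 1"
    using D(4)[of 0 0] by (auto simp: fun_eq_iff deriv_snd_def D(1) intro!: DERIV_imp_deriv)
  show "continuous_on UNIV \<phi>" "continuous_on UNIV (deriv_fst \<phi>)" "continuous_on UNIV (deriv_snd \<phi>)"
    using D(2)[of 0 0] D(2) by (simp_all add: fst snd D(1))
  show "((\<lambda>t. \<phi> (x, t)) has_real_derivative deriv_snd \<phi> (x, y)) (at y)"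
    using D(4)[of 0 0] by (simp add: snd D(1))
qed

lemma test_function_support:
  assumes "test_function \<phi>"
  obtains R where "\<And>z. R < norm z \<Longrightarrow> \<phi> z = 0" "\<And>z. R < norm z \<Longrightarrow> deriv_snd \<phi> z = 0"
proof -
  have "bounded {z. \<phi> z \<noteq> 0}"
    using assms by (auto simp: test_function_def compact_closure)
  then obtain R where R: "\<And>z. \<phi> z \<noteq> 0 \<Longrightarrow> norm z \<le> R"
    by (auto simp: bounded_iff)
  have zero: "\<phi> z = 0" if "R < norm z" for z
    using R that by (meson linorder_not_le)
  moreover have "deriv_snd \<phi> z = 0" if "R < norm z" for z
  proof -
    obtain x y where z: "z = (x, y)" by (cases z)
    have o: "open {t. R < norm (x, t)}"
      by (intro open_Collect_less continuous_intros)
    have d: "((\<lambda>_. 0) has_real_derivative 0) (at y)" by simp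
    have "((\<lambda>t. \<phi> (x, t)) has_real_derivative 0) (at y)"
      by (rule has_field_derivative_transform_within_open[OF d o]) (use that z zero in auto)
    then show ?thesis
      unfolding deriv_snd_def z by (simp add: DERIV_imp_deriv)
  qed
  ultimately show ?thesis using that by blast
qed

lemma integrable_compact_support:
  fixes f :: "'a::euclidean_space \<Rightarrow> real"
  assumes "continuous_on UNIV f" "\<And>z. R < norm z \<Longrightarrow> f z = 0"
  shows "integrable lborel f"
proof -
  have "integrable lborel (\<lambda>z. indicator (cball 0 R) z *\<^sub>R f z)"
    by (intro borel_integrable_compact compact_cball continuous_on_subset[OF assms(1)]) auto
  also have "(\<lambda>z. indicator (cball 0 R) z *\<^sub>R f z) = f"
    using assms(2) by (auto simp: fun_eq_iff not_le split: split_indicator)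
  finally show ?thesis .
qed

lemma test_function_measurable: "test_function \<phi> \<Longrightarrow> \<phi> \<in> borel_measurable borel"
  by (intro borel_measurable_continuous_onI test_function_continuous)

lemma test_function_mult_integrable:
  fixes f :: "real \<times> real \<Rightarrow> real"
  assumes "test_function \<phi>" "f \<in> borel_measurable borel" "integrable lborel (\<lambda>z. (f z)\<^sup>2)"
  shows "integrable lborel (\<lambda>z. \<phi> z * f z)"
proof (rule integrable_mult_square)
  obtain R where R: "\<And>z. R < norm z \<Longrightarrow> \<phi> z = 0"
    using test_function_support[OF assms(1)] by metis
  show "integrable lborel (\<lambda>z. (\<phi> z)\<^sup>2)"
    using R by (intro integrable_compact_support[of _ R] continuous_intros test_function_continuous assms) auto
qed (use assms test_function_measurable in auto)

section \<open>Uniqueness of the images under the operators\<close>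

lemma cnj_measurable [measurable]: "cnj \<in> borel_measurable borel"
  by (intro borel_measurable_continuous_onI continuous_intros)

lemma square_integrable_measurable:
  "square_integrable f \<Longrightarrow> f \<in> borel_measurable borel"
  by (simp add: square_integrable_def)

lemma square_integrable_Re_Im:
  assumes "square_integrable f"
  shows "integrable lborel (\<lambda>z. (Re (f z))\<^sup>2)" "integrable lborel (\<lambda>z. (Im (f z))\<^sup>2)"
proof -
  have [measurable]: "f \<in> borel_measurable borel" and i: "integrable lborel (\<lambda>z. (cmod (f z))\<^sup>2)"
    using assms by (auto simp: square_integrable_def)
  show "integrable lborel (\<lambda>z. (Re (f z))\<^sup>2)" "integrable lborel (\<lambda>z. (Im (f z))\<^sup>2)"
    by (rule Bochner_Integration.integrable_bound[OF i]; simp add: cmod_power2)+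
qed

lemma
  assumes \<phi>: "test_function \<phi>" and \<eta>: "square_integrable \<eta>"
  shows Re_test_integral: "Re (LINT z|lborel. complex_of_real (\<phi> z) * \<eta> z) = (LINT z|lborel. \<phi> z * Re (\<eta> z))"
    and Im_test_integral: "Im (LINT z|lborel. complex_of_real (\<phi> z) * \<eta> z) = (LINT z|lborel. \<phi> z * Im (\<eta> z))"
proof -
  have [measurable]: "\<eta> \<in> borel_measurable borel" "\<phi> \<in> borel_measurable borel"
    using square_integrable_measurable[OF \<eta>] test_function_measurable[OF \<phi>] by auto
  have "integrable lborel (\<lambda>z. complex_of_real (\<phi> z * Re (\<eta> z)) + \<i> * complex_of_real (\<phi> z * Im (\<eta> z)))"
    using test_function_mult_integrable[OF \<phi>, of "\<lambda>z. Re (\<eta> z)"]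
      test_function_mult_integrable[OF \<phi>, of "\<lambda>z. Im (\<eta> z)"] square_integrable_Re_Im[OF \<eta>]
    by (intro Bochner_Integration.integrable_add integrable_mult_right integrable_of_real) auto
  also have "(\<lambda>z. complex_of_real (\<phi> z * Re (\<eta> z)) + \<i> * complex_of_real (\<phi> z * Im (\<eta> z)))
      = (\<lambda>z. complex_of_real (\<phi> z) * \<eta> z)"
    by (auto simp: fun_eq_iff complex_eq_iff)
  finally have int: "integrable lborel (\<lambda>z. complex_of_real (\<phi> z) * \<eta> z)" .
  show "Re (LINT z|lborel. complex_of_real (\<phi> z) * \<eta> z) = (LINT z|lborel. \<phi> z * Re (\<eta> z))"
    using integral_bounded_linear[OF bounded_linear_Re int] by simp
  show "Im (LINT z|lborel. complex_of_real (\<phi> z) * \<eta> z) = (LINT z|lborel. \<phi> z * Im (\<eta> z))"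
    using integral_bounded_linear[OF bounded_linear_Im int] by simp
qed

text \<open>Since \<open>op_xp\<close> is an arbitrary choice, this is what makes norms independent
  of it. The fundamental lemma concerns real functions and is therefore applied to the real and the
  imaginary part of the difference.\<close>

lemma is_xp_unique:
  assumes "is_xp \<psi> \<eta>\<^sub>1" "is_xp \<psi> \<eta>\<^sub>2"
  shows "AE z in lborel. \<eta>\<^sub>1 z = \<eta>\<^sub>2 z"
proof -
  have sq: "square_integrable \<eta>\<^sub>1" "square_integrable \<eta>\<^sub>2"
    using assms by (auto simp: is_xp_def)
  have [measurable]: "\<eta>\<^sub>1 \<in> borel_measurable borel" "\<eta>\<^sub>2 \<in> borel_measurable borel"
    using sq[THEN square_integrable_measurable] .
  have eq: "(LINT z|lborel. complex_of_real (\<phi> z) * \<eta>\<^sub>1 z) = (LINT z|lborel. complex_of_real (\<phi> z) * \<eta>\<^sub>2 z)"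
    if "test_function \<phi>" for \<phi>
    using assms that by (simp add: is_xp_def)
  have diff: "AE z in lborel. f (\<eta>\<^sub>1 z) - f (\<eta>\<^sub>2 z) = 0"
    if [measurable]: "f \<in> borel_measurable borel"
      and f: "\<And>\<eta>. square_integrable \<eta> \<Longrightarrow> integrable lborel (\<lambda>z. (f (\<eta> z))\<^sup>2)"
      and test: "\<And>\<phi>. test_function \<phi> \<Longrightarrow> (LINT z|lborel. \<phi> z * f (\<eta>\<^sub>1 z)) = (LINT z|lborel. \<phi> z * f (\<eta>\<^sub>2 z))"
    for f :: "complex \<Rightarrow> real"
  proof (rule AE_eq_0_if_test_integrals_eq_0)
    show "integrable lborel (\<lambda>z. (f (\<eta>\<^sub>1 z) - f (\<eta>\<^sub>2 z))\<^sup>2)"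
      unfolding power2_diff
      using f[OF sq(1)] f[OF sq(2)] integrable_mult_square[of "\<lambda>z. f (\<eta>\<^sub>1 z)" lborel "\<lambda>z. f (\<eta>\<^sub>2 z)"]
      by (simp add: mult.assoc)
    show "(LINT z|lborel. \<phi> z * (f (\<eta>\<^sub>1 z) - f (\<eta>\<^sub>2 z))) = 0" if "test_function \<phi>" for \<phi>
      using test[OF that] test_function_mult_integrable[OF that _ f[OF sq(1)]]
        test_function_mult_integrable[OF that _ f[OF sq(2)]]
      by (simp add: right_diff_distrib)
  qed measurable
  have "AE z in lborel. Re (\<eta>\<^sub>1 z) - Re (\<eta>\<^sub>2 z) = 0"
    using eq sq by (intro diff) (auto simp: square_integrable_Re_Im Re_test_integral[symmetric])
  moreover have "AE z in lborel. Im (\<eta>\<^sub>1 z) - Im (\<eta>\<^sub>2 z) = 0"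
    using eq sq by (intro diff) (auto simp: square_integrable_Re_Im Im_test_integral[symmetric])
  ultimately show ?thesis
    by eventually_elim (simp add: complex_eq_iff)
qed

lemma norm2_sq_cong_AE:
  assumes "AE z in lborel. f z = g z" "f \<in> borel_measurable borel" "g \<in> borel_measurable borel"
  shows "norm2_sq f = norm2_sq g"
  unfolding norm2_sq_def using assms by (intro integral_cong_AE) auto

text \<open>For real \<psi> the weak equation has a purely imaginary right side, so the real part of
  \<eta> is orthogonal to all test functions and vanishes almost everywhere. The inner product with
  \<psi> is then imaginary, so the mean contributes nothing to the variance.\<close>

lemma
  assumes \<psi>: "\<And>z. Im (\<psi> z) = 0" "\<psi> \<in> borel_measurable borel" and \<eta>: "is_xp \<psi> \<eta>"
  shows is_xp_Im: "test_function \<phi> \<Longrightarrow>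
      (LINT z|lborel. \<phi> z * Im (\<eta> z)) = (LINT z|lborel. fst z * deriv_snd \<phi> z * Re (\<psi> z))"
    and is_xp_inner: "Re (inner2 \<psi> \<eta>) = 0"
    and is_xp_norm2_sq: "norm2_sq \<eta> = (LINT z|lborel. (Im (\<eta> z))\<^sup>2)"
proof -
  have sq: "square_integrable \<eta>" using \<eta> by (simp add: is_xp_def)
  note [measurable] = square_integrable_measurable[OF sq] \<psi>(2)
  have real: "\<psi> z = complex_of_real (Re (\<psi> z))" for z
    using \<psi>(1)[of z] by (simp add: complex_eq_iff)
  have rhs: "\<i> * (LINT z|lborel. complex_of_real (fst z * deriv_snd \<phi> z) * \<psi> z)
      = \<i> * complex_of_real (LINT z|lborel. fst z * deriv_snd \<phi> z * Re (\<psi> z))" for \<phi>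
    by (subst real) (simp add: of_real_mult[symmetric] del: of_real_mult)
  have eq: "(LINT z|lborel. complex_of_real (\<phi> z) * \<eta> z)
      = \<i> * complex_of_real (LINT z|lborel. fst z * deriv_snd \<phi> z * Re (\<psi> z))" if "test_function \<phi>" for \<phi>
    using \<eta> that rhs by (simp add: is_xp_def)
  have Re0: "AE z in lborel. Re (\<eta> z) = 0"
    using sq eq
    by (intro AE_eq_0_if_test_integrals_eq_0) (auto simp: square_integrable_Re_Im Re_test_integral[symmetric])
  show "test_function \<phi> \<Longrightarrow>
      (LINT z|lborel. \<phi> z * Im (\<eta> z)) = (LINT z|lborel. fst z * deriv_snd \<phi> z * Re (\<psi> z))"
    using sq eq by (simp add: Im_test_integral[symmetric])
  have "inner2 \<psi> \<eta> = (LINT z|lborel. \<i> * complex_of_real (Re (\<psi> z) * Im (\<eta> z)))"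
    unfolding inner2_def
  proof (rule integral_cong_AE)
    show "AE z in lborel. cnj (\<psi> z) * \<eta> z = \<i> * complex_of_real (Re (\<psi> z) * Im (\<eta> z))"
      using Re0 by eventually_elim (auto simp: complex_eq_iff \<psi>(1))
  qed measurable
  also have "\<dots> = \<i> * complex_of_real (LINT z|lborel. Re (\<psi> z) * Im (\<eta> z))"
    by (simp del: of_real_mult)
  finally show "Re (inner2 \<psi> \<eta>) = 0" by simp
  show "norm2_sq \<eta> = (LINT z|lborel. (Im (\<eta> z))\<^sup>2)"
    unfolding norm2_sq_def
    by (rule integral_cong_AE) (use Re0 in \<open>auto simp: cmod_power2\<close>)
qed

section \<open>Exchange of the two variables\<close>

lemma distr_lborel_swap: "distr lborel borel prod.swap = (lborel :: (real \<times> real) measure)"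
proof (rule measure_eqI)
  fix A assume "A \<in> sets (distr lborel borel (prod.swap :: real \<times> real \<Rightarrow> _))"
  then have [measurable]: "A \<in> sets borel" by simp
  have [measurable]: "(prod.swap :: real \<times> real \<Rightarrow> _) \<in> borel_measurable borel"
    by (intro borel_measurable_continuous_onI continuous_on_swap)
  have "emeasure (distr lborel borel prod.swap) A = (\<integral>\<^sup>+z. indicator A (snd z, fst z) \<partial>lborel)"
    by (subst nn_integral_indicator[symmetric], simp)
      (simp add: nn_integral_distr del: nn_integral_indicator, simp add: prod.swap_def)
  then show "emeasure (distr lborel borel prod.swap) A = emeasure lborel A"
    using nn_integral_lborel_swap[of "indicator A"] by simp
qed simp

lemma prod_swap_measurable [measurable]:
  "(prod.swap :: real \<times> real \<Rightarrow> _) \<in> borel_measurable borel"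
  by (intro borel_measurable_continuous_onI continuous_on_swap)

lemma integral_lborel_swap:
  fixes f :: "real \<times> real \<Rightarrow> 'b::{banach, second_countable_topology}"
  assumes [measurable]: "f \<in> borel_measurable borel"
  shows "(LINT z|lborel. f (prod.swap z)) = (LINT z|lborel. f z)"
  by (subst (2) distr_lborel_swap[symmetric], subst integral_distr) auto

lemma integrable_lborel_swap:
  fixes f :: "real \<times> real \<Rightarrow> 'b::{banach, second_countable_topology}"
  assumes "integrable lborel f"
  shows "integrable lborel (\<lambda>z. f (prod.swap z))"
  using assms by (subst integrable_distr_eq[of prod.swap lborel borel f, symmetric]) (auto simp: distr_lborel_swap)

lemma test_function_swap:
  assumes "test_function \<phi>"
  shows "test_function (\<lambda>z. \<phi> (prod.swap z))"
proof -
  obtain D where D: "D 0 0 = \<phi>" "\<And>m n. continuous_on UNIV (D m n)"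
    "\<And>m n x y. ((\<lambda>s. D m n (s, y)) has_real_derivative D (Suc m) n (x, y)) (at x)"
    "\<And>m n x y. ((\<lambda>t. D m n (x, t)) has_real_derivative D m (Suc n) (x, y)) (at y)"
    using assms unfolding test_function_def smooth_plane_def by metis
  have "smooth_plane (\<lambda>z. \<phi> (prod.swap z))"
    unfolding smooth_plane_def
    using D by (intro exI[of _ "\<lambda>m n z. D n m (prod.swap z)"])
      (auto intro!: continuous_on_compose2[OF D(2)] continuous_on_swap)
  moreover have "bounded {z. \<phi> (prod.swap z) \<noteq> 0}"
  proof -
    have "bounded {z. \<phi> z \<noteq> 0}"
      using assms by (auto simp: test_function_def compact_closure)
    then obtain R where "\<And>x y. \<phi> (x, y) \<noteq> 0 \<Longrightarrow> norm (x, y) \<le> R"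
      by (auto simp: bounded_iff)
    then have "norm z \<le> R" if "\<phi> (prod.swap z) \<noteq> 0" for z
      using that by (cases z) (force simp: norm_prod_def add.commute)
    then show ?thesis by (auto simp: bounded_iff intro!: exI[of _ R])
  qed
  ultimately show ?thesis
    by (simp add: test_function_def compact_closure)
qed

text \<open>The exchange of variables preserves Lebesgue measure and the class of test functions and
  interchanges the two partial derivatives. It reduces all statements about \<open>is_px\<close> to
  \<open>is_xp\<close>.\<close>

lemma is_px_iff_is_xp_swap:
  assumes [measurable]: "\<psi> \<in> borel_measurable borel"
  shows "is_px \<psi> \<eta> \<longleftrightarrow> is_xp (\<lambda>z. \<psi> (prod.swap z)) (\<lambda>z. \<eta> (prod.swap z))"
proof -
  have sq_imp: "square_integrable (\<lambda>z. \<eta> (prod.swap z))" if "square_integrable \<eta>" for \<eta>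
    using that by (auto simp: square_integrable_def intro!: integrable_lborel_swap measurable_compose[OF prod_swap_measurable])
  have sq: "square_integrable (\<lambda>z. \<eta> (prod.swap z)) \<longleftrightarrow> square_integrable \<eta>"
    using sq_imp[of \<eta>] sq_imp[of "\<lambda>z. \<eta> (prod.swap z)"] by auto
  have lhs: "(LINT z|lborel. complex_of_real (\<phi> (prod.swap z)) * \<eta> (prod.swap z)) = (LINT z|lborel. complex_of_real (\<phi> z) * \<eta> z)"
    if "test_function \<phi>" "square_integrable \<eta>" for \<phi>
    using test_function_measurable[OF that(1)] square_integrable_measurable[OF that(2)]
    by (subst integral_lborel_swap[symmetric]) auto
  have rhs: "(LINT z|lborel. complex_of_real (fst z * deriv_snd (\<lambda>z. \<phi> (prod.swap z)) z) * \<psi> (prod.swap z))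
      = (LINT z|lborel. complex_of_real (snd z * deriv_fst \<phi> z) * \<psi> z)"
    if "test_function \<phi>" for \<phi>
  proof -
    have [measurable]: "deriv_fst \<phi> \<in> borel_measurable borel"
      using that by (intro borel_measurable_continuous_onI test_function_continuous_deriv_fst)
    have d: "deriv_snd (\<lambda>z. \<phi> (prod.swap z)) z = deriv_fst \<phi> (prod.swap z)" for z
      by (simp add: deriv_snd_def deriv_fst_def)
    show ?thesis
      unfolding d by (subst (2) integral_lborel_swap[symmetric]) auto
  qed
  show ?thesis
  proof
    assume px: "is_px \<psi> \<eta>"
    then have s: "square_integrable \<eta>" by (simp add: is_px_def)
    show "is_xp (\<lambda>z. \<psi> (prod.swap z)) (\<lambda>z. \<eta> (prod.swap z))"
      unfolding is_xp_def sq
    proof (intro conjI allI impI s)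
      fix \<phi> assume t: "test_function \<phi>"
      note t' = test_function_swap[OF t]
      show "(LINT z|lborel. complex_of_real (\<phi> z) * \<eta> (prod.swap z))
        = \<i> * (LINT z|lborel. complex_of_real (fst z * deriv_snd \<phi> z) * \<psi> (prod.swap z))"
        using px t' lhs[OF t' s] rhs[OF t'] by (simp add: is_px_def)
    qed
  next
    assume xp: "is_xp (\<lambda>z. \<psi> (prod.swap z)) (\<lambda>z. \<eta> (prod.swap z))"
    then have s: "square_integrable \<eta>" using sq by (simp add: is_xp_def)
    show "is_px \<psi> \<eta>"
      unfolding is_px_def
    proof (intro conjI allI impI s)
      fix \<phi> assume t: "test_function \<phi>"
      show "(LINT z|lborel. complex_of_real (\<phi> z) * \<eta> z)
        = \<i> * (LINT z|lborel. complex_of_real (snd z * deriv_fst \<phi> z) * \<psi> z)"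
        using xp test_function_swap[OF t] lhs[OF t s] rhs[OF t] by (simp add: is_xp_def)
    qed
  qed
qed

text \<open>The function \<open>\<Psi>\<close> of the definition is unconstrained at negative
  arguments and need not be measurable. The restriction of \<psi> to the half-axis y = 0, x = sqrt s
  is a Borel function with the same values, already in the variable r^2.\<close>

lemma spherical_profile:
  assumes "\<psi> \<in> spherical_states"
  obtains u where "u \<in> borel_measurable borel" "\<And>z. \<psi> z = complex_of_real (u (rsq z))"
proof -
  obtain \<Psi> where \<Psi>: "\<And>x y. \<psi> (x, y) = complex_of_real (\<Psi> (sqrt (x\<^sup>2 + y\<^sup>2)))"
    and [measurable]: "\<psi> \<in> borel_measurable borel"
    using assms by (auto simp: spherical_states_def wave_function_def square_integrable_def)
  have [measurable]: "(\<lambda>s::real. (sqrt s, 0::real)) \<in> borel_measurable borel"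
    by (intro borel_measurable_continuous_onI continuous_intros)
  have "(\<lambda>s. Re (\<psi> (sqrt s, 0))) \<in> borel_measurable borel"
    by measurable
  moreover have "\<psi> z = complex_of_real (Re (\<psi> (sqrt (rsq z), 0)))" for z
    by (cases z) (simp add: \<Psi> rsq_def)
  ultimately show ?thesis using that by blast
qed

lemma
  assumes [measurable]: "u \<in> borel_measurable borel" and \<psi>: "\<And>z. \<psi> z = complex_of_real (u (rsq z))"
  shows radial_square_integrable_iff:
      "square_integrable \<psi> \<longleftrightarrow> integrable lborel (\<lambda>s. indicator {0..} s * (u s)\<^sup>2)"
    and radial_norm2_sq: "norm2_sq \<psi> = pi * (LINT s|lborel. indicator {0..} s * (u s)\<^sup>2)"
proof -
  have m: "\<psi> \<in> borel_measurable borel"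
    unfolding \<psi>[abs_def] by measurable
  have eq: "(\<lambda>s. pi * indicator {0..} s * (u s)\<^sup>2) = (\<lambda>s. pi * (indicator {0..} s * (u s)\<^sup>2))"
    by (simp add: mult.assoc)
  show "square_integrable \<psi> \<longleftrightarrow> integrable lborel (\<lambda>s. indicator {0..} s * (u s)\<^sup>2)"
    using radial_integrable[of "\<lambda>s. (u s)\<^sup>2"] m unfolding eq
    by (simp add: square_integrable_def \<psi> cmod_power2)
  show "norm2_sq \<psi> = pi * (LINT s|lborel. indicator {0..} s * (u s)\<^sup>2)"
    using radial_integral[of "\<lambda>s. (u s)\<^sup>2"] unfolding eq
    by (simp add: norm2_sq_def \<psi> cmod_power2)
qed

lemma spherical_is_xp_norm:
  assumes "\<psi> \<in> spherical_states" "is_xp \<psi> \<eta>"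
  shows "1 / 8 < norm2_sq \<eta>" "Re (inner2 \<psi> \<eta>) = 0"
proof -
  obtain u where [measurable]: "u \<in> borel_measurable borel" and u: "\<And>z. \<psi> z = complex_of_real (u (rsq z))"
    using spherical_profile[OF assms(1)] by metis
  have \<psi>: "square_integrable \<psi>" "norm2_sq \<psi> = 1"
    using assms(1) by (auto simp: spherical_states_def wave_function_def)
  have im: "Im (\<psi> z) = 0" for z by (simp add: u)
  note m\<psi> = square_integrable_measurable[OF \<psi>(1)]
  have sq: "square_integrable \<eta>" using assms by (simp add: is_xp_def)
  note [measurable] = square_integrable_measurable[OF sq]
  \<comment> \<open>Since \<eta> = - i x d\<psi>/dy is purely imaginary almost everywhere, the real
    weak derivative x d\<psi>/dy = i \<eta> is minus the imaginary part of \<eta>.\<close>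
  interpret radial_weak_derivative u "\<lambda>z. - Im (\<eta> z)"
  proof
    show "integrable lborel (\<lambda>s. indicator {0..} s * (u s)\<^sup>2)"
      using radial_square_integrable_iff[of u \<psi>, OF _ u] \<psi> by simp
    show "integrable lborel (\<lambda>z. (- Im (\<eta> z))\<^sup>2)"
      using square_integrable_Re_Im[OF sq] by simp
    show "(LINT z|lborel. \<phi> z * - Im (\<eta> z)) = - (LINT z|lborel. fst z * deriv_snd \<phi> z * u (rsq z))"
      if "test_function \<phi>" for \<phi>
      using is_xp_Im[OF im m\<psi> assms(2) that] by (simp add: u)
  qed measurable
  have vv: "(\<lambda>s. (v s)\<^sup>2) = (\<lambda>s. indicator {0..} s * (u s)\<^sup>2)"
    by (auto simp: v_def fun_eq_iff split: split_indicator)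
  have one: "pi * (LINT s|lborel. (v s)\<^sup>2) = 1"
    using radial_norm2_sq[of u \<psi>, OF _ u] \<psi>(2) by (simp add: vv)
  then have "0 < (LINT s|lborel. (v s)\<^sup>2)"
    by (metis pi_gt_zero zero_less_mult_pos zero_less_one)
  from hardy_strict[OF this] one show "1 / 8 < norm2_sq \<eta>"
    using is_xp_norm2_sq[OF im m\<psi> assms(2)] by simp
  show "Re (inner2 \<psi> \<eta>) = 0"
    by (rule is_xp_inner[OF im m\<psi> assms(2)])
qed

lemma spherical_swap:
  assumes "\<psi> \<in> spherical_states"
  shows "(\<lambda>z. \<psi> (prod.swap z)) = \<psi>"
proof -
  obtain u where "\<And>z. \<psi> z = complex_of_real (u (rsq z))"
    using spherical_profile[OF assms] by metis
  then show ?thesis by (auto simp: fun_eq_iff rsq_def add.commute)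
qed

lemma spherical_is_px_swap:
  assumes "\<psi> \<in> spherical_states" "is_px \<psi> \<eta>"
  shows "is_xp \<psi> (\<lambda>z. \<eta> (prod.swap z))" "norm2_sq (\<lambda>z. \<eta> (prod.swap z)) = norm2_sq \<eta>"
    "inner2 \<psi> (\<lambda>z. \<eta> (prod.swap z)) = inner2 \<psi> \<eta>"
proof -
  have [measurable]: "\<psi> \<in> borel_measurable borel" "\<eta> \<in> borel_measurable borel"
    using assms by (auto simp: spherical_states_def wave_function_def is_px_def square_integrable_measurable)
  show "is_xp \<psi> (\<lambda>z. \<eta> (prod.swap z))"
    using assms is_px_iff_is_xp_swap[of \<psi> \<eta>] by (simp add: spherical_swap)
  show "norm2_sq (\<lambda>z. \<eta> (prod.swap z)) = norm2_sq \<eta>"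
    unfolding norm2_sq_def by (rule integral_lborel_swap) measurable
  have "inner2 \<psi> (\<lambda>z. \<eta> (prod.swap z)) = (LINT z|lborel. cnj (\<psi> (prod.swap z)) * \<eta> (prod.swap z))"
    unfolding inner2_def using spherical_swap[OF assms(1)] by (metis (no_types))
  also have "\<dots> = inner2 \<psi> \<eta>"
    unfolding inner2_def by (rule integral_lborel_swap) measurable
  finally show "inner2 \<psi> (\<lambda>z. \<eta> (prod.swap z)) = inner2 \<psi> \<eta>" .
qed

text \<open>A spherical state is invariant under the exchange of variables, so the swapped
  \<open>op_px \<psi>\<close> is another version of \<open>op_xp \<psi>\<close>. Both means vanish,
  and by uniqueness both variances are the norm of any version.\<close>

lemma spherical_sigma:
  assumes "\<psi> \<in> spherical_states" "is_xp \<psi> \<eta>"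
  shows "sigma_xp \<psi> = sqrt (norm2_sq \<eta>)" "sigma_px \<psi> = sqrt (norm2_sq \<eta>)"
proof -
  have "\<exists>\<eta>. is_xp \<psi> \<eta>" "\<exists>\<eta>. is_px \<psi> \<eta>"
    using assms by (auto simp: spherical_states_def wave_function_def)
  then have xp: "is_xp \<psi> (op_xp \<psi>)" and px: "is_px \<psi> (op_px \<psi>)"
    unfolding op_xp_def op_px_def by (metis someI_ex)+
  note px' = spherical_is_px_swap[OF assms(1) px]
  have unique: "norm2_sq \<eta>' = norm2_sq \<eta>" if "is_xp \<psi> \<eta>'" for \<eta>'
    using is_xp_unique[OF that assms(2)] that assms(2)
    by (intro norm2_sq_cong_AE) (auto simp: is_xp_def square_integrable_measurable)
  show "sigma_xp \<psi> = sqrt (norm2_sq \<eta>)"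
    using unique[OF xp] spherical_is_xp_norm(2)[OF assms(1) xp] by (simp add: sigma_xp_def std_dev_def)
  show "sigma_px \<psi> = sqrt (norm2_sq \<eta>)"
    using unique[OF px'(1)] spherical_is_xp_norm(2)[OF assms(1) px'(1)] px'(2,3)
    by (simp add: sigma_px_def std_dev_def)
qed

corollary spherical_product:
  assumes "\<psi> \<in> spherical_states" "is_xp \<psi> \<eta>"
  shows "sigma_xp \<psi> * sigma_px \<psi> = norm2_sq \<eta>"
  using spherical_sigma[OF assms] spherical_is_xp_norm(1)[OF assms] by simp

corollary spherical_product_gt:
  assumes "\<psi> \<in> spherical_states"
  shows "1 / 8 < sigma_xp \<psi> * sigma_px \<psi>"
proof -
  obtain \<eta> where "is_xp \<psi> \<eta>"
    using assms by (auto simp: spherical_states_def wave_function_def)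
  then show ?thesis
    using spherical_product[OF assms] spherical_is_xp_norm(1)[OF assms] by simp
qed

text \<open>Integration by parts on each line of constant x: the sum of both integrands is the
  y-derivative of x \<phi>(x, y) u(x^2 + y^2), which has compact support.\<close>

lemma weak_derivative_radial:
  assumes u: "\<And>s. (u has_real_derivative u' s) (at s)" "continuous_on UNIV u'" and \<phi>: "test_function \<phi>"
  shows "(LINT z|lborel. \<phi> z * (2 * fst z * snd z * u' (rsq z))) = - (LINT z|lborel. fst z * deriv_snd \<phi> z * u (rsq z))"
proof -
  obtain R where R: "\<And>z. R < norm z \<Longrightarrow> \<phi> z = 0" "\<And>z. R < norm z \<Longrightarrow> deriv_snd \<phi> z = 0"
    using test_function_support[OF \<phi>] by metis
  have cu: "continuous_on UNIV u"
    using u(1) by (meson DERIV_isCont continuous_at_imp_continuous_on)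
  have cq: "continuous_on UNIV rsq"
    unfolding rsq_def by (intro continuous_intros)
  have cuq: "continuous_on UNIV (\<lambda>z. u (rsq z))" "continuous_on UNIV (\<lambda>z. u' (rsq z))"
    by (rule continuous_on_compose2[OF cu cq] continuous_on_compose2[OF u(2) cq]; simp)+
  let ?f = "\<lambda>z. \<phi> z * (2 * fst z * snd z * u' (rsq z))"
  let ?g = "\<lambda>z. fst z * deriv_snd \<phi> z * u (rsq z)"
  have cf: "continuous_on UNIV ?f" and cg: "continuous_on UNIV ?g"
    by (intro continuous_intros cuq test_function_continuous[OF \<phi>] test_function_continuous_deriv_snd[OF \<phi>])+
  have int: "integrable lborel ?f" "integrable lborel ?g"
    using R by (auto intro!: integrable_compact_support[OF cf, of R] integrable_compact_support[OF cg, of R])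
  have inner: "(LINT y|lborel. ?f (x, y) + ?g (x, y)) = 0" for x
  proof -
    \<comment> \<open>The support radius R may be negative, so its absolute value is used; adding 1
      puts the end points strictly outside the support.\<close>
    define T where "T = \<bar>R\<bar> + 1"
    have T: "R < norm (x, y)" if "T \<le> \<bar>y\<bar>" for y
    proof -
      have "R < \<bar>y\<bar>" using that by (simp add: T_def)
      also have "\<bar>y\<bar> \<le> norm (x, y)" using norm_snd_le[of y x] by simp
      finally show ?thesis .
    qed
    have D: "((\<lambda>y. x * \<phi> (x, y) * u (x\<^sup>2 + y\<^sup>2)) has_real_derivative ?f (x, y) + ?g (x, y)) (at y)" for y
    proof -
      have q: "((\<lambda>y. x\<^sup>2 + y\<^sup>2) has_real_derivative 2 * y) (at y)"
        by (auto intro!: derivative_eq_intros)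
      have uq: "((\<lambda>y. u (x\<^sup>2 + y\<^sup>2)) has_real_derivative u' (x\<^sup>2 + y\<^sup>2) * (2 * y)) (at y)"
        by (rule DERIV_chain2[OF u(1) q])
      show ?thesis
        by (rule DERIV_cong[OF DERIV_mult[OF DERIV_cmult[OF test_function_DERIV_snd[OF \<phi>]] uq]])
          (simp add: rsq_def algebra_simps)
    qed
    have c: "continuous_on {-T..T} (\<lambda>y. ?f (x, y) + ?g (x, y))"
    proof -
      have "continuous_on UNIV (\<lambda>z. ?f z + ?g z)" by (intro continuous_on_add cf cg)
      moreover have "continuous_on {-T..T} (\<lambda>y. (x, y))" by (intro continuous_intros)
      ultimately show ?thesis by (rule continuous_on_compose2) simp
    qed
    have "(LINT y|lborel. ?f (x, y) + ?g (x, y)) = (LINT y|lborel. indicator {-T..T} y *\<^sub>R (?f (x, y) + ?g (x, y)))"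
    proof (intro Bochner_Integration.integral_cong refl)
      fix y show "?f (x, y) + ?g (x, y) = indicator {-T..T} y *\<^sub>R (?f (x, y) + ?g (x, y))"
        using R[OF T[of y]] by (cases "y \<in> {-T..T}") auto
    qed
    also have "\<dots> = x * \<phi> (x, T) * u (x\<^sup>2 + T\<^sup>2) - x * \<phi> (x, - T) * u (x\<^sup>2 + (- T)\<^sup>2)"
    proof (intro integral_FTC_atLeastAtMost c)
      show "- T \<le> T" by (simp add: T_def)
      show "((\<lambda>y. x * \<phi> (x, y) * u (x\<^sup>2 + y\<^sup>2)) has_vector_derivative ?f (x, y) + ?g (x, y)) (at y within {-T..T})" for y
        by (rule has_vector_derivative_at_within[OF D[of y, unfolded has_real_derivative_iff_has_vector_derivative]])
    qed
    also have "\<dots> = 0"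
      using R(1)[OF T[of T]] R(1)[OF T[of "-T"]] by (simp add: T_def)
    finally show ?thesis .
  qed
  have "integrable lborel (\<lambda>z. ?f z + ?g z)" using int by simp
  then have "(LINT z|lborel. ?f z + ?g z) = (LINT x|lborel. LINT y|lborel. ?f (x, y) + ?g (x, y))"
    using lborel_pair.integral_fst'[of "\<lambda>z. ?f z + ?g z"] by (simp only: lborel_prod)
  then have "(LINT z|lborel. ?f z + ?g z) = 0"
    by (simp only: inner Bochner_Integration.integral_zero)
  then show ?thesis
    using int by (simp add: Bochner_Integration.integral_add)
qed

text \<open>The candidate - 2 i x y u'(r^2) is symmetric in x and y, so a single computation of the
  weak derivative serves \<open>is_xp\<close> and \<open>is_px\<close>. The factor pi/2 is 4 times
  the weight pi/8 of x^2 y^2.\<close>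

lemma radial_spherical:
  fixes u u' :: "real \<Rightarrow> real"
  assumes u: "\<And>s. (u has_real_derivative u' s) (at s)" "continuous_on UNIV u'"
    and \<psi>: "\<And>z. \<psi> z = complex_of_real (u (rsq z))"
    and int: "integrable lborel (\<lambda>s. indicator {0..} s * (u s)\<^sup>2)"
    and one: "pi * (LINT s|lborel. indicator {0..} s * (u s)\<^sup>2) = 1"
    and int': "integrable lborel (\<lambda>s. indicator {0..} s * (s * u' s)\<^sup>2)"
  shows "\<psi> \<in> spherical_states"
    and "sigma_xp \<psi> * sigma_px \<psi> = pi / 2 * (LINT s|lborel. indicator {0..} s * (s * u' s)\<^sup>2)"
proof -
  have cu: "continuous_on UNIV u"
    using u(1) by (meson DERIV_isCont continuous_at_imp_continuous_on)
  have [measurable]: "u \<in> borel_measurable borel" "u' \<in> borel_measurable borel"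
    using cu u(2) by (auto intro: borel_measurable_continuous_onI)
  have m [measurable]: "\<psi> \<in> borel_measurable borel"
    unfolding \<psi>[abs_def] by measurable
  define \<eta> where "\<eta> = (\<lambda>z. - \<i> * complex_of_real (2 * fst z * snd z * u' (rsq z)))"
  have [measurable]: "\<eta> \<in> borel_measurable borel"
    unfolding \<eta>_def by measurable
  have \<eta>2: "(cmod (\<eta> z))\<^sup>2 = (fst z * snd z)\<^sup>2 * (4 * (u' (rsq z))\<^sup>2)" for z
    by (simp add: \<eta>_def norm_mult power_mult_distrib)
  have eq: "(\<lambda>s. pi / 8 * s\<^sup>2 * indicator {0..} s * (4 * (u' s)\<^sup>2))
      = (\<lambda>s. pi / 2 * (indicator {0..} s * (s * u' s)\<^sup>2))"
    by (auto simp: fun_eq_iff power_mult_distrib)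
  have sq: "square_integrable \<eta>"
    using radial_x2y2_integrable[of "\<lambda>s. 4 * (u' s)\<^sup>2"] int' unfolding eq
    by (simp add: square_integrable_def \<eta>2)
  have norm: "norm2_sq \<eta> = pi / 2 * (LINT s|lborel. indicator {0..} s * (s * u' s)\<^sup>2)"
    using radial_x2y2_integral[of "\<lambda>s. 4 * (u' s)\<^sup>2"] unfolding eq by (simp add: norm2_sq_def \<eta>2)
  have xp: "is_xp \<psi> \<eta>"
    unfolding is_xp_def
  proof (intro conjI allI impI sq)
    fix \<phi> assume \<phi>: "test_function \<phi>"
    have "(LINT z|lborel. complex_of_real (\<phi> z) * \<eta> z)
        = (LINT z|lborel. - \<i> * complex_of_real (\<phi> z * (2 * fst z * snd z * u' (rsq z))))"
      by (intro Bochner_Integration.integral_cong) (auto simp: \<eta>_def)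
    also have "\<dots> = - \<i> * complex_of_real (LINT z|lborel. \<phi> z * (2 * fst z * snd z * u' (rsq z)))"
      by (simp only: integral_mult_right_zero integral_complex_of_real)
    also have "\<dots> = \<i> * complex_of_real (LINT z|lborel. fst z * deriv_snd \<phi> z * u (rsq z))"
      unfolding weak_derivative_radial[OF u \<phi>] by simp
    also have "complex_of_real (LINT z|lborel. fst z * deriv_snd \<phi> z * u (rsq z))
        = (LINT z|lborel. complex_of_real (fst z * deriv_snd \<phi> z) * \<psi> z)"
      by (simp only: \<psi> of_real_mult[symmetric] integral_complex_of_real)
    finally show "(LINT z|lborel. complex_of_real (\<phi> z) * \<eta> z)
        = \<i> * (LINT z|lborel. complex_of_real (fst z * deriv_snd \<phi> z) * \<psi> z)" .
  qed
  have swap: "(\<lambda>z. \<psi> (prod.swap z)) = \<psi>" "(\<lambda>z. \<eta> (prod.swap z)) = \<eta>"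
    by (auto simp: fun_eq_iff \<psi> \<eta>_def rsq_def add.commute)
  have px: "is_px \<psi> \<eta>"
    unfolding is_px_iff_is_xp_swap[OF m] swap by (rule xp)
  have "square_integrable \<psi>" "norm2_sq \<psi> = 1"
    using radial_square_integrable_iff[of u \<psi>, OF _ \<psi>] radial_norm2_sq[of u \<psi>, OF _ \<psi>] int one by auto
  moreover have "\<exists>\<Psi> :: real \<Rightarrow> real. \<forall>x y. \<psi> (x, y) = complex_of_real (\<Psi> (sqrt (x\<^sup>2 + y\<^sup>2)))"
    by (intro exI[of _ "\<lambda>r. u (r\<^sup>2)"] allI) (simp add: \<psi> rsq_def)
  ultimately show sph: "\<psi> \<in> spherical_states"
    using xp px unfolding spherical_states_def wave_function_def by blast
  show "sigma_xp \<psi> * sigma_px \<psi> = pi / 2 * (LINT s|lborel. indicator {0..} s * (s * u' s)\<^sup>2)"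
    using spherical_product[OF sph xp] norm by simp
qed

section \<open>Power series of Bessel functions\<close>

text \<open>The antiderivative of s^m exp (- a s) that vanishes at infinity, for a > 0, by the
  recursion that integration by parts gives.\<close>

primrec power_exp_antideriv :: "real \<Rightarrow> nat \<Rightarrow> real \<Rightarrow> real" where
  "power_exp_antideriv a 0 s = - exp (- (a * s)) / a"
| "power_exp_antideriv a (Suc m) s =
    (- (s ^ Suc m * exp (- (a * s))) + real (Suc m) * power_exp_antideriv a m s) / a"

lemma power_exp_tendsto_0:
  fixes a :: real
  assumes "0 < a"
  shows "((\<lambda>s. s ^ m * exp (- (a * s))) \<longlongrightarrow> 0) at_top"
proof -
  have "filterlim (\<lambda>s. a * s) at_top at_top"
    by (rule filterlim_tendsto_pos_mult_at_top[OF tendsto_const assms filterlim_ident])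
  then have "((\<lambda>s. (a * s) ^ m / exp (a * s)) \<longlongrightarrow> 0) at_top"
    by (rule filterlim_compose[OF tendsto_power_div_exp_0])
  then have "((\<lambda>s. (1 / a ^ m) * ((a * s) ^ m / exp (a * s))) \<longlongrightarrow> (1 / a ^ m) * 0) at_top"
    by (intro tendsto_intros)
  also have "(\<lambda>s. (1 / a ^ m) * ((a * s) ^ m / exp (a * s))) = (\<lambda>s. s ^ m * exp (- (a * s)))"
    using assms by (auto simp: fun_eq_iff power_mult_distrib exp_minus divide_simps)
  finally show ?thesis by simp
qed

lemma
  fixes a :: real
  assumes "0 < a"
  shows power_exp_integrable: "integrable lborel (\<lambda>s. indicator {0..} s * (s ^ m * exp (- (a * s))))"
    and power_exp_integral: "(LINT s|lborel. indicator {0..} s * (s ^ m * exp (- (a * s)))) = fact m / a ^ Suc m"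
proof -
  have D: "(power_exp_antideriv a m has_real_derivative s ^ m * exp (- (a * s))) (at s)" for s
  proof (induction m)
    case 0
    show ?case using assms by (auto intro!: derivative_eq_intros)
  next
    case (Suc m)
    have 1: "((\<lambda>s. s ^ Suc m) has_real_derivative real (Suc m) * s ^ m) (at s)"
      using DERIV_pow[of "Suc m" s] by simp
    have 2: "((\<lambda>s. exp (- (a * s))) has_real_derivative - a * exp (- (a * s))) (at s)"
      by (auto intro!: derivative_eq_intros)
    have "((\<lambda>s. (- (s ^ Suc m * exp (- (a * s))) + real (Suc m) * power_exp_antideriv a m s) / a)
      has_real_derivative (- (real (Suc m) * s ^ m * exp (- (a * s)) + - a * exp (- (a * s)) * s ^ Suc m)
        + real (Suc m) * (s ^ m * exp (- (a * s)))) / a) (at s)"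
      by (intro DERIV_cdivide DERIV_add DERIV_minus DERIV_mult 1 2 DERIV_cmult Suc.IH)
    then show ?case
      using assms by (simp add: mult_ac)
  qed
  have lim: "(power_exp_antideriv a m \<longlongrightarrow> 0) at_top"
  proof (induction m)
    case 0
    have "((\<lambda>s. - (s ^ 0 * exp (- (a * s))) / a) \<longlongrightarrow> - 0 / a) at_top"
      by (intro tendsto_divide tendsto_minus power_exp_tendsto_0 assms tendsto_const) (use assms in simp)
    then show ?case by simp
  next
    case (Suc m)
    have "((\<lambda>s. (- (s ^ Suc m * exp (- (a * s))) + real (Suc m) * power_exp_antideriv a m s) / a)
        \<longlongrightarrow> (- 0 + real (Suc m) * 0) / a) at_top"
      by (intro tendsto_intros power_exp_tendsto_0 assms Suc.IH) (use assms in simp)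
    then show ?case by (simp del: power_Suc)
  qed
  have zero: "power_exp_antideriv a m 0 = - (fact m / a ^ Suc m)"
  proof (induction m)
    case (Suc m)
    show ?case
      using assms by (simp only: power_exp_antideriv.simps Suc.IH) (simp add: field_simps)
  qed simp
  have nn: "(\<integral>\<^sup>+s. ennreal (indicator {0..} s * (s ^ m * exp (- (a * s)))) \<partial>lborel) = ennreal (fact m / a ^ Suc m)"
  proof -
    have "(\<integral>\<^sup>+s. ennreal (indicator {0..} s * (s ^ m * exp (- (a * s)))) \<partial>lborel)
        = (\<integral>\<^sup>+s. ennreal (s ^ m * exp (- (a * s))) * indicator {0..} s \<partial>lborel)"
      by (intro nn_integral_cong) (auto split: split_indicator)
    also have "\<dots> = ennreal (0 - power_exp_antideriv a m 0)"
      by (rule nn_integral_FTC_atLeast) (use D lim in auto)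
    finally show ?thesis by (simp add: zero)
  qed
  show int: "integrable lborel (\<lambda>s. indicator {0..} s * (s ^ m * exp (- (a * s))))"
    using nn by (intro integrableI_nonneg) (auto split: split_indicator)
  have "0 \<le> (LINT s|lborel. indicator {0..} s * (s ^ m * exp (- (a * s))))"
    by (intro integral_nonneg_AE AE_I2) (auto split: split_indicator)
  then show "(LINT s|lborel. indicator {0..} s * (s ^ m * exp (- (a * s)))) = fact m / a ^ Suc m"
    using nn assms by (subst (asm) nn_integral_eq_integral[OF int]) (auto split: split_indicator)
qed

section \<open>The Bessel function as a power series in w = z^2 / 4\<close>

definition bes :: "real \<Rightarrow> real" where
  "bes w = (\<Sum>n. 1 / (fact n)\<^sup>2 * w ^ n)"

text \<open>The Euler operator w d/dw applied to \<open>bes\<close>.\<close>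

definition bes_euler :: "real \<Rightarrow> real" where
  "bes_euler w = (\<Sum>n. real n / (fact n)\<^sup>2 * w ^ n)"

lemma bes_summable_norm: "summable (\<lambda>n. norm (1 / (fact n)\<^sup>2 * w ^ n :: real))"
proof (rule summable_comparison_test[OF exI[of _ 0]])
  show "summable (\<lambda>n. \<bar>w\<bar> ^ n /\<^sub>R fact n)"
    by (rule summable_exp_generic)
  have "1 / (fact n)\<^sup>2 \<le> (1 / fact n :: real)" for n :: nat
    by (simp add: power2_eq_square divide_simps fact_ge_1)
  then have "1 / (fact n)\<^sup>2 * \<bar>w\<bar> ^ n \<le> 1 / fact n * \<bar>w\<bar> ^ n" for n :: nat
    by (intro mult_right_mono) auto
  then show "\<forall>n\<ge>0. norm (norm (1 / (fact n)\<^sup>2 * w ^ n)) \<le> \<bar>w\<bar> ^ n /\<^sub>R fact n"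
    by (simp add: abs_mult power_abs divide_inverse mult.commute)
qed

lemma bes_summable: "summable (\<lambda>n. 1 / (fact n)\<^sup>2 * w ^ n :: real)"
  using bes_summable_norm by (rule summable_norm_cancel)

lemma diffs_bes: "diffs (\<lambda>n. real n / (fact n)\<^sup>2) = (\<lambda>n. 1 / (fact n)\<^sup>2)"
  by (auto simp: diffs_def fun_eq_iff power2_eq_square divide_simps)

lemma
  shows bes_euler_summable: "summable (\<lambda>n. real n / (fact n)\<^sup>2 * w ^ n)"
    and bes_euler_diffs: "bes_euler w = w * (\<Sum>n. diffs (\<lambda>n. 1 / (fact n)\<^sup>2) n * w ^ n)"
proof -
  have s: "summable (\<lambda>n. diffs (\<lambda>n. 1 / (fact n)\<^sup>2 :: real) n * w ^ n)"
    by (rule termdiff_converges_all) (rule bes_summable)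
  have "(\<lambda>n. w * (diffs (\<lambda>n. 1 / (fact n)\<^sup>2) n * w ^ n)) sums (w * (\<Sum>n. diffs (\<lambda>n. 1 / (fact n)\<^sup>2) n * w ^ n))"
    using s by (intro sums_mult summable_sums)
  also have "(\<lambda>n. w * (diffs (\<lambda>n. 1 / (fact n)\<^sup>2) n * w ^ n)) = (\<lambda>n. real (Suc n) / (fact (Suc n))\<^sup>2 * w ^ Suc n)"
    by (auto simp: diffs_def fun_eq_iff)
  finally have "(\<lambda>n. real n / (fact n)\<^sup>2 * w ^ n) sums (w * (\<Sum>n. diffs (\<lambda>n. 1 / (fact n)\<^sup>2) n * w ^ n))"
    by (subst (asm) sums_Suc_iff) simp
  then show "summable (\<lambda>n. real n / (fact n)\<^sup>2 * w ^ n)"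
    "bes_euler w = w * (\<Sum>n. diffs (\<lambda>n. 1 / (fact n)\<^sup>2) n * w ^ n)"
    by (auto simp: sums_iff bes_euler_def)
qed

definition bes' :: "real \<Rightarrow> real" where
  "bes' w = (\<Sum>n. diffs (\<lambda>n. 1 / (fact n)\<^sup>2) n * w ^ n)"

lemma DERIV_bes: "(bes has_real_derivative bes' w) (at w)"
  unfolding bes_def[abs_def] bes'_def
  by (rule termdiffs_strong_converges_everywhere) (rule bes_summable)

lemma bes_euler_bes': "bes_euler w = w * bes' w"
  unfolding bes'_def by (rule bes_euler_diffs)

text \<open>Bessel's equation of order 0. In the variable w = z^2 / 4 it reads (w f')' = f, which on
  coefficients is n^2 / (n!)^2 = 1 / ((n - 1)!)^2.\<close>

lemma DERIV_bes_euler: "(bes_euler has_real_derivative bes w) (at w)"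
  using termdiffs_strong_converges_everywhere[of "\<lambda>n. real n / (fact n)\<^sup>2" w] bes_euler_summable
  unfolding bes_euler_def[abs_def] bes_def diffs_bes by blast

lemma continuous_bes': "continuous_on UNIV bes'"
proof -
  have "(bes' has_real_derivative (\<Sum>n. diffs (diffs (\<lambda>n. 1 / (fact n)\<^sup>2)) n * w ^ n)) (at w)" for w
    unfolding bes'_def[abs_def]
    by (intro termdiffs_strong_converges_everywhere termdiff_converges_all bes_summable)
  then show ?thesis
    by (meson DERIV_isCont continuous_at_imp_continuous_on)
qed

lemma bes_nonneg: "0 \<le> w \<Longrightarrow> 0 \<le> bes w"
  unfolding bes_def by (intro suminf_nonneg bes_summable) simp

lemma bes_euler_nonneg: "0 \<le> w \<Longrightarrow> 0 \<le> bes_euler w"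
  unfolding bes_euler_def by (intro suminf_nonneg bes_euler_summable) simp

lemma bes_euler_le:
  assumes "0 \<le> w"
  shows "bes_euler w \<le> w * bes w"
proof -
  have s: "summable (\<lambda>n. diffs (\<lambda>n. 1 / (fact n)\<^sup>2 :: real) n * w ^ n)"
    by (rule termdiff_converges_all) (rule bes_summable)
  have "diffs (\<lambda>n. 1 / (fact n)\<^sup>2 :: real) n \<le> 1 / (fact n)\<^sup>2" for n
  proof -
    have "diffs (\<lambda>n. 1 / (fact n)\<^sup>2 :: real) n = 1 / (fact n)\<^sup>2 * (1 / real (Suc n))"
      by (simp add: diffs_def power2_eq_square divide_simps)
    also have "\<dots> \<le> 1 / (fact n)\<^sup>2 * 1"
      by (intro mult_left_mono) auto
    finally show ?thesis by simp
  qed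
  then have "bes' w \<le> bes w"
    unfolding bes'_def bes_def using assms by (intro suminf_le s bes_summable mult_right_mono) auto
  then show ?thesis
    unfolding bes_euler_bes' using assms by (rule mult_left_mono)
qed

lemma central_binomial_le: "real (2 * n choose n) \<le> 4 ^ n"
proof -
  have "(2 * n choose n) \<le> (\<Sum>k\<le>2 * n. (2 * n choose k))"
    by (intro member_le_sum) auto
  also have "\<dots> = 4 ^ n"
    by (simp add: choose_row_sum power_mult)
  finally show ?thesis
    by (metis of_nat_le_iff of_nat_power of_nat_numeral)
qed

text \<open>Termwise comparison with the series of cosh z: the central binomial coefficient is at
  most 4^n, so (2 n)! is at most 4^n (n!)^2.\<close>

lemma bes_le_exp:
  assumes "0 \<le> z"
  shows "bes (z\<^sup>2 / 4) \<le> exp z"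
proof -
  let ?c = "\<lambda>n. if even n then z ^ n /\<^sub>R fact n else 0"
  have "?c n = 0" if "n \<notin> range ((*) 2)" for n
    using that by (auto elim!: evenE)
  then have "(\<lambda>n. ?c (2 * n)) sums cosh z"
    using cosh_converges[of z] by (subst sums_mono_reindex) (auto simp: strict_mono_def)
  then have even_sums: "(\<lambda>n. z ^ (2 * n) / fact (2 * n)) sums cosh z"
    by (simp add: divide_inverse mult.commute)
  have "bes (z\<^sup>2 / 4) \<le> (\<Sum>n. z ^ (2 * n) / fact (2 * n))"
    unfolding bes_def
  proof (intro suminf_le bes_summable)
    show "summable (\<lambda>n. z ^ (2 * n) / fact (2 * n))"
      using even_sums by (simp add: sums_iff)
    fix n
    have "fact (2 * n) = (fact n)\<^sup>2 * real (2 * n choose n)"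
      by (simp add: binomial_fact power2_eq_square mult_2)
    also have "\<dots> \<le> (fact n)\<^sup>2 * 4 ^ n"
      by (intro mult_left_mono central_binomial_le) simp
    finally have "z ^ (2 * n) / ((fact n)\<^sup>2 * 4 ^ n) \<le> z ^ (2 * n) / fact (2 * n)"
      using assms by (intro divide_left_mono) auto
    then show "1 / (fact n)\<^sup>2 * (z\<^sup>2 / 4) ^ n \<le> z ^ (2 * n) / fact (2 * n)"
      by (simp add: power_divide power_mult[symmetric])
  qed
  also have "\<dots> = cosh z"
    using even_sums by (simp add: sums_iff)
  also have "\<dots> \<le> exp z"
    using assms by (simp add: cosh_def)
  finally show ?thesis .
qed

text \<open>In the Cauchy product the coefficient of w^n is 1 / (n!)^2 times the sum of the squares
  of the binomial coefficients of n, which is the central binomial coefficient by Vandermonde's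
  identity.\<close>

lemma bes_square_sums: "(\<lambda>n. real (2 * n choose n) / (fact n)\<^sup>2 * w ^ n) sums (bes w)\<^sup>2"
proof -
  have "(\<lambda>k. \<Sum>i\<le>k. (1 / (fact i)\<^sup>2 * w ^ i) * (1 / (fact (k - i))\<^sup>2 * w ^ (k - i))) sums (bes w * bes w)"
    unfolding bes_def by (intro Cauchy_product_sums bes_summable_norm)
  also have "(\<lambda>k. \<Sum>i\<le>k. (1 / (fact i)\<^sup>2 * w ^ i) * (1 / (fact (k - i))\<^sup>2 * w ^ (k - i)))
      = (\<lambda>k. real (2 * k choose k) / (fact k)\<^sup>2 * w ^ k)"
  proof
    fix k
    have "(\<Sum>i\<le>k. (1 / (fact i)\<^sup>2 * w ^ i) * (1 / (fact (k - i))\<^sup>2 * w ^ (k - i)))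
        = (\<Sum>i\<le>k. (real (k choose i))\<^sup>2 * (w ^ k / (fact k)\<^sup>2))"
    proof (intro sum.cong refl)
      fix i assume "i \<in> {..k}"
      then have i: "i \<le> k" by simp
      have "w ^ k = w ^ i * w ^ (k - i)" using i by (simp add: power_add[symmetric])
      then show "(1 / (fact i)\<^sup>2 * w ^ i) * (1 / (fact (k - i))\<^sup>2 * w ^ (k - i)) = (real (k choose i))\<^sup>2 * (w ^ k / (fact k)\<^sup>2)"
        by (simp add: binomial_fact[OF i] power_divide power_mult_distrib)
    qed
    also have "\<dots> = real (2 * k choose k) / (fact k)\<^sup>2 * w ^ k"
      unfolding sum_distrib_right[symmetric]
      by (simp add: choose_square_sum[symmetric])
    finally show "(\<Sum>i\<le>k. (1 / (fact i)\<^sup>2 * w ^ i) * (1 / (fact (k - i))\<^sup>2 * w ^ (k - i)))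
      = real (2 * k choose k) / (fact k)\<^sup>2 * w ^ k" .
  qed
  finally show ?thesis by (simp add: power2_eq_square)
qed

lemma bessel_I0_bes: "bessel_I0 z = bes (z\<^sup>2 / 4)"
  unfolding bessel_I0_def bes_def
  by (intro arg_cong[where f = suminf]) (auto simp: fun_eq_iff power_divide power_mult)

text \<open>The coefficients of (1 - x)^(-1/2), and at the same time the averages of sin^(2 n) over
  a quarter period.\<close>

definition wallis :: "nat \<Rightarrow> real" where
  "wallis n = real (2 * n choose n) / 4 ^ n"

lemma wallis_0 [simp]: "wallis 0 = 1"
  by (simp add: wallis_def)

lemma wallis_Suc: "wallis (Suc n) = wallis n * (2 * real n + 1) / (2 * real n + 2)"
proof -
  have "real (2 * Suc n choose Suc n) = fact (2 * Suc n) / (fact (Suc n) * fact (Suc n))"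
    by (subst binomial_fact) auto
  also have "fact (2 * Suc n) = (2 * real n + 2) * ((2 * real n + 1) * fact (2 * n))"
    by (simp add: algebra_simps)
  also have "(fact (Suc n) * fact (Suc n) :: real) = (real n + 1) * (real n + 1) * (fact n * fact n)"
    by (simp add: algebra_simps)
  also have "(2 * real n + 2) * ((2 * real n + 1) * fact (2 * n)) / ((real n + 1) * (real n + 1) * (fact n * fact n))
      = 4 * (2 * real n + 1) / (2 * real n + 2) * (fact (2 * n) / (fact n * fact n))"
    by (simp add: divide_simps) (simp add: algebra_simps)
  also have "fact (2 * n) / (fact n * fact n) = real (2 * n choose n)"
    by (subst binomial_fact) (auto simp: mult_2)
  finally have e: "real (2 * Suc n choose Suc n) = 4 * (2 * real n + 1) / (2 * real n + 2) * real (2 * n choose n)" .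
  show ?thesis
    unfolding wallis_def e by (simp add: divide_simps) (simp add: algebra_simps)
qed

lemma wallis_pos: "0 < wallis n"
  by (simp add: wallis_def)

lemma wallis_le_1: "wallis n \<le> 1"
  using central_binomial_le[of n] by (simp add: wallis_def)

section \<open>Moments of the Bessel profile\<close>

text \<open>The intended values are A = (1 + \<xi>) / (1 - \<xi>) and B = sqrt \<xi> / (1 - \<xi>),
  so that U(s) = exp (- A s / 2) I_0(B s) is the profile of \<open>psi_fam\<close> up to its
  normalising factor. \<open>disc\<close> fixes the scale of s.\<close>

locale bessel_profile =
  fixes A B :: real
  assumes B_pos: "0 < B" and B_less: "B < A / 2" and disc: "A\<^sup>2 - 4 * B\<^sup>2 = 1"
begin

lemma A_pos: "0 < A"
  using B_pos B_less by simp

definition warg :: "real \<Rightarrow> real" where "warg s = B\<^sup>2 * s\<^sup>2 / 4"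
definition decay :: "real \<Rightarrow> real" where "decay s = exp (- (A / 2 * s))"
definition U :: "real \<Rightarrow> real" where "U s = decay s * bes (warg s)"
definition U' :: "real \<Rightarrow> real" where
  "U' s = decay s * (bes' (warg s) * (B\<^sup>2 * s / 2)) - A / 2 * U s"
text \<open>This is s U'(s), whose square carries the uncertainty product. Written with
  \<open>bes_euler\<close>, it can be differentiated by Bessel's equation without second
  derivatives.\<close>

definition P :: "real \<Rightarrow> real" where
  "P s = decay s * (2 * bes_euler (warg s)) - A / 2 * s * U s"

lemma DERIV_warg: "(warg has_real_derivative B\<^sup>2 * s / 2) (at s)"
  unfolding warg_def by (auto intro!: derivative_eq_intros)

lemma DERIV_decay: "(decay has_real_derivative - (A / 2) * decay s) (at s)"
  unfolding decay_def by (auto intro!: derivative_eq_intros)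

lemma DERIV_U: "(U has_real_derivative U' s) (at s)"
  unfolding U_def[abs_def] U'_def
  by (rule DERIV_cong[OF DERIV_mult[OF DERIV_decay DERIV_chain2[OF DERIV_bes DERIV_warg]]]) (simp add: algebra_simps)

lemma P_eq: "P s = s * U' s"
  by (simp add: P_def U'_def bes_euler_bes' warg_def algebra_simps power2_eq_square)

text \<open>Bessel's equation for U. The coefficient of s U comes out as B^2 - A^2 / 4, which
  \<open>disc\<close> turns into - 1/4.\<close>

lemma DERIV_P: "(P has_real_derivative - A * P s - (A / 2) * U s - (1 / 4) * s * U s) (at s)"
proof -
  have "(P has_real_derivative (- (A / 2) * decay s * (2 * bes_euler (warg s))
      + 2 * (bes (warg s) * (B\<^sup>2 * s / 2)) * decay s) - (A / 2 * 1 * U s + U' s * (A / 2 * s))) (at s)"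
    unfolding P_def[abs_def]
    by (intro DERIV_diff DERIV_mult DERIV_decay DERIV_cmult DERIV_chain2[OF DERIV_bes_euler DERIV_warg] DERIV_ident DERIV_U)
  moreover have "(- (A / 2) * decay s * (2 * bes_euler (warg s))
      + 2 * (bes (warg s) * (B\<^sup>2 * s / 2)) * decay s) - (A / 2 * 1 * U s + U' s * (A / 2 * s))
      = - A * P s - (A / 2) * U s - (1 / 4) * s * U s"
  proof -
    have B2: "B\<^sup>2 = (A\<^sup>2 - 1) / 4" using disc by simp
    have e: "decay s * (2 * bes_euler (warg s)) = P s + A / 2 * s * U s" by (simp add: P_def)
    have "(- (A / 2) * decay s * (2 * bes_euler (warg s))
      + 2 * (bes (warg s) * (B\<^sup>2 * s / 2)) * decay s) - (A / 2 * 1 * U s + U' s * (A / 2 * s))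
      = - (A / 2) * (decay s * (2 * bes_euler (warg s))) + B\<^sup>2 * s * U s - A / 2 * U s - A / 2 * P s"
      by (simp add: P_eq U_def algebra_simps)
    also have "\<dots> = - A * P s - (A / 2) * U s - (1 / 4) * s * U s"
      unfolding e B2 by (simp add: field_simps power2_eq_square)
    finally show ?thesis .
  qed
  ultimately show ?thesis by (rule DERIV_cong)
qed

lemma continuous_U: "continuous_on S U" and continuous_P: "continuous_on S P"
  using DERIV_U DERIV_P by (meson DERIV_isCont continuous_at_imp_continuous_on)+

lemma continuous_U': "continuous_on UNIV U'"
proof -
  have "continuous_on UNIV warg" "continuous_on UNIV decay"
    using DERIV_warg DERIV_decay by (meson DERIV_isCont continuous_at_imp_continuous_on)+
  then show ?thesis
    unfolding U'_def[abs_def]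
    by (intro continuous_intros continuous_U continuous_on_compose2[OF continuous_bes']) auto
qed

lemma [measurable]: "U \<in> borel_measurable borel" "P \<in> borel_measurable borel"
  using continuous_U continuous_P by (auto intro: borel_measurable_continuous_onI)

text \<open>The estimate I_0(B s) <= exp (B s) leaves the decay rate A / 2 - B > 0, on which all
  integrability and all limits at infinity rest.\<close>

lemma U_bounds:
  assumes "0 \<le> s"
  shows "0 \<le> U s" "U s \<le> exp (- ((A / 2 - B) * s))"
    "\<bar>P s\<bar> \<le> (B\<^sup>2 / 2 * s\<^sup>2 + A / 2 * s) * exp (- ((A / 2 - B) * s))"
proof -
  have arg0: "0 \<le> warg s" by (simp add: warg_def)
  have a: "warg s = (B * s)\<^sup>2 / 4" by (simp add: warg_def power_mult_distrib)
  have "0 \<le> B * s" using assms B_pos by simp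
  then have b: "bes (warg s) \<le> exp (B * s)"
    unfolding a by (rule bes_le_exp)
  have d: "0 < decay s" "decay s * exp (B * s) = exp (- ((A / 2 - B) * s))"
    by (auto simp: decay_def exp_add[symmetric] algebra_simps)
  show U0: "0 \<le> U s"
    using d(1) bes_nonneg[OF arg0] by (simp add: U_def)
  show U1: "U s \<le> exp (- ((A / 2 - B) * s))"
    unfolding U_def d(2)[symmetric] using d(1) b by (intro mult_left_mono) auto
  have "0 \<le> decay s * (2 * bes_euler (warg s))"
    using d(1) bes_euler_nonneg[OF arg0] by simp
  moreover have "0 \<le> A / 2 * s * U s"
    using U0 assms A_pos by simp
  ultimately have "\<bar>P s\<bar> \<le> decay s * (2 * bes_euler (warg s)) + A / 2 * s * U s"
    unfolding P_def by linarith
  also have "decay s * (2 * bes_euler (warg s)) \<le> decay s * (2 * (warg s * bes (warg s)))"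
    using d(1) bes_euler_le[OF arg0] by (intro mult_left_mono) auto
  also have "\<dots> = B\<^sup>2 / 2 * s\<^sup>2 * U s"
    by (simp add: U_def warg_def)
  also have "B\<^sup>2 / 2 * s\<^sup>2 * U s + A / 2 * s * U s = (B\<^sup>2 / 2 * s\<^sup>2 + A / 2 * s) * U s"
    by (simp add: algebra_simps)
  also have "\<dots> \<le> (B\<^sup>2 / 2 * s\<^sup>2 + A / 2 * s) * exp (- ((A / 2 - B) * s))"
    using U1 assms A_pos by (intro mult_left_mono add_nonneg_nonneg) auto
  finally show "\<bar>P s\<bar> \<le> (B\<^sup>2 / 2 * s\<^sup>2 + A / 2 * s) * exp (- ((A / 2 - B) * s))" by simp
qed

section \<open>Integrability, and the integral of P^2 in terms of moments of U^2\<close>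

definition rate :: real where "rate = 2 * (A / 2 - B)"

lemma rate_pos: "0 < rate"
  using B_less by (simp add: rate_def)

lemma exp_rate: "exp (- ((A / 2 - B) * s)) * exp (- ((A / 2 - B) * s)) = exp (- (rate * s))"
  by (simp add: exp_add[symmetric] rate_def)

lemma moment_integrable: "integrable lborel (\<lambda>s. indicator {0..} s * (s ^ k * (U s)\<^sup>2))"
proof (rule Bochner_Integration.integrable_bound[OF power_exp_integrable[OF rate_pos, of k]])
  show "AE s in lborel. norm (indicator {0..} s * (s ^ k * (U s)\<^sup>2)) \<le> norm (indicator {0..} s * (s ^ k * exp (- (rate * s))))"
  proof (intro AE_I2)
    fix s :: real
    have "(U s)\<^sup>2 \<le> exp (- (rate * s))" if "0 \<le> s"
      unfolding exp_rate[symmetric] power2_eq_square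
      using U_bounds(1,2)[OF that] by (intro mult_mono) auto
    then show "norm (indicator {0..} s * (s ^ k * (U s)\<^sup>2)) \<le> norm (indicator {0..} s * (s ^ k * exp (- (rate * s))))"
      by (auto simp: abs_mult split: split_indicator intro!: mult_left_mono)
  qed
qed measurable

lemma P_square_integrable: "integrable lborel (\<lambda>s. indicator {0..} s * (P s)\<^sup>2)"
proof (rule Bochner_Integration.integrable_bound)
  let ?f = "\<lambda>s. 2 * (B\<^sup>2 / 2)\<^sup>2 * (indicator {0..} s * (s ^ 4 * exp (- (rate * s))))
      + 2 * (A / 2)\<^sup>2 * (indicator {0..} s * (s ^ 2 * exp (- (rate * s))))"
  show "integrable lborel ?f"
    using power_exp_integrable[OF rate_pos] by (intro Bochner_Integration.integrable_add integrable_mult_right)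
  show "AE s in lborel. norm (indicator {0..} s * (P s)\<^sup>2) \<le> norm (?f s)"
  proof (intro AE_I2)
    fix s :: real
    show "norm (indicator {0..} s * (P s)\<^sup>2) \<le> norm (?f s)"
    proof (cases "0 \<le> s")
      case True
      have "(P s)\<^sup>2 \<le> ((B\<^sup>2 / 2 * s\<^sup>2 + A / 2 * s) * exp (- ((A / 2 - B) * s)))\<^sup>2"
        using U_bounds(3)[OF True] by (rule power2_le_iff_abs_le[THEN iffD2, rotated])
          (use True A_pos in \<open>auto intro!: mult_nonneg_nonneg add_nonneg_nonneg\<close>)
      also have "\<dots> = (B\<^sup>2 / 2 * s\<^sup>2 + A / 2 * s)\<^sup>2 * exp (- (rate * s))"
        unfolding exp_rate[symmetric] by (simp add: power2_eq_square)
      also have "\<dots> \<le> (2 * (B\<^sup>2 / 2 * s\<^sup>2)\<^sup>2 + 2 * (A / 2 * s)\<^sup>2) * exp (- (rate * s))"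
      proof (intro mult_right_mono)
        show "(x + y)\<^sup>2 \<le> 2 * x\<^sup>2 + 2 * y\<^sup>2" for x y :: real
          using sum_squares_bound[of x y] by (simp add: power2_sum)
      qed simp
      also have "\<dots> = ?f s"
      proof -
        have "(B\<^sup>2 / 2 * s\<^sup>2)\<^sup>2 = (B\<^sup>2 / 2)\<^sup>2 * s ^ 4"
          by (simp only: power_mult_distrib power_mult[symmetric]) simp
        moreover have "(A / 2 * s)\<^sup>2 = (A / 2)\<^sup>2 * s\<^sup>2"
          by (rule power_mult_distrib)
        ultimately show ?thesis
          using True by (simp only:) (simp add: algebra_simps)
      qed
      finally show ?thesis using True by simp
    qed simp
  qed
qed measurable

text \<open>The boundary terms of three integrations by parts. The derivative of s U P contains P^2
  together with the mixed terms U P and - A s U P; as P = s U', these are removed by the derivatives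
  of - s U^2 / 2 and A s^2 U^2 / 2. Only P^2 and multiples of U^2 are left.\<close>

definition boundary :: "real \<Rightarrow> real" where
  "boundary s = s * U s * P s - 1 / 2 * s * (U s)\<^sup>2 + A / 2 * s\<^sup>2 * (U s)\<^sup>2"

lemma DERIV_boundary:
  "(boundary has_real_derivative (P s)\<^sup>2 - (1 / 2 - A / 2 * s + s\<^sup>2 / 4) * (U s)\<^sup>2) (at s)"
proof -
  have "(boundary has_real_derivative
      ((1 * U s + U' s * s) * P s + (- A * P s - (A / 2) * U s - (1 / 4) * s * U s) * (s * U s))
      - (1 / 2 * 1 * (U s * U s) + (U' s * U s + U' s * U s) * (1 / 2 * s))
      + (A / 2 * (1 * s + 1 * s) * (U s * U s) + (U' s * U s + U' s * U s) * (A / 2 * (s * s)))) (at s)"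
    unfolding boundary_def[abs_def] power2_eq_square
    by (intro DERIV_diff DERIV_add DERIV_mult DERIV_cmult DERIV_ident DERIV_U DERIV_P)
  then show ?thesis
    by (rule DERIV_cong) (simp add: P_eq power2_eq_square algebra_simps)
qed

lemma boundary_tendsto: "(boundary \<longlongrightarrow> 0) at_top"
proof (rule Lim_null_comparison)
  let ?e = "\<lambda>s. exp (- (rate * s))"
  let ?f = "\<lambda>s. B\<^sup>2 / 2 * (s ^ 3 * ?e s) + A / 2 * (s ^ 2 * ?e s) + 1 / 2 * (s ^ 1 * ?e s) + A / 2 * (s ^ 2 * ?e s)"
  have "(?f \<longlongrightarrow> B\<^sup>2 / 2 * 0 + A / 2 * 0 + 1 / 2 * 0 + A / 2 * 0) at_top"
    by (intro tendsto_intros power_exp_tendsto_0 rate_pos)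
  then show "(?f \<longlongrightarrow> 0) at_top" by simp
  show "\<forall>\<^sub>F s in at_top. norm (boundary s) \<le> ?f s"
    using eventually_ge_at_top[of 0]
  proof eventually_elim
    fix s :: real assume s: "0 \<le> s"
    have U2: "(U s)\<^sup>2 \<le> ?e s"
      unfolding exp_rate[symmetric] power2_eq_square
      using U_bounds(1,2)[OF s] by (intro mult_mono) auto
    have "\<bar>U s * P s\<bar> \<le> exp (- ((A / 2 - B) * s)) * ((B\<^sup>2 / 2 * s\<^sup>2 + A / 2 * s) * exp (- ((A / 2 - B) * s)))"
      unfolding abs_mult using U_bounds[OF s] by (intro mult_mono) auto
    also have "\<dots> = (B\<^sup>2 / 2 * s\<^sup>2 + A / 2 * s) * ?e s"
      unfolding exp_rate[symmetric] by simp
    finally have UP: "\<bar>U s * P s\<bar> \<le> (B\<^sup>2 / 2 * s\<^sup>2 + A / 2 * s) * ?e s" .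
    have "norm (boundary s) \<le> s * \<bar>U s * P s\<bar> + 1 / 2 * s * (U s)\<^sup>2 + A / 2 * s\<^sup>2 * (U s)\<^sup>2"
    proof -
      have "\<bar>s * U s * P s\<bar> = s * \<bar>U s * P s\<bar>" using s by (simp add: abs_mult)
      moreover have "0 \<le> 1 / 2 * s * (U s)\<^sup>2" "0 \<le> A / 2 * s\<^sup>2 * (U s)\<^sup>2" using s A_pos by auto
      ultimately show ?thesis unfolding boundary_def real_norm_def by linarith
    qed
    also have "\<dots> \<le> s * ((B\<^sup>2 / 2 * s\<^sup>2 + A / 2 * s) * ?e s) + 1 / 2 * s * ?e s + A / 2 * s\<^sup>2 * ?e s"
      using s A_pos U2 UP by (intro add_mono mult_left_mono) auto
    also have "\<dots> = ?f s"
      by (simp add: algebra_simps power2_eq_square power3_eq_cube)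
    finally show "norm (boundary s) \<le> ?f s" .
  qed
qed

definition moment :: "nat \<Rightarrow> real" where
  "moment k = (LINT s|lborel. indicator {0..} s * (s ^ k * (U s)\<^sup>2))"

text \<open>\<open>boundary\<close> vanishes at 0 and tends to 0 at infinity, so its derivative
  integrates to 0 over the half-line.\<close>

lemma P_square_integral:
  "(LINT s|lborel. indicator {0..} s * (P s)\<^sup>2) = 1 / 2 * moment 0 - A / 2 * moment 1 + 1 / 4 * moment 2"
proof -
  let ?f = "\<lambda>s. (P s)\<^sup>2 - (1 / 2 - A / 2 * s + s\<^sup>2 / 4) * (U s)\<^sup>2"
  let ?m = "\<lambda>k s. indicator {0..} s * (s ^ k * (U s)\<^sup>2)"
  let ?p = "\<lambda>s. indicator {0..} s * (P s)\<^sup>2"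
  have eq: "indicator {0..} s * ?f s = ?p s - 1 / 2 * ?m 0 s + A / 2 * ?m 1 s - 1 / 4 * ?m 2 s" for s
    by (simp add: algebra_simps)
  have int: "integrable lborel (\<lambda>s. indicator {0..} s * ?f s)"
    unfolding eq using P_square_integrable moment_integrable
    by (intro Bochner_Integration.integrable_add Bochner_Integration.integrable_diff integrable_mult_right)
  have cont: "continuous_on S ?f" for S
    by (auto intro!: continuous_intros continuous_U continuous_P)
  have "((\<lambda>y. LINT s|lborel. indicator {..y} s *\<^sub>R (indicator {0..} s * ?f s)) \<longlongrightarrow> (LINT s|lborel. indicator {0..} s * ?f s)) at_top"
    by (rule tendsto_integral_at_top[OF _ int]) simp
  moreover have "\<forall>\<^sub>F y in at_top. (LINT s|lborel. indicator {..y} s *\<^sub>R (indicator {0..} s * ?f s)) = boundary y"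
    using eventually_ge_at_top[of 0]
  proof eventually_elim
    fix y :: real assume "0 \<le> y"
    have "(LINT s|lborel. indicator {..y} s *\<^sub>R (indicator {0..} s * ?f s)) = (LINT s|lborel. indicator {0..y} s *\<^sub>R ?f s)"
      by (intro Bochner_Integration.integral_cong) (auto split: split_indicator)
    also have "\<dots> = boundary y - boundary 0"
    proof (intro integral_FTC_atLeastAtMost cont \<open>0 \<le> y\<close>)
      show "(boundary has_vector_derivative ?f s) (at s within {0..y})" for s
        by (rule has_vector_derivative_at_within[OF DERIV_boundary[of s, unfolded has_real_derivative_iff_has_vector_derivative]])
    qed
    finally show "(LINT s|lborel. indicator {..y} s *\<^sub>R (indicator {0..} s * ?f s)) = boundary y"
      by (simp add: boundary_def)
  qed
  ultimately have "(boundary \<longlongrightarrow> (LINT s|lborel. indicator {0..} s * ?f s)) at_top"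
    by (rule Lim_transform_eventually)
  then have "(LINT s|lborel. indicator {0..} s * ?f s) = 0"
    using boundary_tendsto tendsto_unique trivial_limit_at_top_linorder by blast
  moreover have "(LINT s|lborel. indicator {0..} s * ?f s) = (LINT s|lborel. ?p s) - 1 / 2 * moment 0 + A / 2 * moment 1 - 1 / 4 * moment 2"
    unfolding eq moment_def using P_square_integrable moment_integrable
    by (simp only: Bochner_Integration.integral_add Bochner_Integration.integral_diff integral_mult_right_zero
        Bochner_Integration.integrable_add Bochner_Integration.integrable_diff integrable_mult_right)
  ultimately show ?thesis by simp
qed

text \<open>In terms of \<xi> the square of Landen's modulus 2 sqrt \<xi> / (1 + \<xi>).\<close>

definition ratio :: real where "ratio = (2 * B / A)\<^sup>2"

text \<open>The series of I_0^2 is integrated term by term against exp (- A s), each term being a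
  Gamma integral (2 n + k)! / A^(2 n + k + 1). All terms are nonnegative, so the exchange of sum and
  integral is free for extended nonnegative integrals, and finiteness of the moment then yields
  summability.\<close>

lemma moment_sums:
  "(\<lambda>n. (wallis n)\<^sup>2 * ratio ^ n * (fact (2 * n + k) / fact (2 * n))) sums (A ^ Suc k * moment k)"
proof -
  define c where "c = (\<lambda>n. real (2 * n choose n) / (fact n)\<^sup>2 * (B\<^sup>2 / 4) ^ n)"
  define t where "t = (\<lambda>n. c n * (fact (2 * n + k) / A ^ Suc (2 * n + k)))"
  have c_nonneg: "0 \<le> c n" for n by (simp add: c_def)
  have t_nonneg: "0 \<le> t n" for n using c_nonneg A_pos by (simp add: t_def)
  let ?f = "\<lambda>n s. indicator {0..} s * (s ^ (2 * n + k) * exp (- (A * s)))"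
  have f_nonneg: "0 \<le> c n * ?f n s" for n s
    using c_nonneg by (auto split: split_indicator)
  have sums: "(\<lambda>n. c n * ?f n s) sums (indicator {0..} s * (s ^ k * (U s)\<^sup>2))" for s
  proof -
    have "(\<lambda>n. real (2 * n choose n) / (fact n)\<^sup>2 * warg s ^ n) sums (bes (warg s))\<^sup>2"
      by (rule bes_square_sums)
    then have "(\<lambda>n. (indicator {0..} s * (s ^ k * (decay s)\<^sup>2)) * (real (2 * n choose n) / (fact n)\<^sup>2 * warg s ^ n))
        sums ((indicator {0..} s * (s ^ k * (decay s)\<^sup>2)) * (bes (warg s))\<^sup>2)"
      by (rule sums_mult)
    moreover have "(indicator {0..} s * (s ^ k * (decay s)\<^sup>2)) * (real (2 * n choose n) / (fact n)\<^sup>2 * warg s ^ n) = c n * ?f n s" for n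
    proof -
      have "(decay s)\<^sup>2 = exp (- (A * s))"
        by (simp add: decay_def power2_eq_square exp_add[symmetric])
      moreover have "warg s ^ n = (B\<^sup>2 / 4) ^ n * s ^ (2 * n)"
        by (simp add: warg_def power_mult_distrib power_divide power_mult[symmetric])
      ultimately show ?thesis
        by (simp add: c_def power_add mult_ac)
    qed
    ultimately show ?thesis by (simp add: U_def power_mult_distrib mult.assoc)
  qed
  have "(\<Sum>n. ennreal (t n)) = (\<Sum>n. \<integral>\<^sup>+s. ennreal (c n * ?f n s) \<partial>lborel)"
  proof (intro arg_cong[where f = suminf] ext)
    fix n
    have "(\<integral>\<^sup>+s. ennreal (c n * ?f n s) \<partial>lborel) = ennreal (LINT s|lborel. c n * ?f n s)"
      by (intro nn_integral_eq_integral integrable_mult_right power_exp_integrable A_pos AE_I2 f_nonneg)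
    then show "ennreal (t n) = (\<integral>\<^sup>+s. ennreal (c n * ?f n s) \<partial>lborel)"
      using power_exp_integral[OF A_pos, of "2 * n + k"] by (simp add: t_def)
  qed
  also have "\<dots> = (\<integral>\<^sup>+s. (\<Sum>n. ennreal (c n * ?f n s)) \<partial>lborel)"
    by (rule nn_integral_suminf[symmetric]) measurable
  also have "\<dots> = (\<integral>\<^sup>+s. ennreal (indicator {0..} s * (s ^ k * (U s)\<^sup>2)) \<partial>lborel)"
    by (intro nn_integral_cong suminf_ennreal_eq f_nonneg sums)
  also have "\<dots> = ennreal (moment k)"
    unfolding moment_def by (intro nn_integral_eq_integral moment_integrable AE_I2) (auto split: split_indicator)
  finally have eq: "(\<Sum>n. ennreal (t n)) = ennreal (moment k)" .
  have "summable t"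
    using eq t_nonneg by (intro summable_suminf_not_top) auto
  moreover have "0 \<le> moment k"
    unfolding moment_def by (intro integral_nonneg_AE AE_I2) (auto split: split_indicator)
  ultimately have "t sums moment k"
    using eq t_nonneg suminf_nonneg[of t] by (simp add: suminf_ennreal2 sums_iff)
  then have "(\<lambda>n. A ^ Suc k * t n) sums (A ^ Suc k * moment k)"
    by (rule sums_mult)
  moreover have "A ^ Suc k * t n = (wallis n)\<^sup>2 * ratio ^ n * (fact (2 * n + k) / fact (2 * n))" for n
  proof -
    have C: "real (2 * n choose n) = fact (2 * n) / (fact n)\<^sup>2"
      by (subst binomial_fact) (auto simp: mult_2 power2_eq_square)
    have r: "ratio ^ n = 4 ^ n * (B\<^sup>2) ^ n / A ^ (2 * n)"
      by (simp add: ratio_def power_divide power_mult_distrib power_mult[symmetric])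
    have "A ^ Suc k * t n = c n * fact (2 * n + k) / A ^ (2 * n)"
      using A_pos by (simp add: t_def power_add)
    also have "c n = (B\<^sup>2) ^ n / 4 ^ n * (real (2 * n choose n))\<^sup>2 / fact (2 * n)"
    proof -
      have "real (2 * n choose n) / fact (2 * n) = 1 / (fact n)\<^sup>2"
        unfolding C by simp
      then have "(real (2 * n choose n))\<^sup>2 / fact (2 * n) = real (2 * n choose n) / (fact n)\<^sup>2"
        unfolding power2_eq_square times_divide_eq_right[symmetric] by simp
      moreover have "(B\<^sup>2) ^ n / 4 ^ n * (real (2 * n choose n))\<^sup>2 / fact (2 * n)
          = (B\<^sup>2) ^ n / 4 ^ n * ((real (2 * n choose n))\<^sup>2 / fact (2 * n))" by simp
      ultimately show ?thesis
        unfolding c_def by (simp only: power_divide mult.commute)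
    qed
    finally show ?thesis
      using A_pos by (simp add: wallis_def r power_divide field_simps power2_eq_square)
  qed
  ultimately show ?thesis by simp
qed

lemma norm_sums: "(\<lambda>n. (wallis n)\<^sup>2 * ratio ^ n) sums (A * moment 0)"
  using moment_sums[of 0] by simp

text \<open>By \<open>P_square_integral\<close> the right side is 2 A m_0 - 2 A^2 m_1 + A m_2, where
  m_k is the k-th moment. The series for m_2 comes with the factor A^3 instead of A; since 1 -
  \<open>ratio\<close> = 1 / A^2, this is repaired by subtracting \<open>ratio\<close> times that
  series. The terms that result are those of the series of K plus those of E.\<close>

lemma P_sums:
  "(\<lambda>n. (wallis n)\<^sup>2 * ratio ^ n * (1 + 1 / (1 - 2 * real n)))
    sums (4 * A * (LINT s|lborel. indicator {0..} s * (P s)\<^sup>2))"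
proof -
  let ?b = "\<lambda>n. (wallis n)\<^sup>2 * ratio ^ n"
  have s0: "?b sums (A * moment 0)" by (rule norm_sums)
  have s1: "(\<lambda>n. ?b n * (2 * real n + 1)) sums (A\<^sup>2 * moment 1)"
    using moment_sums[of 1] by (simp add: power2_eq_square add.commute)
  have s2: "(\<lambda>n. ?b n * ((2 * real n + 1) * (2 * real n + 2))) sums (A ^ 3 * moment 2)"
  proof -
    have "fact (2 * n + 2) / fact (2 * n) = (2 * real n + 1) * (2 * real n + 2)" for n
      by (simp add: field_simps)
    then show ?thesis using moment_sums[of 2] by (simp add: eval_nat_numeral)
  qed
  \<comment> \<open>Multiplication by \<open>ratio\<close> amounts to a shift of the index by one;
    the recurrence of \<open>wallis\<close> expresses the shifted terms through \<open>?b\<close>.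
    The additional term at n = 0 is 0.\<close>
  have s3: "(\<lambda>n. ?b n * ((2 * real n) ^ 3 / (2 * real n - 1))) sums (ratio * (A ^ 3 * moment 2))"
  proof -
    have "(\<lambda>n. ratio * (?b n * ((2 * real n + 1) * (2 * real n + 2)))) sums (ratio * (A ^ 3 * moment 2))"
      using s2 by (rule sums_mult)
    also have "(\<lambda>n. ratio * (?b n * ((2 * real n + 1) * (2 * real n + 2))))
        = (\<lambda>n. ?b (Suc n) * ((2 * real (Suc n)) ^ 3 / (2 * real (Suc n) - 1)))"
    proof
      fix n
      have e: "w\<^sup>2 * (p * y) = (w * p / y)\<^sup>2 * (y ^ 3 / p)" if "0 < p" "0 < y" for w p y :: real
        using that by (simp add: power_divide power_mult_distrib power2_eq_square power3_eq_cube)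
      have "(wallis n)\<^sup>2 * ((2 * real n + 1) * (2 * real n + 2))
          = (wallis (Suc n))\<^sup>2 * ((2 * real n + 2) ^ 3 / (2 * real n + 1))"
        unfolding wallis_Suc by (rule e) auto
      moreover have "2 * real (Suc n) = 2 * real n + 2" "2 * real (Suc n) - 1 = 2 * real n + 1" by auto
      ultimately show "ratio * (?b n * ((2 * real n + 1) * (2 * real n + 2)))
          = ?b (Suc n) * ((2 * real (Suc n)) ^ 3 / (2 * real (Suc n) - 1))"
        by (simp only: power_Suc mult_ac)
    qed
    finally show ?thesis
      by (subst (asm) sums_Suc_iff) simp
  qed
  have ratio: "1 - ratio = 1 / A\<^sup>2"
  proof -
    have "1 - ratio = (A\<^sup>2 - 4 * B\<^sup>2) / A\<^sup>2"
      using A_pos by (simp add: ratio_def power_divide power_mult_distrib diff_divide_distrib)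
    then show ?thesis unfolding disc .
  qed
  have "(\<lambda>n. 2 * ?b n - 2 * (?b n * (2 * real n + 1)) + ?b n * ((2 * real n + 1) * (2 * real n + 2))
      - ?b n * ((2 * real n) ^ 3 / (2 * real n - 1)))
    sums (2 * (A * moment 0) - 2 * (A\<^sup>2 * moment 1) + A ^ 3 * moment 2 - ratio * (A ^ 3 * moment 2))"
    by (intro sums_add sums_diff sums_mult s0 s1 s2 s3)
  moreover have "2 * b - 2 * (b * (2 * real n + 1)) + b * ((2 * real n + 1) * (2 * real n + 2))
      - b * ((2 * real n) ^ 3 / (2 * real n - 1)) = b * (1 + 1 / (1 - 2 * real n))" for b n
  proof -
    have "real (2 * n) \<noteq> real 1"
      by (simp only: of_nat_eq_iff) presburger
    then have "2 * real n - 1 \<noteq> 0" "1 - 2 * real n \<noteq> 0" by auto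
    then show ?thesis
      by (simp add: field_simps power3_eq_cube)
  qed
  moreover have "2 * (A * moment 0) - 2 * (A\<^sup>2 * moment 1) + A ^ 3 * moment 2 - ratio * (A ^ 3 * moment 2)
      = 4 * A * (LINT s|lborel. indicator {0..} s * (P s)\<^sup>2)"
  proof -
    have "A ^ 3 * moment 2 - ratio * (A ^ 3 * moment 2) = (1 - ratio) * (A ^ 3 * moment 2)"
      by (simp add: algebra_simps)
    also have "\<dots> = A * moment 2"
      unfolding ratio using A_pos by (simp add: power2_eq_square power3_eq_cube)
    finally have e: "A ^ 3 * moment 2 - ratio * (A ^ 3 * moment 2) = A * moment 2" .
    have "2 * (A * moment 0) - 2 * (A\<^sup>2 * moment 1) + A * moment 2
      = 4 * A * (LINT s|lborel. indicator {0..} s * (P s)\<^sup>2)"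
      unfolding P_square_integral by (simp add: algebra_simps power2_eq_square)
    then show ?thesis using e by linarith
  qed
  ultimately show ?thesis by simp
qed

end

section \<open>Complete elliptic integrals and Landen transformation\<close>

lemma two_real_neq_1: "2 * real n - 1 \<noteq> 0" "1 - 2 * real n \<noteq> 0"
proof -
  have "real (2 * n) \<noteq> real 1"
    by (simp only: of_nat_eq_iff) presburger
  then show "2 * real n - 1 \<noteq> 0" "1 - 2 * real n \<noteq> 0" by auto
qed

text \<open>The coefficients of sqrt (1 - x).\<close>

definition wallis_E :: "nat \<Rightarrow> real" where
  "wallis_E n = wallis n / (1 - 2 * real n)"

lemma wallis_E_0 [simp]: "wallis_E 0 = 1"
  by (simp add: wallis_E_def)

lemma wallis_E_Suc: "wallis_E (Suc n) = wallis_E n * (2 * real n - 1) / (2 * real n + 2)"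
proof -
  have e: "1 - 2 * real (Suc n) = - (2 * real n + 1)" and f: "2 * real n - 1 = - (1 - 2 * real n)" by simp_all
  have "w * p / y / (- p) = w / m * (- m) / y" if "p \<noteq> 0" "m \<noteq> 0" for w p y m :: real
    using that by simp
  moreover have "2 * real n + 1 \<noteq> 0" by (simp add: add_nonneg_eq_0_iff)
  ultimately show ?thesis
    unfolding wallis_E_def wallis_Suc e f
    using two_real_neq_1(2)[of n] by blast
qed

lemma abs_wallis_le_1: "\<bar>wallis n\<bar> \<le> 1"
  using wallis_le_1[of n] wallis_pos[of n] by simp

lemma abs_wallis_E_le_1: "\<bar>wallis_E n\<bar> \<le> 1"
proof -
  have "1 \<le> \<bar>1 - 2 * real n\<bar>" by (cases n) auto
  then have "\<bar>wallis n\<bar> / \<bar>1 - 2 * real n\<bar> \<le> 1 / 1"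
    using abs_wallis_le_1 by (intro frac_le) auto
  then show ?thesis by (simp add: wallis_E_def abs_divide)
qed

lemma gchoose_Suc: "(a gchoose Suc n) = (a gchoose n) * (a - of_nat n) / of_nat (Suc n)"
  for a :: "'a::field_char_0"
proof -
  have "of_nat (Suc n) * (a gchoose Suc n) = (a gchoose n) * (a - of_nat n)"
    using gbinomial_mult_1[of a n] by (simp only: algebra_simps)
  then show ?thesis
    by (metis nonzero_mult_div_cancel_left of_nat_neq_0)
qed

text \<open>Polymorphic because the real binomial series is needed for the elliptic integrals and
  the complex one for Landen's transformation.\<close>

lemma gchoose_minus_half: "((- 1 / 2) gchoose n) = (- 1) ^ n * (of_real (wallis n) :: 'a::{real_field, field_char_0})"
proof (induction n)
  case (Suc n)
  have "of_real (wallis (Suc n)) = (of_real (wallis n) * (2 * of_nat n + 1) / (2 * of_nat n + 2) :: 'a)"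
    unfolding wallis_Suc by simp
  moreover have "2 * of_nat n + 2 = (2 * of_nat (Suc n) :: 'a)" by simp
  moreover have "x * (- 1 / 2 - of_nat n) / of_nat (Suc n) = - x * (2 * of_nat n + 1) / (2 * of_nat (Suc n))" for x :: 'a
    using of_nat_neq_0[where 'a = 'a, of n] by (simp add: divide_simps del: of_nat_Suc) (simp add: algebra_simps)
  ultimately show ?case
    unfolding gchoose_Suc Suc.IH by simp
qed simp

lemma gchoose_half: "((1 / 2) gchoose n) = (- 1) ^ n * (of_real (wallis_E n) :: 'a::{real_field, field_char_0})"
proof (induction n)
  case (Suc n)
  have "of_real (wallis_E (Suc n)) = (of_real (wallis_E n) * (2 * of_nat n - 1) / (2 * of_nat n + 2) :: 'a)"
    unfolding wallis_E_Suc by simp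
  moreover have "2 * of_nat n + 2 = (2 * of_nat (Suc n) :: 'a)" by simp
  moreover have "x * (1 / 2 - of_nat n) / of_nat (Suc n) = - x * (2 * of_nat n - 1) / (2 * of_nat (Suc n))" for x :: 'a
    using of_nat_neq_0[where 'a = 'a, of n] by (simp add: divide_simps del: of_nat_Suc) (simp add: algebra_simps)
  ultimately show ?case
    unfolding gchoose_Suc Suc.IH by simp
qed simp

lemma powr_minus_half:
  assumes "0 < y"
  shows "y powr (- 1 / 2) = 1 / sqrt y"
proof -
  have "y powr (- 1 / 2) = y powr (- (1 / 2))" by simp
  also have "\<dots> = inverse (y powr (1 / 2))" by (rule powr_minus)
  also have "\<dots> = 1 / sqrt y"
    using assms by (simp only: powr_half_sqrt[OF less_imp_le] inverse_eq_divide)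
  finally show ?thesis .
qed

section \<open>Power series of the complete elliptic integrals\<close>

lemma sin_power_has_integral:
  "((\<lambda>\<theta>. (sin \<theta>) ^ (2 * n)) has_integral pi / 2 * wallis n) {0..pi/2}"
proof (induction n)
  case 0
  show ?case using has_integral_const_real[of "1::real" 0 "pi / 2"] by simp
next
  case (Suc n)
  \<comment> \<open>Wallis' recurrence: sin^(2 n + 1) cos vanishes at both ends of the interval, so
    its derivative, a combination of two consecutive even powers of sin, has integral 0.\<close>
  have D: "((\<lambda>\<theta>. (sin \<theta>) ^ (2 * n + 1) * cos \<theta>) has_real_derivative
      (2 * real n + 1) * (sin \<theta>) ^ (2 * n) - (2 * real n + 2) * (sin \<theta>) ^ (2 * Suc n)) (at \<theta>)" for \<theta>
  proof -
    have 1: "((\<lambda>\<theta>. (sin \<theta>) ^ (2 * n + 1)) has_real_derivative (2 * real n + 1) * (sin \<theta>) ^ (2 * n) * cos \<theta>) (at \<theta>)"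
      by (rule DERIV_cong[OF DERIV_chain2[OF DERIV_pow DERIV_sin]]) simp
    have c: "cos \<theta> * cos \<theta> = 1 - sin \<theta> * sin \<theta>"
      using sin_cos_squared_add[of \<theta>] by (simp add: power2_eq_square)
    have "(2 * real n + 1) * (sin \<theta>) ^ (2 * n) * cos \<theta> * cos \<theta> + - sin \<theta> * (sin \<theta>) ^ (2 * n + 1)
        = (2 * real n + 1) * (sin \<theta>) ^ (2 * n) * (cos \<theta> * cos \<theta>) - sin \<theta> * sin \<theta> * (sin \<theta>) ^ (2 * n)" by simp
    also have "\<dots> = (2 * real n + 1) * (sin \<theta>) ^ (2 * n) - (2 * real n + 2) * (sin \<theta>) ^ (2 * Suc n)"
      unfolding c by (simp add: algebra_simps)
    finally show ?thesis
      using DERIV_mult[OF 1 DERIV_cos] by simp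
  qed
  have "((\<lambda>\<theta>. (2 * real n + 1) * (sin \<theta>) ^ (2 * n) - (2 * real n + 2) * (sin \<theta>) ^ (2 * Suc n)) has_integral
      (sin (pi / 2)) ^ (2 * n + 1) * cos (pi / 2) - (sin 0) ^ (2 * n + 1) * cos 0) {0..pi/2}"
  proof (rule fundamental_theorem_of_calculus)
    show "((\<lambda>\<theta>. (sin \<theta>) ^ (2 * n + 1) * cos \<theta>) has_vector_derivative
      (2 * real n + 1) * (sin \<theta>) ^ (2 * n) - (2 * real n + 2) * (sin \<theta>) ^ (2 * Suc n)) (at \<theta> within {0..pi/2})" for \<theta>
      by (rule has_vector_derivative_at_within[OF D[unfolded has_real_derivative_iff_has_vector_derivative]])
  qed simp
  then have "((\<lambda>\<theta>. (2 * real n + 1) * (sin \<theta>) ^ (2 * n) - (2 * real n + 2) * (sin \<theta>) ^ (2 * Suc n)) has_integral 0) {0..pi/2}"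
    by simp
  from has_integral_diff[OF has_integral_mult_right[OF Suc.IH, of "2 * real n + 1"] this]
  have "((\<lambda>\<theta>. (2 * real n + 2) * (sin \<theta>) ^ (2 * Suc n)) has_integral (2 * real n + 1) * (pi / 2 * wallis n)) {0..pi/2}"
    by simp
  from has_integral_mult_right[OF this, of "1 / (2 * real n + 2)"]
  have "((\<lambda>\<theta>. 1 / (2 * real n + 2) * ((2 * real n + 2) * (sin \<theta>) ^ (2 * Suc n))) has_integral
      1 / (2 * real n + 2) * ((2 * real n + 1) * (pi / 2 * wallis n))) {0..pi/2}" .
  moreover have "1 / (2 * real n + 2) * ((2 * real n + 2) * (sin \<theta>) ^ (2 * Suc n)) = (sin \<theta>) ^ (2 * Suc n)" for \<theta>
    by (simp add: add_nonneg_eq_0_iff)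
  moreover have "1 / (2 * real n + 2) * ((2 * real n + 1) * (pi / 2 * wallis n)) = pi / 2 * wallis (Suc n)"
    by (simp add: wallis_Suc)
  ultimately show ?case by (simp only:)
qed

text \<open>The constant majorant of all partial sums for dominated convergence, real in
  \<open>sin_series_integral\<close> and complex in \<open>parseval\<close>.\<close>

lemma geometric_dominated:
  fixes c :: "nat \<Rightarrow> real" and z :: "'a::{real_normed_field, banach}"
  assumes c: "\<And>n. \<bar>c n\<bar> \<le> 1" and z: "norm z \<le> r" "r < 1"
  shows "norm (\<Sum>n<N. of_real (c n) * z ^ n) \<le> 1 / (1 - r)"
proof -
  have r: "0 \<le> r" using z norm_ge_zero order_trans by blast
  have le: "norm (of_real (c n) * z ^ n) \<le> r ^ n" for n
  proof -
    have "norm (of_real (c n) * z ^ n) = \<bar>c n\<bar> * norm z ^ n"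
      by (simp add: norm_mult norm_power)
    also have "\<dots> \<le> 1 * r ^ n"
      using c z r by (intro mult_mono power_mono) auto
    finally show ?thesis by simp
  qed
  have sr: "summable (\<lambda>n. r ^ n)" using r z by (simp add: summable_geometric)
  have "norm (\<Sum>n<N. of_real (c n) * z ^ n) \<le> (\<Sum>n<N. r ^ n)"
    using le by (rule sum_norm_le)
  also have "\<dots> \<le> (\<Sum>n. r ^ n)"
    using r by (intro sum_le_suminf sr) auto
  also have "\<dots> = 1 / (1 - r)"
    using r z by (simp add: suminf_geometric)
  finally show "norm (\<Sum>n<N. of_real (c n) * z ^ n) \<le> 1 / (1 - r)" .
qed

lemma sin_series_integral:
  fixes c :: "nat \<Rightarrow> real"
  assumes c: "\<And>n. \<bar>c n\<bar> \<le> 1" and k: "0 \<le> k" "k < 1"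
    and f: "\<And>\<theta>. (\<lambda>n. c n * (k\<^sup>2 * (sin \<theta>)\<^sup>2) ^ n) sums f \<theta>"
  shows "(\<lambda>n. c n * wallis n * k ^ (2 * n)) sums (2 / pi * integral {0..pi/2} f)"
proof -
  let ?g = "\<lambda>N \<theta>. \<Sum>n<N. c n * (k\<^sup>2 * (sin \<theta>)\<^sup>2) ^ n"
  have k2: "0 \<le> k\<^sup>2" "k\<^sup>2 < 1" using k by (auto simp: power_less_one_iff)
  have has: "(?g N has_integral (\<Sum>n<N. c n * k ^ (2 * n) * (pi / 2 * wallis n))) {0..pi/2}" for N
  proof -
    have "(\<lambda>\<theta>. c n * (k\<^sup>2 * (sin \<theta>)\<^sup>2) ^ n) = (\<lambda>\<theta>. c n * k ^ (2 * n) * sin \<theta> ^ (2 * n))" for n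
      by (simp add: fun_eq_iff power_mult_distrib power_mult)
    then show ?thesis
      using has_integral_mult_right[OF sin_power_has_integral] by (intro has_integral_sum) auto
  qed
  have bound: "norm (?g N \<theta>) \<le> 1 / (1 - k\<^sup>2)" for N \<theta>
  proof -
    have "norm (k\<^sup>2 * (sin \<theta>)\<^sup>2) \<le> k\<^sup>2"
      using k2 by (simp add: mult_left_le power_le_one_iff abs_square_le_1)
    from geometric_dominated[OF c this k2(2), where N = N] show ?thesis by simp
  qed
  have "(\<lambda>N. integral {0..pi/2} (?g N)) \<longlonglongrightarrow> integral {0..pi/2} f"
  proof (rule dominated_convergence(2))
    show "?g N integrable_on {0..pi/2}" for N using has by blast
    show "(\<lambda>_. 1 / (1 - k\<^sup>2)) integrable_on {0..pi/2}" by (rule integrable_const_ivl)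
    show "norm (?g N \<theta>) \<le> 1 / (1 - k\<^sup>2)" for N \<theta> by (rule bound)
    show "(\<lambda>N. ?g N \<theta>) \<longlonglongrightarrow> f \<theta>" for \<theta> using f[of \<theta>] by (simp add: sums_def)
  qed
  moreover have "integral {0..pi/2} (?g N) = (\<Sum>n<N. pi / 2 * (c n * wallis n * k ^ (2 * n)))" for N
    using integral_unique[OF has[of N]] by (simp add: mult_ac)
  ultimately have "(\<lambda>n. pi / 2 * (c n * wallis n * k ^ (2 * n))) sums integral {0..pi/2} f"
    by (simp add: sums_def)
  then have "(\<lambda>n. 2 / pi * (pi / 2 * (c n * wallis n * k ^ (2 * n)))) sums (2 / pi * integral {0..pi/2} f)"
    by (rule sums_mult)
  then show ?thesis by (simp add: mult.assoc)
qed

lemma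
  assumes "0 \<le> k" "k < 1"
  shows elliptic_K_sums: "(\<lambda>n. (wallis n)\<^sup>2 * k ^ (2 * n)) sums (2 / pi * elliptic_K k)"
    and elliptic_E_sums: "(\<lambda>n. (wallis n)\<^sup>2 * k ^ (2 * n) / (1 - 2 * real n)) sums (2 / pi * elliptic_E k)"
proof -
  have x: "0 \<le> k\<^sup>2 * (sin \<theta>)\<^sup>2" "k\<^sup>2 * (sin \<theta>)\<^sup>2 < 1" for \<theta>
  proof -
    have "k\<^sup>2 * (sin \<theta>)\<^sup>2 \<le> k\<^sup>2" by (simp add: mult_left_le power_le_one_iff abs_square_le_1)
    also have "\<dots> < 1" using assms by (auto simp: power_less_one_iff)
    finally show "k\<^sup>2 * (sin \<theta>)\<^sup>2 < 1" .
  qed simp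
  have "(\<lambda>n. wallis n * (k\<^sup>2 * (sin \<theta>)\<^sup>2) ^ n) sums (1 / sqrt (1 - k\<^sup>2 * (sin \<theta>)\<^sup>2))" for \<theta>
  proof -
    have "(\<lambda>n. ((- 1 / 2) gchoose n) * (- (k\<^sup>2 * (sin \<theta>)\<^sup>2)) ^ n) sums (1 + - (k\<^sup>2 * (sin \<theta>)\<^sup>2)) powr (- 1 / 2)"
      using x[of \<theta>] by (intro gen_binomial_real) auto
    moreover have "((- 1 / 2) gchoose n) * (- (k\<^sup>2 * (sin \<theta>)\<^sup>2)) ^ n = wallis n * (k\<^sup>2 * (sin \<theta>)\<^sup>2) ^ n" for n
      unfolding gchoose_minus_half power_minus[of "k\<^sup>2 * (sin \<theta>)\<^sup>2"] by (simp add: mult_ac power_mult_distrib[symmetric] del: power_mult_distrib) 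
    moreover have "(1 + - (k\<^sup>2 * (sin \<theta>)\<^sup>2)) powr (- 1 / 2) = 1 / sqrt (1 - k\<^sup>2 * (sin \<theta>)\<^sup>2)"
      using x[of \<theta>] by (subst powr_minus_half) auto
    ultimately show ?thesis by (simp only:)
  qed
  from sin_series_integral[OF abs_wallis_le_1 assms this]
  show "(\<lambda>n. (wallis n)\<^sup>2 * k ^ (2 * n)) sums (2 / pi * elliptic_K k)"
    by (simp add: elliptic_K_def power2_eq_square)
  have "(\<lambda>n. wallis_E n * (k\<^sup>2 * (sin \<theta>)\<^sup>2) ^ n) sums sqrt (1 - k\<^sup>2 * (sin \<theta>)\<^sup>2)" for \<theta>
  proof -
    have "(\<lambda>n. ((1 / 2) gchoose n) * (- (k\<^sup>2 * (sin \<theta>)\<^sup>2)) ^ n) sums (1 + - (k\<^sup>2 * (sin \<theta>)\<^sup>2)) powr (1 / 2)"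
      using x[of \<theta>] by (intro gen_binomial_real) auto
    moreover have "((1 / 2) gchoose n) * (- (k\<^sup>2 * (sin \<theta>)\<^sup>2)) ^ n = wallis_E n * (k\<^sup>2 * (sin \<theta>)\<^sup>2) ^ n" for n
      unfolding gchoose_half power_minus[of "k\<^sup>2 * (sin \<theta>)\<^sup>2"] by (simp add: mult_ac power_mult_distrib[symmetric] del: power_mult_distrib)
    moreover have "(1 + - (k\<^sup>2 * (sin \<theta>)\<^sup>2)) powr (1 / 2) = sqrt (1 - k\<^sup>2 * (sin \<theta>)\<^sup>2)"
      using x[of \<theta>] by (simp add: powr_half_sqrt)
    ultimately show ?thesis by (simp only:)
  qed
  from sin_series_integral[OF abs_wallis_E_le_1 assms this]
  show "(\<lambda>n. (wallis n)\<^sup>2 * k ^ (2 * n) / (1 - 2 * real n)) sums (2 / pi * elliptic_E k)"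
    by (simp add: elliptic_E_def wallis_E_def power2_eq_square mult_ac)
qed

section \<open>Parseval's identity and Landen's transformation\<close>

lemma cos_even_integral:
  "((\<lambda>\<phi>. cos (2 * (real m - real n) * \<phi>)) has_integral (if m = n then pi / 2 else 0)) {0..pi/2}"
proof (cases "m = n")
  case True
  then show ?thesis using has_integral_const_real[of "1::real" 0 "pi / 2"] by simp
next
  case False
  let ?d = "2 * (real m - real n)"
  have "?d \<noteq> 0" using False by simp
  have "((\<lambda>\<phi>. cos (?d * \<phi>)) has_integral sin (?d * (pi / 2)) / ?d - sin (?d * 0) / ?d) {0..pi/2}"
  proof (rule fundamental_theorem_of_calculus)
    have "((\<lambda>\<phi>. sin (?d * \<phi>) / ?d) has_real_derivative cos (?d * \<phi>)) (at \<phi>)" for \<phi>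
      using \<open>?d \<noteq> 0\<close> by (auto intro!: derivative_eq_intros)
    then show "((\<lambda>\<phi>. sin (?d * \<phi>) / ?d) has_vector_derivative cos (?d * \<phi>)) (at \<phi> within {0..pi/2})" for \<phi>
      unfolding has_real_derivative_iff_has_vector_derivative by (rule has_vector_derivative_at_within)
  qed simp
  moreover have "sin (?d * (pi / 2)) = 0"
  proof -
    have "?d * (pi / 2) = real_of_int (int m - int n) * pi" by simp
    then show ?thesis by (simp only: sin_integer_2pi sin_zero_iff_int2) blast
  qed
  ultimately show ?thesis using False by simp
qed

text \<open>As the coefficients are real, the squared modulus of a partial sum is a double sum of
  cosines of even multiples of \<phi>. Those are orthogonal already on [0, pi/2], so half of the
  circle described by exp (2 i \<phi>) suffices, which is the range of the elliptic
  integrals.\<close>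

lemma parseval:
  fixes c :: "nat \<Rightarrow> real"
  assumes c: "\<And>n. \<bar>c n\<bar> \<le> 1" and r: "0 \<le> r" "r < 1"
    and g: "\<And>\<phi>. (\<lambda>n. of_real (c n) * (of_real r * cis (2 * \<phi>)) ^ n) sums g \<phi>"
  shows "(\<lambda>n. (c n)\<^sup>2 * r ^ (2 * n)) sums (2 / pi * integral {0..pi/2} (\<lambda>\<phi>. (cmod (g \<phi>))\<^sup>2))"
proof -
  let ?g = "\<lambda>N \<phi>. \<Sum>n<N. of_real (c n) * (of_real r * cis (2 * \<phi>)) ^ n"
  have sq: "(cmod (?g N \<phi>))\<^sup>2 = (\<Sum>m<N. \<Sum>n<N. c m * r ^ m * (c n * r ^ n) * cos (2 * (real m - real n) * \<phi>))" for N \<phi>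
  proof -
    have t: "of_real (c n) * (of_real r * cis (2 * \<phi>)) ^ n = of_real (c n * r ^ n) * cis (2 * real n * \<phi>)" for n
    proof -
      have "cis (2 * \<phi>) ^ n = cis (2 * real n * \<phi>)"
        using Complex.DeMoivre[of "2 * \<phi>" n] by (simp only: mult_ac)
      then show ?thesis by (simp add: power_mult_distrib)
    qed
    have re: "Re (?g N \<phi>) = (\<Sum>n<N. c n * r ^ n * cos (2 * real n * \<phi>))"
      and im: "Im (?g N \<phi>) = (\<Sum>n<N. c n * r ^ n * sin (2 * real n * \<phi>))"
      unfolding t by (simp_all del: of_real_mult of_real_power)
    have "(cmod z)\<^sup>2 = Re z * Re z + Im z * Im z" for z
      by (simp only: cmod_power2) (simp add: power2_eq_square)
    then have "(cmod (?g N \<phi>))\<^sup>2 = Re (?g N \<phi>) * Re (?g N \<phi>) + Im (?g N \<phi>) * Im (?g N \<phi>)" .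
    then show ?thesis
      unfolding re im sum_product sum.distrib[symmetric]
      by (elim trans, intro sum.cong refl) (simp add: left_diff_distrib right_diff_distrib cos_diff algebra_simps)
  qed
  have has: "((\<lambda>\<phi>. (cmod (?g N \<phi>))\<^sup>2) has_integral (\<Sum>n<N. pi / 2 * ((c n)\<^sup>2 * r ^ (2 * n)))) {0..pi/2}" for N
  proof -
    have "((\<lambda>\<phi>. (cmod (?g N \<phi>))\<^sup>2) has_integral
        (\<Sum>m<N. \<Sum>n<N. c m * r ^ m * (c n * r ^ n) * (if m = n then pi / 2 else 0))) {0..pi/2}"
      unfolding sq by (intro has_integral_sum has_integral_mult_right cos_even_integral) auto
    moreover have "(\<Sum>m<N. \<Sum>n<N. c m * r ^ m * (c n * r ^ n) * (if m = n then pi / 2 else 0))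
        = (\<Sum>n<N. pi / 2 * ((c n)\<^sup>2 * r ^ (2 * n)))"
    proof (intro sum.cong refl)
      fix m assume "m \<in> {..<N}"
      then have "(\<Sum>n<N. c m * r ^ m * (c n * r ^ n) * (if m = n then pi / 2 else 0)) = c m * r ^ m * (c m * r ^ m) * (pi / 2)"
        by (simp add: if_distrib[where f = "\<lambda>x. _ * x"] cong: if_cong)
      then show "(\<Sum>n<N. c m * r ^ m * (c n * r ^ n) * (if m = n then pi / 2 else 0)) = pi / 2 * ((c m)\<^sup>2 * r ^ (2 * m))"
        by (simp add: power2_eq_square mult_2 power_add)
    qed
    ultimately show ?thesis by simp
  qed
  have "(\<lambda>N. integral {0..pi/2} (\<lambda>\<phi>. (cmod (?g N \<phi>))\<^sup>2)) \<longlonglongrightarrow> integral {0..pi/2} (\<lambda>\<phi>. (cmod (g \<phi>))\<^sup>2)"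
  proof (rule dominated_convergence(2))
    show "(\<lambda>\<phi>. (cmod (?g N \<phi>))\<^sup>2) integrable_on {0..pi/2}" for N using has by blast
    show "(\<lambda>_. (1 / (1 - r))\<^sup>2) integrable_on {0..pi/2}" by (rule integrable_const_ivl)
    show "norm ((cmod (?g N \<phi>))\<^sup>2) \<le> (1 / (1 - r))\<^sup>2" for N \<phi>
    proof -
      have "norm (of_real r * cis (2 * \<phi>)) \<le> r" using r by (simp add: norm_mult)
      from geometric_dominated[OF c this r(2), where N = N]
      have "(cmod (?g N \<phi>))\<^sup>2 \<le> (1 / (1 - r))\<^sup>2" by (intro power_mono) auto
      then show ?thesis by simp
    qed
    show "(\<lambda>N. (cmod (?g N \<phi>))\<^sup>2) \<longlonglongrightarrow> (cmod (g \<phi>))\<^sup>2" for \<phi>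
      using g[of \<phi>] by (intro tendsto_intros) (simp add: sums_def)
  qed
  then have "(\<lambda>N. \<Sum>n<N. pi / 2 * ((c n)\<^sup>2 * r ^ (2 * n))) \<longlonglongrightarrow> integral {0..pi/2} (\<lambda>\<phi>. (cmod (g \<phi>))\<^sup>2)"
    by (simp only: integral_unique[OF has])
  then have "(\<lambda>n. pi / 2 * ((c n)\<^sup>2 * r ^ (2 * n))) sums integral {0..pi/2} (\<lambda>\<phi>. (cmod (g \<phi>))\<^sup>2)"
    by (simp add: sums_def)
  then have "(\<lambda>n. 2 / pi * (pi / 2 * ((c n)\<^sup>2 * r ^ (2 * n)))) sums (2 / pi * integral {0..pi/2} (\<lambda>\<phi>. (cmod (g \<phi>))\<^sup>2))"
    by (rule sums_mult)
  then show ?thesis by simp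
qed

text \<open>By cos (2 \<phi>) = 1 - 2 sin^2 \<phi>, the squared modulus of 1 + \<xi> exp (2 i
  \<phi>) is (1 + \<xi>)^2 - 4 \<xi> sin^2 \<phi>, a multiple of the radicand of an elliptic
  integral. That the modulus is below 1 is (1 - sqrt \<xi>)^2 > 0.\<close>

lemma landen_modulus:
  assumes "0 < \<xi>" "\<xi> < 1"
  shows "0 \<le> 2 * sqrt \<xi> / (1 + \<xi>)" "2 * sqrt \<xi> / (1 + \<xi>) < 1"
    "1 - (2 * sqrt \<xi> / (1 + \<xi>))\<^sup>2 * (sin \<phi>)\<^sup>2 = (cmod (1 + of_real \<xi> * cis (2 * \<phi>)) / (1 + \<xi>))\<^sup>2"
proof -
  have "0 < (1 - sqrt \<xi>)\<^sup>2" using assms by simp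
  then show "2 * sqrt \<xi> / (1 + \<xi>) < 1" using assms by (simp add: power2_diff)
  show "0 \<le> 2 * sqrt \<xi> / (1 + \<xi>)" using assms by simp
  have "(cmod (1 + of_real \<xi> * cis (2 * \<phi>)))\<^sup>2 = (1 + \<xi> * cos (2 * \<phi>))\<^sup>2 + (\<xi> * sin (2 * \<phi>))\<^sup>2"
    by (simp add: cmod_power2)
  also have "\<dots> = 1 + 2 * \<xi> * cos (2 * \<phi>) + \<xi>\<^sup>2 * ((sin (2 * \<phi>))\<^sup>2 + (cos (2 * \<phi>))\<^sup>2)"
  proof -
    have "(1 + \<xi> * c)\<^sup>2 + (\<xi> * s)\<^sup>2 = 1 + 2 * \<xi> * c + \<xi>\<^sup>2 * (s\<^sup>2 + c\<^sup>2)" for c s :: real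
      by (simp add: power2_eq_square algebra_simps)
    then show ?thesis .
  qed
  also have "\<dots> = (1 + \<xi>)\<^sup>2 - 4 * \<xi> * (sin \<phi>)\<^sup>2"
  proof -
    have "1 + 2 * \<xi> * (1 - 2 * x) + \<xi>\<^sup>2 * 1 = (1 + \<xi>)\<^sup>2 - 4 * \<xi> * x" for x
      by (simp add: power2_eq_square algebra_simps)
    then show ?thesis
      using sin_cos_squared_add[of "2 * \<phi>"] cos_double_sin[of \<phi>] by metis
  qed
  finally have "(cmod (1 + of_real \<xi> * cis (2 * \<phi>)))\<^sup>2 = (1 + \<xi>)\<^sup>2 - 4 * \<xi> * (sin \<phi>)\<^sup>2" .
  moreover have "(2 * sqrt \<xi>)\<^sup>2 = 4 * \<xi>" using assms by (simp add: power_mult_distrib)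
  moreover have "1 + \<xi> \<noteq> 0" using assms by simp
  ultimately show "1 - (2 * sqrt \<xi> / (1 + \<xi>))\<^sup>2 * (sin \<phi>)\<^sup>2 = (cmod (1 + of_real \<xi> * cis (2 * \<phi>)) / (1 + \<xi>))\<^sup>2"
    by (simp add: power_divide diff_divide_distrib)
qed

text \<open>
  Landen's transformation: with \<open>w = \<xi> e\<^sup>2\<^sup>i\<^sup>\<phi>\<close>, the integrands of the complete integrals of modulus
  \<open>2 \<surd>\<xi> / (1 + \<xi>)\<close> are multiples of \<open>\<bar>1 + w\<bar>\<^sup>-\<^sup>1\<close> and \<open>\<bar>1 + w\<bar>\<close>, that is, of the squared
  moduli of the binomial series of exponents \<open>\<plusminus>1/2\<close>.
\<close>

lemma
  assumes \<xi>: "0 < \<xi>" "\<xi> < 1"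
  shows landen_K: "elliptic_K (2 * sqrt \<xi> / (1 + \<xi>)) = (1 + \<xi>) * elliptic_K \<xi>"
    and landen_E: "(1 + \<xi>) * elliptic_E (2 * sqrt \<xi> / (1 + \<xi>)) = 2 * elliptic_E \<xi> - (1 - \<xi>\<^sup>2) * elliptic_K \<xi>"
proof -
  let ?w = "\<lambda>\<phi>. of_real \<xi> * cis (2 * \<phi>) :: complex"
  have w: "cmod (?w \<phi>) < 1" for \<phi> using \<xi> by (simp add: norm_mult)
  have pos: "0 < cmod (1 + ?w \<phi>)" for \<phi>
  proof -
    have "1 - cmod (?w \<phi>) \<le> cmod (1 + ?w \<phi>)"
      using norm_diff_ineq[of 1 "?w \<phi>"] by simp
    then show ?thesis using w[of \<phi>] by linarith
  qed
  have "(\<lambda>n. of_real ((- 1) ^ n * wallis n) * (?w \<phi>) ^ n) sums (1 + ?w \<phi>) powr (- 1 / 2)" for \<phi>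
    using gen_binomial_complex[OF w, of "- 1 / 2" \<phi>] unfolding gchoose_minus_half by simp
  from parseval[OF _ _ \<xi>(2) this] abs_wallis_le_1 \<xi>
  have "(\<lambda>n. ((- 1) ^ n * wallis n)\<^sup>2 * \<xi> ^ (2 * n)) sums
      (2 / pi * integral {0..pi/2} (\<lambda>\<phi>. (cmod ((1 + ?w \<phi>) powr (- 1 / 2)))\<^sup>2))"
    by (simp add: abs_mult)
  also have "(\<lambda>n. ((- 1) ^ n * wallis n)\<^sup>2 * \<xi> ^ (2 * n)) = (\<lambda>n. (wallis n)\<^sup>2 * \<xi> ^ (2 * n))"
    by (simp add: power_mult_distrib power_mult[symmetric])
  finally have S: "(\<lambda>n. (wallis n)\<^sup>2 * \<xi> ^ (2 * n)) sums
      (2 / pi * integral {0..pi/2} (\<lambda>\<phi>. (cmod ((1 + ?w \<phi>) powr (- 1 / 2)))\<^sup>2))" .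
  have "2 / pi * elliptic_K \<xi> = 2 / pi * integral {0..pi/2} (\<lambda>\<phi>. (cmod ((1 + ?w \<phi>) powr (- 1 / 2)))\<^sup>2)"
    by (rule sums_unique2[OF elliptic_K_sums S]) (use \<xi> in auto)
  moreover have "(cmod ((1 + ?w \<phi>) powr (- 1 / 2)))\<^sup>2 = 1 / cmod (1 + ?w \<phi>)" for \<phi>
  proof -
    have "cmod ((1 + ?w \<phi>) powr (- 1 / 2)) = cmod (1 + ?w \<phi>) powr (- 1 / 2)"
      by (subst norm_powr_real_powr') auto
    also have "\<dots> = 1 / sqrt (cmod (1 + ?w \<phi>))"
      using pos by (rule powr_minus_half)
    finally show ?thesis
      using pos[of \<phi>] by (simp only: power_divide) simp
  qed
  ultimately have K: "elliptic_K \<xi> = integral {0..pi/2} (\<lambda>\<phi>. 1 / cmod (1 + ?w \<phi>))" by simp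
  have "elliptic_K (2 * sqrt \<xi> / (1 + \<xi>)) = integral {0..pi/2} (\<lambda>\<phi>. (1 + \<xi>) * (1 / cmod (1 + ?w \<phi>)))"
    unfolding elliptic_K_def landen_modulus(3)[OF \<xi>] using \<xi> by simp
  then show "elliptic_K (2 * sqrt \<xi> / (1 + \<xi>)) = (1 + \<xi>) * elliptic_K \<xi>"
    unfolding K by (simp only: integral_mult_right)
  have "(\<lambda>n. of_real ((- 1) ^ n * wallis_E n) * (?w \<phi>) ^ n) sums (1 + ?w \<phi>) powr (1 / 2)" for \<phi>
    using gen_binomial_complex[OF w, of "1 / 2" \<phi>] unfolding gchoose_half by simp
  from parseval[OF _ _ \<xi>(2) this] abs_wallis_E_le_1 \<xi>
  have "(\<lambda>n. ((- 1) ^ n * wallis_E n)\<^sup>2 * \<xi> ^ (2 * n)) sums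
      (2 / pi * integral {0..pi/2} (\<lambda>\<phi>. (cmod ((1 + ?w \<phi>) powr (1 / 2)))\<^sup>2))"
    by (simp add: abs_mult)
  also have "(\<lambda>n. ((- 1) ^ n * wallis_E n)\<^sup>2 * \<xi> ^ (2 * n)) = (\<lambda>n. (wallis_E n)\<^sup>2 * \<xi> ^ (2 * n))"
    by (simp add: power_mult_distrib power_mult[symmetric])
  also have "(\<lambda>\<phi>. (cmod ((1 + ?w \<phi>) powr (1 / 2)))\<^sup>2) = (\<lambda>\<phi>. cmod (1 + ?w \<phi>))"
  proof
    fix \<phi>
    have "cmod ((1 + ?w \<phi>) powr (1 / 2)) = cmod (1 + ?w \<phi>) powr (1 / 2)"
      by (subst norm_powr_real_powr') auto
    then show "(cmod ((1 + ?w \<phi>) powr (1 / 2)))\<^sup>2 = cmod (1 + ?w \<phi>)"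
      using pos[of \<phi>] by (simp add: powr_half_sqrt)
  qed
  finally have E: "(\<lambda>n. (wallis_E n)\<^sup>2 * \<xi> ^ (2 * n)) sums (2 / pi * integral {0..pi/2} (\<lambda>\<phi>. cmod (1 + ?w \<phi>)))" .
  have "elliptic_E (2 * sqrt \<xi> / (1 + \<xi>)) = integral {0..pi/2} (\<lambda>\<phi>. 1 / (1 + \<xi>) * cmod (1 + ?w \<phi>))"
    unfolding elliptic_E_def landen_modulus(3)[OF \<xi>] using \<xi> by simp
  then have "elliptic_E (2 * sqrt \<xi> / (1 + \<xi>)) = 1 / (1 + \<xi>) * integral {0..pi/2} (\<lambda>\<phi>. cmod (1 + ?w \<phi>))"
    by (simp only: integral_mult_right)
  then have Ez: "(1 + \<xi>) * elliptic_E (2 * sqrt \<xi> / (1 + \<xi>)) = integral {0..pi/2} (\<lambda>\<phi>. cmod (1 + ?w \<phi>))"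
    using \<xi> by simp
  let ?b = "\<lambda>n. (wallis n)\<^sup>2 * \<xi> ^ (2 * n)"
  have sK: "?b sums (2 / pi * elliptic_K \<xi>)" and sE: "(\<lambda>n. ?b n / (1 - 2 * real n)) sums (2 / pi * elliptic_E \<xi>)"
    using elliptic_K_sums[of \<xi>] elliptic_E_sums[of \<xi>] \<xi> by auto
  \<comment> \<open>The squares of \<open>wallis_E\<close> give the terms b / m^2 with m = 1 - 2 n.
    By 1 / m^2 = 2 / m - 1 + (1 - m)^2 / m^2 they split into the series of E, the series of K, and
    this third one, which is the series of K with its index shifted; its term at n = 0 is 0.\<close>
  have sS: "(\<lambda>n. ?b n * ((2 * real n)\<^sup>2 / (2 * real n - 1)\<^sup>2)) sums (\<xi>\<^sup>2 * (2 / pi * elliptic_K \<xi>))"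
  proof -
    have "(\<lambda>n. \<xi>\<^sup>2 * ?b n) sums (\<xi>\<^sup>2 * (2 / pi * elliptic_K \<xi>))"
      using sK by (rule sums_mult)
    also have "(\<lambda>n. \<xi>\<^sup>2 * ?b n) = (\<lambda>n. ?b (Suc n) * ((2 * real (Suc n))\<^sup>2 / (2 * real (Suc n) - 1)\<^sup>2))"
    proof
      fix n
      have e: "w\<^sup>2 = (w * p / y)\<^sup>2 * (y\<^sup>2 / p\<^sup>2)" if "0 < p" "0 < y" for w p y :: real
        using that by (simp add: power_divide power_mult_distrib)
      have "(wallis n)\<^sup>2 = (wallis (Suc n))\<^sup>2 * ((2 * real n + 2)\<^sup>2 / (2 * real n + 1)\<^sup>2)"
        unfolding wallis_Suc by (rule e) auto
      moreover have "2 * real (Suc n) = 2 * real n + 2" "2 * real (Suc n) - 1 = 2 * real n + 1" by auto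
      moreover have "\<xi> ^ (2 * Suc n) = \<xi>\<^sup>2 * \<xi> ^ (2 * n)" by (simp add: power2_eq_square)
      ultimately show "\<xi>\<^sup>2 * ?b n = ?b (Suc n) * ((2 * real (Suc n))\<^sup>2 / (2 * real (Suc n) - 1)\<^sup>2)"
        by (simp only: mult_ac)
    qed
    finally show ?thesis
      by (subst (asm) sums_Suc_iff) simp
  qed
  have "(\<lambda>n. 2 * (?b n / (1 - 2 * real n)) - ?b n + ?b n * ((2 * real n)\<^sup>2 / (2 * real n - 1)\<^sup>2))
      sums (2 * (2 / pi * elliptic_E \<xi>) - 2 / pi * elliptic_K \<xi> + \<xi>\<^sup>2 * (2 / pi * elliptic_K \<xi>))"
    by (intro sums_add sums_diff sums_mult sK sE sS)
  moreover have "2 * (b / (1 - 2 * real n)) - b + b * ((2 * real n)\<^sup>2 / (2 * real n - 1)\<^sup>2) = b / (1 - 2 * real n)\<^sup>2" for b n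
  proof -
    have "2 * (b / m) - b + b * ((1 - m)\<^sup>2 / (- m)\<^sup>2) = b / m\<^sup>2" if "m \<noteq> 0" for m :: real
      using that by (simp add: field_simps power2_eq_square)
    from this[OF two_real_neq_1(2)[of n]] show ?thesis by simp
  qed
  moreover have "?b n / (1 - 2 * real n)\<^sup>2 = (wallis_E n)\<^sup>2 * \<xi> ^ (2 * n)" for n
    by (simp add: wallis_E_def power_divide)
  ultimately have "(\<lambda>n. (wallis_E n)\<^sup>2 * \<xi> ^ (2 * n))
      sums (2 * (2 / pi * elliptic_E \<xi>) - 2 / pi * elliptic_K \<xi> + \<xi>\<^sup>2 * (2 / pi * elliptic_K \<xi>))"
    by simp
  from sums_unique2[OF E this]
  have "2 / pi * integral {0..pi/2} (\<lambda>\<phi>. cmod (1 + ?w \<phi>))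
      = 2 / pi * (2 * elliptic_E \<xi> - (1 - \<xi>\<^sup>2) * elliptic_K \<xi>)"
    by (simp add: algebra_simps)
  then show "(1 + \<xi>) * elliptic_E (2 * sqrt \<xi> / (1 + \<xi>)) = 2 * elliptic_E \<xi> - (1 - \<xi>\<^sup>2) * elliptic_K \<xi>"
    unfolding Ez by simp
qed

section \<open>The uncertainty product\<close>

lemma elliptic_radicand:
  fixes \<xi> \<theta> :: real
  assumes "0 < \<xi>" "\<xi> < 1"
  shows "0 < 1 - \<xi>\<^sup>2 * (sin \<theta>)\<^sup>2" "1 - \<xi>\<^sup>2 * (sin \<theta>)\<^sup>2 \<le> 1"
proof -
  have "\<xi>\<^sup>2 * (sin \<theta>)\<^sup>2 \<le> \<xi>\<^sup>2"
    using mult_left_le[of "(sin \<theta>)\<^sup>2" "\<xi>\<^sup>2"] by (simp add: abs_square_le_1)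
  also have "\<dots> < 1" using assms by (auto simp: power_less_one_iff)
  finally show "0 < 1 - \<xi>\<^sup>2 * (sin \<theta>)\<^sup>2" by simp
qed simp

lemma elliptic_integrable:
  assumes "0 < \<xi>" "\<xi> < 1"
  shows "(\<lambda>\<theta>. 1 / sqrt (1 - \<xi>\<^sup>2 * (sin \<theta>)\<^sup>2)) integrable_on {0..pi/2}"
    "(\<lambda>\<theta>. sqrt (1 - \<xi>\<^sup>2 * (sin \<theta>)\<^sup>2)) integrable_on {0..pi/2}"
  using elliptic_radicand(1)[OF assms]
  by (auto intro!: integrable_continuous_interval continuous_intros simp: less_imp_neq[symmetric])

lemma elliptic_E_nonneg:
  assumes "0 < \<xi>" "\<xi> < 1"
  shows "0 \<le> elliptic_E \<xi>"
  unfolding elliptic_E_def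
  using elliptic_radicand(1)[OF assms] by (intro integral_nonneg elliptic_integrable assms) (auto intro: less_imp_le)

lemma elliptic_E_le:
  assumes "0 < \<xi>" "\<xi> < 1"
  shows "elliptic_E \<xi> \<le> elliptic_K \<xi>" "elliptic_E \<xi> \<le> pi / 2"
proof -
  have r: "sqrt (1 - \<xi>\<^sup>2 * (sin \<theta>)\<^sup>2) \<le> 1" "0 < sqrt (1 - \<xi>\<^sup>2 * (sin \<theta>)\<^sup>2)" for \<theta>
    using elliptic_radicand[OF assms, of \<theta>] by auto
  show "elliptic_E \<xi> \<le> elliptic_K \<xi>"
    unfolding elliptic_E_def elliptic_K_def
  proof (intro integral_le elliptic_integrable assms)
    fix \<theta> show "sqrt (1 - \<xi>\<^sup>2 * (sin \<theta>)\<^sup>2) \<le> 1 / sqrt (1 - \<xi>\<^sup>2 * (sin \<theta>)\<^sup>2)"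
      by (rule order_trans[OF r(1)], subst le_divide_eq_1_pos[OF r(2)], rule r(1))
  qed
  have "elliptic_E \<xi> \<le> integral {0..pi/2} (\<lambda>\<theta>. 1)"
    unfolding elliptic_E_def by (intro integral_le elliptic_integrable assms r(1) integrable_const_ivl)
  then show "elliptic_E \<xi> \<le> pi / 2" by simp
qed

text \<open>With \<delta> = sqrt (1 - \<xi>^2) the radicand is \<delta>^2 + \<xi>^2 cos^2 \<theta>,
  and cos \<theta> is at most pi/2 - \<theta>, so the root is at most \<delta> + (pi/2 - \<theta>).
  The reciprocal integrates to ln (\<delta> + pi/2) - ln \<delta>, where the first logarithm is
  positive. This forces K to diverge as \<xi> tends to 1.\<close>

lemma elliptic_K_ge:
  assumes "0 < \<xi>" "\<xi> < 1"
  shows "- ln (sqrt (1 - \<xi>\<^sup>2)) < elliptic_K \<xi>"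
proof -
  define \<delta> where "\<delta> = sqrt (1 - \<xi>\<^sup>2)"
  have \<xi>2: "\<xi>\<^sup>2 < 1" using assms by (auto simp: power_less_one_iff)
  then have \<delta>: "0 < \<delta>" "\<delta>\<^sup>2 = 1 - \<xi>\<^sup>2" by (auto simp: \<delta>_def)
  have has: "((\<lambda>\<theta>. 1 / (\<delta> + (pi / 2 - \<theta>))) has_integral - ln (\<delta> + (pi / 2 - pi / 2)) - - ln (\<delta> + (pi / 2 - 0))) {0..pi/2}"
  proof (rule fundamental_theorem_of_calculus)
    fix \<theta> assume "\<theta> \<in> {0..pi/2}"
    then have "0 < \<delta> + (pi / 2 - \<theta>)" using \<delta>(1) by simp
    then have "((\<lambda>\<theta>. - ln (\<delta> + (pi / 2 - \<theta>))) has_real_derivative 1 / (\<delta> + (pi / 2 - \<theta>))) (at \<theta>)"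
      by (auto intro!: derivative_eq_intros)
    then show "((\<lambda>\<theta>. - ln (\<delta> + (pi / 2 - \<theta>))) has_vector_derivative 1 / (\<delta> + (pi / 2 - \<theta>))) (at \<theta> within {0..pi/2})"
      unfolding has_real_derivative_iff_has_vector_derivative by (rule has_vector_derivative_at_within)
  qed simp
  have "ln (\<delta> + pi / 2) - ln \<delta> = integral {0..pi/2} (\<lambda>\<theta>. 1 / (\<delta> + (pi / 2 - \<theta>)))"
    using integral_unique[OF has] by simp
  also have "\<dots> \<le> elliptic_K \<xi>"
    unfolding elliptic_K_def
  proof (intro integral_le elliptic_integrable assms has_integral_integrable[OF has])
    fix \<theta> assume \<theta>: "\<theta> \<in> {0..pi/2}"
    define \<tau> where "\<tau> = pi / 2 - \<theta>"
    have "0 \<le> \<tau>" using \<theta> by (simp add: \<tau>_def)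
    have "cos \<theta> = sin \<tau>" by (simp add: \<tau>_def sin_cos_eq)
    then have c: "cos \<theta> \<le> \<tau>" using sin_x_le_x[OF \<open>0 \<le> \<tau>\<close>] by simp
    have "0 \<le> cos \<theta>" using \<theta> by (intro cos_ge_zero) auto
    have "1 - \<xi>\<^sup>2 * (sin \<theta>)\<^sup>2 = \<delta>\<^sup>2 + \<xi>\<^sup>2 * (cos \<theta>)\<^sup>2"
      unfolding \<delta>(2) sin_squared_eq by (simp add: algebra_simps)
    also have "\<dots> \<le> \<delta>\<^sup>2 + 1 * \<tau>\<^sup>2"
      using c \<open>0 \<le> cos \<theta>\<close> \<xi>2 by (intro add_left_mono mult_mono power_mono) auto
    also have "\<dots> \<le> (\<delta> + \<tau>)\<^sup>2"
      using \<delta>(1) \<open>0 \<le> \<tau>\<close> by (simp add: power2_sum)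
    finally have "sqrt (1 - \<xi>\<^sup>2 * (sin \<theta>)\<^sup>2) \<le> \<delta> + \<tau>"
      using \<delta>(1) \<open>0 \<le> \<tau>\<close> by (intro real_le_lsqrt) auto
    then show "1 / (\<delta> + (pi / 2 - \<theta>)) \<le> 1 / sqrt (1 - \<xi>\<^sup>2 * (sin \<theta>)\<^sup>2)"
      using elliptic_radicand(1)[OF assms, of \<theta>] \<delta>(1) \<open>0 \<le> \<tau>\<close> unfolding \<tau>_def
      by (intro divide_left_mono mult_pos_pos) auto
  qed
  finally have "ln (\<delta> + pi / 2) - ln \<delta> \<le> elliptic_K \<xi>" .
  moreover have "0 < ln (\<delta> + pi / 2)"
    using \<delta>(1) pi_gt3 by (intro ln_gt_zero) linarith
  ultimately show ?thesis unfolding \<delta>_def by linarith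
qed

lemma elliptic_K_pos:
  assumes "0 < \<xi>" "\<xi> < 1"
  shows "0 < elliptic_K \<xi>"
proof -
  have "\<xi>\<^sup>2 < 1" using assms by (auto simp: power_less_one_iff)
  then have "ln (sqrt (1 - \<xi>\<^sup>2)) \<le> 0" by simp
  then show ?thesis using elliptic_K_ge[OF assms] by linarith
qed

text \<open>The norm is a multiple of K(z) and the integral of P^2 a multiple of K(z) + E(z), with
  Landen's modulus z, because \<open>ratio\<close> is z^2. Landen's transformation then returns to
  modulus \<xi>.\<close>

lemma psi_fam_product:
  assumes \<xi>: "0 < \<xi>" "\<xi> < 1"
  shows "psi_fam \<xi> \<in> spherical_states"
    and "sigma_xp (psi_fam \<xi>) * sigma_px (psi_fam \<xi>) =
      1/4 + 1/4 * (- (1 / (1 + \<xi>)) + 1 / (1 + \<xi>)\<^sup>2 * (elliptic_E \<xi> / elliptic_K \<xi>))"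
proof -
  define A where "A = (1 + \<xi>) / (1 - \<xi>)"
  define B where "B = sqrt \<xi> / (1 - \<xi>)"
  define z where "z = 2 * sqrt \<xi> / (1 + \<xi>)"
  define C where "C = 1 / sqrt (2 * elliptic_K \<xi> * (1 - \<xi>))"
  have z: "0 \<le> z" "z < 1" unfolding z_def using landen_modulus[OF \<xi>] by auto
  interpret bessel_profile A B
  proof
    show "0 < B" using \<xi> by (simp add: B_def)
    have "sqrt \<xi> < (1 + \<xi>) / 2" using z(2) \<xi> unfolding z_def by (simp add: field_simps)
    then have "sqrt \<xi> / (1 - \<xi>) < (1 + \<xi>) / 2 / (1 - \<xi>)"
      using \<xi> by (intro divide_strict_right_mono) auto
    then show "B < A / 2" by (simp add: A_def B_def mult.commute)
    show "A\<^sup>2 - 4 * B\<^sup>2 = 1"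
    proof -
      have "A\<^sup>2 - 4 * B\<^sup>2 = ((1 + \<xi>)\<^sup>2 - 4 * \<xi>) / (1 - \<xi>)\<^sup>2"
        using \<xi> by (simp add: A_def B_def power_divide diff_divide_distrib)
      also have "(1 + \<xi>)\<^sup>2 - 4 * \<xi> = (1 - \<xi>)\<^sup>2" by (simp add: power2_eq_square algebra_simps)
      finally show ?thesis using \<xi> by simp
    qed
  qed
  have K: "0 < elliptic_K \<xi>" by (rule elliptic_K_pos[OF \<xi>])
  have C2: "C\<^sup>2 = 1 / (2 * elliptic_K \<xi> * (1 - \<xi>))"
    using K \<xi> by (simp add: C_def power_divide)
  have ratio: "ratio ^ n = z ^ (2 * n)" for n
  proof -
    have "2 * B / A = z" using \<xi> by (simp add: A_def B_def z_def)
    then show ?thesis by (simp add: ratio_def power_mult)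
  qed
  have m0: "A * moment 0 = 2 / pi * elliptic_K z"
    using sums_unique2[OF norm_sums[unfolded ratio] elliptic_K_sums[OF z]] .
  have mP: "4 * A * (LINT s|lborel. indicator {0..} s * (P s)\<^sup>2) = 2 / pi * elliptic_K z + 2 / pi * elliptic_E z"
  proof (rule sums_unique2[OF P_sums[unfolded ratio]])
    show "(\<lambda>n. (wallis n)\<^sup>2 * z ^ (2 * n) * (1 + 1 / (1 - 2 * real n))) sums (2 / pi * elliptic_K z + 2 / pi * elliptic_E z)"
      using sums_add[OF elliptic_K_sums[OF z] elliptic_E_sums[OF z]] by (simp add: distrib_left)
  qed
  let ?u = "\<lambda>s. C * U s" and ?u' = "\<lambda>s. C * U' s"
  have psi: "psi_fam \<xi> p = complex_of_real (?u (rsq p))" for p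
  proof -
    obtain x y where p: "p = (x, y)" by (cases p)
    have "U (rsq p) = exp (- ((1 + \<xi>) / (1 - \<xi>)) * ((x\<^sup>2 + y\<^sup>2) / 2)) * bessel_I0 (sqrt \<xi> / (1 - \<xi>) * (x\<^sup>2 + y\<^sup>2))"
      unfolding U_def decay_def warg_def bessel_I0_bes power_mult_distrib
      by (simp add: A_def B_def rsq_def p power_mult_distrib)
    then show ?thesis
      by (simp only: psi_fam_def p prod.case C_def mult.assoc)
  qed
  have du: "(?u has_real_derivative ?u' s) (at s)" for s
    by (intro DERIV_cmult DERIV_U)
  have cu: "continuous_on UNIV ?u'"
    by (intro continuous_on_mult continuous_on_const continuous_U')
  have sq: "(\<lambda>s. indicator {0..} s * (?u s)\<^sup>2) = (\<lambda>s. C\<^sup>2 * (indicator {0..} s * (s ^ 0 * (U s)\<^sup>2)))"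
    by (simp add: fun_eq_iff power_mult_distrib)
  have sq': "(\<lambda>s. indicator {0..} s * (s * ?u' s)\<^sup>2) = (\<lambda>s. C\<^sup>2 * (indicator {0..} s * (P s)\<^sup>2))"
    by (simp add: fun_eq_iff P_eq power_mult_distrib)
  have int: "integrable lborel (\<lambda>s. indicator {0..} s * (?u s)\<^sup>2)"
    unfolding sq by (intro integrable_mult_right moment_integrable)
  have int': "integrable lborel (\<lambda>s. indicator {0..} s * (s * ?u' s)\<^sup>2)"
    unfolding sq' by (intro integrable_mult_right P_square_integrable)
  \<comment> \<open>The factor 1 + \<xi> from Landen's transformation of K cancels A (1 - \<xi>);
    this accounts for the normalising constant of \<open>psi_fam\<close>.\<close>
  have one: "pi * (LINT s|lborel. indicator {0..} s * (?u s)\<^sup>2) = 1"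
  proof -
    have A1: "A * (1 - \<xi>) = 1 + \<xi>" using \<xi> by (simp add: A_def)
    have "A * moment 0 = 2 / pi * (A * (1 - \<xi>) * elliptic_K \<xi>)"
      unfolding m0 z_def landen_K[OF \<xi>] A1 ..
    also have "\<dots> = A * (2 / pi * (1 - \<xi>) * elliptic_K \<xi>)" by simp
    finally have "A * moment 0 = A * (2 / pi * (1 - \<xi>) * elliptic_K \<xi>)" .
    then have m: "moment 0 = 2 / pi * (1 - \<xi>) * elliptic_K \<xi>"
      unfolding mult_cancel_left using A_pos by (elim disjE) auto
    show ?thesis
      unfolding sq integral_mult_right_zero moment_def[symmetric] m C2 using K \<xi> by simp
  qed
  note rs = radial_spherical[OF du cu psi int one int']
  show "psi_fam \<xi> \<in> spherical_states" by (rule rs(1))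
  have Ez: "elliptic_E z = (2 * elliptic_E \<xi> - (1 - \<xi>\<^sup>2) * elliptic_K \<xi>) / (1 + \<xi>)"
    using landen_E[OF \<xi>] \<xi> unfolding z_def[symmetric] by (simp add: field_simps)
  have Kz: "elliptic_K z = (1 + \<xi>) * elliptic_K \<xi>"
    unfolding z_def by (rule landen_K[OF \<xi>])
  have PI: "(LINT s|lborel. indicator {0..} s * (P s)\<^sup>2) = (elliptic_K z + elliptic_E z) / (2 * pi * A)"
    using mP A_pos by (simp add: field_simps)
  have "sigma_xp (psi_fam \<xi>) * sigma_px (psi_fam \<xi>) = pi / 2 * (C\<^sup>2 * ((elliptic_K z + elliptic_E z) / (2 * pi * A)))"
    unfolding rs(2) sq' integral_mult_right_zero PI ..
  also have "\<dots> = (elliptic_K z + elliptic_E z) / (8 * elliptic_K \<xi> * (1 + \<xi>))"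
  proof -
    have "pi / 2 * (1 / (2 * k * d) * (t / (2 * pi * (x / d)))) = t / (8 * k * x)"
      if "k \<noteq> 0" "d \<noteq> 0" "x \<noteq> 0" for k d x t :: real
      using that by (simp add: field_simps)
    then show ?thesis
      unfolding C2 A_def using K \<xi> by simp
  qed
  also have "\<dots> = 1/4 + 1/4 * (- (1 / (1 + \<xi>)) + 1 / (1 + \<xi>)\<^sup>2 * (elliptic_E \<xi> / elliptic_K \<xi>))"
  proof -
    \<comment> \<open>A rational identity in x = 1 + \<xi>, so 1 - \<xi>^2 is written as 1 - (x -
      1)^2.\<close>
    have "(x * k + (2 * e - (1 - (x - 1)\<^sup>2) * k) / x) / (8 * k * x) = 1/4 + 1/4 * (- (1 / x) + 1 / x\<^sup>2 * (e / k))"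
      if "k \<noteq> 0" "x \<noteq> 0" for k x e :: real
      using that by (simp add: field_simps power2_eq_square)
    from this[of "elliptic_K \<xi>" "1 + \<xi>"] show ?thesis
      unfolding Ez Kz using K \<xi> by simp
  qed
  finally show "sigma_xp (psi_fam \<xi>) * sigma_px (psi_fam \<xi>) =
      1/4 + 1/4 * (- (1 / (1 + \<xi>)) + 1 / (1 + \<xi>)\<^sup>2 * (elliptic_E \<xi> / elliptic_K \<xi>))" .
qed

text \<open>E is at most K, because its integrand is at most 1 and that of K is the reciprocal; and
  the square of 1 / (1 + \<xi>) is smaller than the number itself.\<close>

lemma psi_fam_product_less:
  assumes "0 < \<xi>" "\<xi> < 1"
  shows "sigma_xp (psi_fam \<xi>) * sigma_px (psi_fam \<xi>) < 1/4"
proof -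
  have "elliptic_E \<xi> / elliptic_K \<xi> \<le> 1"
    using elliptic_E_le(1)[OF assms] elliptic_K_pos[OF assms] by simp
  then have "1 / (1 + \<xi>)\<^sup>2 * (elliptic_E \<xi> / elliptic_K \<xi>) \<le> 1 / (1 + \<xi>)\<^sup>2 * 1"
    by (intro mult_left_mono) auto
  also have "\<dots> < 1 / (1 + \<xi>)"
    using assms by (simp add: power2_eq_square divide_simps)
  finally have less: "1 / (1 + \<xi>)\<^sup>2 * (elliptic_E \<xi> / elliptic_K \<xi>) < 1 / (1 + \<xi>)" .
  have "1/4 + 1/4 * (- a + x) < 1/4" if "x < a" for a x :: real
    using that by simp
  from this[OF less] show ?thesis
    unfolding psi_fam_product(2)[OF assms] .
qed

text \<open>E stays below pi/2, while K exceeds - ln (sqrt (1 - \<xi>^2)), which diverges.\<close>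

lemma elliptic_quotient_tendsto: "((\<lambda>\<xi>. elliptic_E \<xi> / elliptic_K \<xi>) \<longlongrightarrow> 0) (at_left 1)"
proof -
  have ev: "\<forall>\<^sub>F \<xi>::real in at_left 1. 0 < \<xi> \<and> \<xi> < 1"
    using eventually_at_left_real[of 0 1] by simp
  have "filterlim (\<lambda>\<xi>::real. sqrt (1 - \<xi>\<^sup>2)) (at_right 0) (at_left 1)"
    unfolding filterlim_at
  proof
    show "\<forall>\<^sub>F \<xi>::real in at_left 1. sqrt (1 - \<xi>\<^sup>2) \<in> {0<..} \<and> sqrt (1 - \<xi>\<^sup>2) \<noteq> 0"
      using ev
    proof eventually_elim
      fix \<xi> :: real assume "0 < \<xi> \<and> \<xi> < 1"
      then have "\<xi>\<^sup>2 < 1" by (auto simp: power_less_one_iff)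
      then show "sqrt (1 - \<xi>\<^sup>2) \<in> {0<..} \<and> sqrt (1 - \<xi>\<^sup>2) \<noteq> 0" by simp
    qed
    have "((\<lambda>\<xi>::real. sqrt (1 - \<xi>\<^sup>2)) \<longlongrightarrow> sqrt (1 - 1\<^sup>2)) (at_left 1)"
      by (intro tendsto_intros)
    then show "((\<lambda>\<xi>::real. sqrt (1 - \<xi>\<^sup>2)) \<longlongrightarrow> 0) (at_left 1)" by simp
  qed
  then have "filterlim (\<lambda>\<xi>::real. - ln (sqrt (1 - \<xi>\<^sup>2))) at_top (at_left 1)"
    unfolding filterlim_uminus_at_bot[symmetric] by (rule filterlim_compose[OF ln_at_0])
  then have K: "filterlim elliptic_K at_top (at_left 1)"
    by (rule filterlim_at_top_mono) (use ev in \<open>eventually_elim; auto intro: less_imp_le elliptic_K_ge\<close>)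
  have upper: "((\<lambda>\<xi>. pi / 2 / elliptic_K \<xi>) \<longlongrightarrow> 0) (at_left 1)"
    by (intro real_tendsto_divide_at_top[OF tendsto_const] K)
  show ?thesis
  proof (rule tendsto_sandwich[OF _ _ tendsto_const upper])
    show "\<forall>\<^sub>F \<xi> in at_left 1. 0 \<le> elliptic_E \<xi> / elliptic_K \<xi>"
      using ev by eventually_elim (auto intro!: divide_nonneg_pos elliptic_E_nonneg elliptic_K_pos)
    show "\<forall>\<^sub>F \<xi> in at_left 1. elliptic_E \<xi> / elliptic_K \<xi> \<le> pi / 2 / elliptic_K \<xi>"
      using ev by eventually_elim (intro divide_right_mono elliptic_E_le(2) less_imp_le[OF elliptic_K_pos]; simp)
  qed
qed

lemma psi_fam_product_tendsto:
  "((\<lambda>\<xi>. sigma_xp (psi_fam \<xi>) * sigma_px (psi_fam \<xi>)) \<longlongrightarrow> 1/8) (at_left 1)"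
proof -
  have "((\<lambda>\<xi>::real. 1/4 + 1/4 * (- (1 / (1 + \<xi>)) + 1 / (1 + \<xi>)\<^sup>2 * (elliptic_E \<xi> / elliptic_K \<xi>)))
      \<longlongrightarrow> 1/4 + 1/4 * (- (1 / (1 + 1)) + 1 / (1 + 1)\<^sup>2 * 0)) (at_left 1)"
    by (intro tendsto_intros elliptic_quotient_tendsto) auto
  then have "((\<lambda>\<xi>::real. 1/4 + 1/4 * (- (1 / (1 + \<xi>)) + 1 / (1 + \<xi>)\<^sup>2 * (elliptic_E \<xi> / elliptic_K \<xi>))) \<longlongrightarrow> 1/8) (at_left 1)"
    by simp
  moreover have "\<forall>\<^sub>F \<xi>::real in at_left 1.
      1/4 + 1/4 * (- (1 / (1 + \<xi>)) + 1 / (1 + \<xi>)\<^sup>2 * (elliptic_E \<xi> / elliptic_K \<xi>))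
      = sigma_xp (psi_fam \<xi>) * sigma_px (psi_fam \<xi>)"
    using eventually_at_left_real[of 0 "1::real", OF zero_less_one] by (rule eventually_mono) (auto simp: psi_fam_product(2))
  ultimately show ?thesis by (rule Lim_transform_eventually)
qed

theorem mainTheorem2:
  shows "bdd_below ((\<lambda>\<psi>. sigma_xp \<psi> * sigma_px \<psi>) ` spherical_states) \<and>
         (INF \<psi>\<in>spherical_states. sigma_xp \<psi> * sigma_px \<psi>) = 1/8 \<and>
         \<not> (\<exists>\<psi>\<in>spherical_states. sigma_xp \<psi> * sigma_px \<psi> = 1/8) \<and>
         (\<forall>\<xi>::real. 0 < \<xi> \<and> \<xi> < 1 \<longrightarrow>
           psi_fam \<xi> \<in> spherical_states \<and>
           sigma_xp (psi_fam \<xi>) * sigma_px (psi_fam \<xi>) =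
             1/4 + 1/4 * (- (1 / (1 + \<xi>)) + 1 / (1 + \<xi>)\<^sup>2 * (elliptic_E \<xi> / elliptic_K \<xi>)) \<and>
           sigma_xp (psi_fam \<xi>) * sigma_px (psi_fam \<xi>) < 1/4) \<and>
         ((\<lambda>\<xi>. sigma_xp (psi_fam \<xi>) * sigma_px (psi_fam \<xi>)) \<longlongrightarrow> 1/8) (at_left 1)"
proof (intro conjI allI impI)
  let ?f = "\<lambda>\<psi>. sigma_xp \<psi> * sigma_px \<psi>"
  show bdd: "bdd_below (?f ` spherical_states)"
    using spherical_product_gt by (intro bdd_belowI2[of _ "1/8"]) (auto intro: less_imp_le)
  \<comment> \<open>The infimum is taken in the conditionally complete reals, so the lower estimate
    requires a nonempty set; any member of the family will do.\<close>
  have ne: "spherical_states \<noteq> {}"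
    using psi_fam_product(1)[of "1/2"] by auto
  show "(INF \<psi>\<in>spherical_states. ?f \<psi>) = 1/8"
  proof (rule antisym)
    have ev: "\<forall>\<^sub>F \<xi> in at_left 1. (INF \<psi>\<in>spherical_states. ?f \<psi>) \<le> ?f (psi_fam \<xi>)"
      using eventually_at_left_real[of 0 "1::real", OF zero_less_one]
      by (rule eventually_mono) (auto intro!: cINF_lower[OF bdd] psi_fam_product(1))
    \<comment> \<open>The infimum lies below every product of the family, hence below their
      limit.\<close>
    show "(INF \<psi>\<in>spherical_states. ?f \<psi>) \<le> 1/8"
      by (rule tendsto_lowerbound[OF psi_fam_product_tendsto ev]) simp
    show "1/8 \<le> (INF \<psi>\<in>spherical_states. ?f \<psi>)"
      using ne spherical_product_gt by (intro cINF_greatest) (auto intro: less_imp_le)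
  qed
  show "\<not> (\<exists>\<psi>\<in>spherical_states. ?f \<psi> = 1/8)"
    using spherical_product_gt by fastforce
qed (use psi_fam_product psi_fam_product_less psi_fam_product_tendsto in auto)

end
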